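(* There is a parallel algorithm which, given $\varepsilon\in(0,1)$ and a finite undirected graph $G=\langle V,E\rangle$ with at least one edge and with maximum degree $\Delta$, finds a $(1+\varepsilon)$-approximation to the maximum subgraph density $\rho_G^*$ of $G$ in parallel time $\widetilde{O}(\Delta\,\varepsilon^{-1})$ and total work $\widetilde{O}(\Delta\,|E|\,\varepsilon^{-1})$.
   Context: The density of a graph is its number of edges divided by its number of vertices (half the average degree). The maximum subgraph density of $G=\langle V,E\rangle$ is $$\rho_G^*=\max_{\emptyset\ne S\subseteq V}\frac{|E(S)|}{|S|},$$ where $E(S)$ is the set of edges of the subgraph of $G$ induced by $S$. A $(1+\varepsilon)$-approximation to $\rho_G^*$ is a number $\tilde\rho$ with $\rho_G^*/(1+\varepsilon)\le\tilde\rho\le(1+\varepsilon)\rho_G^*$. Parallel time (depth) is the length of the longest chain of dependent operations, and total work is the total number of operations; operations are unit-cost real operations (arithmetic, comparison, $\exp$, $\log$). The notation $\widetilde{O}(\cdot)$ hides factors polylogarithmic in $|V|$, $|E|$ and $1/\varepsilon$. *)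

theory Defs
  imports Complex_Main
begin

section \<open>Maximum subgraph density\<close>

definition simple_graph :: "'a set \<Rightarrow> 'a set set \<Rightarrow> bool" where
  "simple_graph V E \<longleftrightarrow> finite V \<and> (\<forall>e\<in>E. e \<subseteq> V \<and> card e = 2)"

definition induced_edges :: "'a set set \<Rightarrow> 'a set \<Rightarrow> 'a set set" where
  "induced_edges E S = {e \<in> E. e \<subseteq> S}"

definition max_subgraph_density :: "'a set \<Rightarrow> 'a set set \<Rightarrow> real" where
  "max_subgraph_density V E =
     Max ((\<lambda>S. real (card (induced_edges E S)) / real (card S)) ` {S. S \<subseteq> V \<and> S \<noteq> {}})"

definition vertex_degree :: "'a set set \<Rightarrow> 'a \<Rightarrow> nat" where
  "vertex_degree E v = card {e \<in> E. v \<in> e}"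

definition max_degree :: "'a set \<Rightarrow> 'a set set \<Rightarrow> nat" where
  "max_degree V E = Max (vertex_degree E ` V)"

definition approximates :: "real \<Rightarrow> real \<Rightarrow> real \<Rightarrow> bool" where
  "approximates \<epsilon> \<rho> r \<longleftrightarrow> \<rho> / (1 + \<epsilon>) \<le> r \<and> r \<le> (1 + \<epsilon>) * \<rho>"

section \<open>A work-depth model with unit-cost real operations\<close>

text \<open>
  Programs are finite syntax trees over real scalars and arrays of reals. The only source of
  parallelism is the array assignment, in which one processor per entry evaluates an expression
  in the old store and writes its own entry of the new array. Reads may be concurrent and writes
  never collide, so this is a fragment of the CREW PRAM. Program constants are integers: an
  arbitrary real constant could serve as an infinite advice string.
\<close>

type_synonym vname = string

record store =
  scalars :: "vname \<Rightarrow> real"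
  arrays  :: "vname \<Rightarrow> real list"

datatype expr =
    Lit int
  | Scalar vname
  | Self  \<comment> \<open>index of the executing processor; 0 outside array assignments\<close>
  | Len vname
  | Read vname expr
  | Add expr expr
  | Sub expr expr
  | Mul expr expr
  | Quot expr expr
  | EExp expr
  | ELog expr
  | IfLess expr expr expr expr

datatype com =
    Nop
  | Assign vname expr
  | ParAssign vname expr expr  \<comment> \<open>array, number of entries, entry as a function of \<open>Self\<close>\<close>
  | Seq com com
  | CondLess expr expr com com
  | WhileLess expr expr com

text \<open>
  Reads are checked: an index that is not a natural number below the length yields 0. Rounding
  is not an operation of the model; the ceiling of \<open>r\<close> is available only as the length of an array
  built with that many processors.
\<close>

definition array_read :: "real list \<Rightarrow> real \<Rightarrow> real" where
  "array_read xs r = (if r \<in> \<nat> \<and> r < real (length xs) then xs ! nat \<lfloor>r\<rfloor> else 0)"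

primrec expr_val :: "expr \<Rightarrow> store \<Rightarrow> nat \<Rightarrow> real" where
  "expr_val (Lit z) s i = of_int z"
| "expr_val (Scalar x) s i = scalars s x"
| "expr_val Self s i = real i"
| "expr_val (Len a) s i = real (length (arrays s a))"
| "expr_val (Read a e) s i = array_read (arrays s a) (expr_val e s i)"
| "expr_val (Add e f) s i = expr_val e s i + expr_val f s i"
| "expr_val (Sub e f) s i = expr_val e s i - expr_val f s i"
| "expr_val (Mul e f) s i = expr_val e s i * expr_val f s i"
| "expr_val (Quot e f) s i = expr_val e s i / expr_val f s i"
| "expr_val (EExp e) s i = exp (expr_val e s i)"
| "expr_val (ELog e) s i = ln (expr_val e s i)"
| "expr_val (IfLess e f g h) s i =
     (if expr_val e s i < expr_val f s i then expr_val g s i else expr_val h s i)"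

text \<open>Both branches of a conditional expression are charged.\<close>

primrec expr_work :: "expr \<Rightarrow> nat" where
  "expr_work (Lit z) = 1"
| "expr_work (Scalar x) = 1"
| "expr_work Self = 1"
| "expr_work (Len a) = 1"
| "expr_work (Read a e) = 1 + expr_work e"
| "expr_work (Add e f) = 1 + expr_work e + expr_work f"
| "expr_work (Sub e f) = 1 + expr_work e + expr_work f"
| "expr_work (Mul e f) = 1 + expr_work e + expr_work f"
| "expr_work (Quot e f) = 1 + expr_work e + expr_work f"
| "expr_work (EExp e) = 1 + expr_work e"
| "expr_work (ELog e) = 1 + expr_work e"
| "expr_work (IfLess e f g h) = 1 + expr_work e + expr_work f + expr_work g + expr_work h"

primrec expr_depth :: "expr \<Rightarrow> nat" where
  "expr_depth (Lit z) = 1"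
| "expr_depth (Scalar x) = 1"
| "expr_depth Self = 1"
| "expr_depth (Len a) = 1"
| "expr_depth (Read a e) = 1 + expr_depth e"
| "expr_depth (Add e f) = 1 + max (expr_depth e) (expr_depth f)"
| "expr_depth (Sub e f) = 1 + max (expr_depth e) (expr_depth f)"
| "expr_depth (Mul e f) = 1 + max (expr_depth e) (expr_depth f)"
| "expr_depth (Quot e f) = 1 + max (expr_depth e) (expr_depth f)"
| "expr_depth (EExp e) = 1 + expr_depth e"
| "expr_depth (ELog e) = 1 + expr_depth e"
| "expr_depth (IfLess e f g h) =
     1 + max (max (expr_depth e) (expr_depth f)) (max (expr_depth g) (expr_depth h))"

text \<open>
  \<open>runs c s w d t\<close>: started in store \<open>s\<close>, the program \<open>c\<close> terminates in store \<open>t\<close> after \<open>w\<close>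
  operations in total, the longest dependent chain having length at most \<open>d\<close>. An array assignment
  with bound \<open>r\<close> has one processor for every natural number less than \<open>r\<close>.
\<close>

inductive runs :: "com \<Rightarrow> store \<Rightarrow> nat \<Rightarrow> nat \<Rightarrow> store \<Rightarrow> bool" where
  Nop: "runs Nop s 0 0 s"
| Assign: "runs (Assign x e) s (1 + expr_work e) (1 + expr_depth e)
     (s\<lparr>scalars := (scalars s)(x := expr_val e s 0)\<rparr>)"
| ParAssign: "p = nat \<lceil>expr_val b s 0\<rceil> \<Longrightarrow>
   runs (ParAssign a b e) s
     (1 + expr_work b + p * (1 + expr_work e)) (1 + expr_depth b + (1 + expr_depth e))
     (s\<lparr>arrays := (arrays s)(a := map (expr_val e s) [0..<p])\<rparr>)"
| Seq: "runs c s w d t \<Longrightarrow> runs c' t w' d' u \<Longrightarrow> runs (Seq c c') s (w + w') (d + d') u"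
| CondTrue: "expr_val e s 0 < expr_val f s 0 \<Longrightarrow> runs c s w d t \<Longrightarrow>
   runs (CondLess e f c c') s
     (1 + expr_work e + expr_work f + w) (1 + max (expr_depth e) (expr_depth f) + d) t"
| CondFalse: "\<not> expr_val e s 0 < expr_val f s 0 \<Longrightarrow> runs c' s w d t \<Longrightarrow>
   runs (CondLess e f c c') s
     (1 + expr_work e + expr_work f + w) (1 + max (expr_depth e) (expr_depth f) + d) t"
| WhileFalse: "\<not> expr_val e s 0 < expr_val f s 0 \<Longrightarrow>
   runs (WhileLess e f c) s
     (1 + expr_work e + expr_work f) (1 + max (expr_depth e) (expr_depth f)) s"
| WhileTrue: "expr_val e s 0 < expr_val f s 0 \<Longrightarrow> runs c s w d t \<Longrightarrow>
   runs (WhileLess e f c) t w' d' u \<Longrightarrow>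
   runs (WhileLess e f c) s
     (1 + expr_work e + expr_work f + w + w')
     (1 + max (expr_depth e) (expr_depth f) + d + d') u"

lemma runs_deterministic:
  "runs c s w d t \<Longrightarrow> runs c s w' d' t' \<Longrightarrow> w' = w \<and> d' = d \<and> t' = t"
proof (induction arbitrary: w' d' t' rule: runs.induct)
  case (Seq c s w1 d1 t c' w2 d2 u)
  from Seq.prems obtain wa da ta wb db where
    *: "w' = wa + wb" "d' = da + db" "runs c s wa da ta" "runs c' ta wb db t'"
    by (cases rule: runs.cases) auto
  from Seq.IH(1)[OF *(3)] have **: "wa = w1" "da = d1" "ta = t" by simp_all
  from Seq.IH(2)[OF *(4)[unfolded **]] show ?case using *(1,2) ** by simp
next
  case (WhileTrue e s f c w1 d1 t w2 d2 u)
  from WhileTrue.prems WhileTrue.hyps(1) obtain wa da ta wb db where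
    *: "w' = 1 + expr_work e + expr_work f + wa + wb"
       "d' = 1 + max (expr_depth e) (expr_depth f) + da + db"
       "runs c s wa da ta" "runs (WhileLess e f c) ta wb db t'"
    by (cases rule: runs.cases) auto
  from WhileTrue.IH(1)[OF *(3)] have **: "wa = w1" "da = d1" "ta = t" by simp_all
  from WhileTrue.IH(2)[OF *(4)[unfolded **]] show ?case using *(1,2) ** by simp
next
  case (CondTrue e s f c w1 d1 t c')
  from CondTrue.prems CondTrue.hyps(1) obtain wa da where
    *: "w' = 1 + expr_work e + expr_work f + wa"
       "d' = 1 + max (expr_depth e) (expr_depth f) + da" "runs c s wa da t'"
    by (cases rule: runs.cases) auto
  from CondTrue.IH[OF *(3)] show ?case using *(1,2) by simp
next
  case (CondFalse e s f c' w1 d1 t c)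
  from CondFalse.prems CondFalse.hyps(1) obtain wa da where
    *: "w' = 1 + expr_work e + expr_work f + wa"
       "d' = 1 + max (expr_depth e) (expr_depth f) + da" "runs c' s wa da t'"
    by (cases rule: runs.cases) auto
  from CondFalse.IH[OF *(3)] show ?case using *(1,2) by simp
qed (erule runs.cases; simp)+

section \<open>Graphs as inputs\<close>

text \<open>
  The vertices are numbered by their positions in the list \<open>vs\<close>; \<open>nb ! i\<close> lists the numbers of the
  neighbours of vertex number \<open>i\<close>, in any order.
\<close>

definition adjacency_lists :: "'a set \<Rightarrow> 'a set set \<Rightarrow> 'a list \<Rightarrow> nat list list \<Rightarrow> bool" where
  "adjacency_lists V E vs nb \<longleftrightarrow>
     distinct vs \<and> set vs = V \<and> length nb = length vs \<and>
     (\<forall>i<length vs. distinct (nb ! i) \<and>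
        set (nb ! i) = {j. j < length vs \<and> {vs ! i, vs ! j} \<in> E})"

text \<open>
  The adjacency lists are concatenated into the array \<open>adj\<close>; entry \<open>i\<close> of the array \<open>off\<close>, for
  \<open>i\<close> up to and including the number of vertices, is the position in \<open>adj\<close> at which list \<open>i\<close> starts.
\<close>

definition input_store :: "real \<Rightarrow> nat list list \<Rightarrow> store" where
  "input_store \<epsilon> nb = \<lparr>
     scalars = (\<lambda>_. 0)(''eps'' := \<epsilon>),
     arrays = (\<lambda>_. [])(
       ''off'' := map (\<lambda>i. real (length (concat (take i nb)))) [0..<Suc (length nb)],
       ''adj'' := map real (concat nb))\<rparr>"

definition output_value :: "store \<Rightarrow> real" where
  "output_value s = scalars s ''out''"

text \<open>
  The factor hidden by the soft-O notation. The summand 1 keeps it bounded away from 0; the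
  logarithms are nonnegative for nonempty graphs and \<open>\<epsilon> < 1\<close>, so this dominates, up to a constant
  factor and for \<open>k\<close> large enough, every polynomial in the three of them.
\<close>

definition polylog :: "nat \<Rightarrow> nat \<Rightarrow> nat \<Rightarrow> real \<Rightarrow> real" where
  "polylog k n m \<epsilon> = (1 + ln (real n) + ln (real m) + ln (1 / \<epsilon>)) ^ k"

end

theory Submission
  imports Defs
begin

text \<open>
  Orient every edge fractionally: an edge sends \<open>(1 + x) / 2\<close> of itself to one end and
  \<open>(1 - x) / 2\<close> to the other. By linear programming duality (Charikar), the maximum subgraph
  density is the value of the game in which one player picks the orientation and the other a
  probability distribution \<open>y\<close> on the vertices and receives the \<open>y\<close>-average load. Only the two easy
  halves of this duality are needed. Averaging the load over a densest set shows that no orientation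
  keeps all loads below the density, and cutting \<open>y\<close> into level sets shows that the best reply
  to \<open>y\<close>, whose value is \<open>\<Sum> min (y u) (y v)\<close> over the edges, never exceeds the density
  (\<open>min_sum_le_density\<close>). A distribution that is almost optimal for the second player therefore
  yields a number just below the density, and that number is the output. Below, everything is summed
  over arcs, so that each edge counts twice.

  Reaching the error \<open>\<epsilon>\<close> in order \<open>1 / \<epsilon>\<close> instead of \<open>1 / \<epsilon>\<^sup>2\<close> rounds needs a regulariser that fits the geometry
  of a cube against a simplex. Sherman's area-convex function
  \<open>2 * \<Sum> y i * x i j ^ 2 + 72 * D * \<Sum> y i * ln (y i)\<close>, for \<open>D\<close> at least the maximum degree, measures
  the movement of \<open>x\<close> in the weights of the current \<open>y\<close>. It has a range of only \<open>O(D log n)\<close>, and yet its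
  Bregman divergences dominate the bilinear coupling of the two players (\<open>area_bound\<close>).
  An extragradient step, which evaluates the gradient at a tentative point and then moves from
  the starting point along that gradient, loses nothing against it (\<open>extragradient_step\<close>). After \<open>k\<close>
  rounds the average is optimal up to \<open>O(D log n / k)\<close> (\<open>regret_inv_density\<close>), and the density is at
  least \<open>1/2\<close>, so \<open>O(D log n / \<epsilon>)\<close> rounds suffice.

  A step minimises the regulariser plus a linear function. Optimising \<open>y\<close> for fixed \<open>x\<close> is a
  softmax, optimising \<open>x\<close> for fixed \<open>y\<close> is a clipped quotient, and alternating between them contracts in
  the supremum norm of \<open>ln y\<close> (\<open>fixpoint_step\<close>). So logarithmically many alternations give a point that
  satisfies the optimality conditions up to a negligible error, and the regret analysis
  uses only these conditions (\<open>near_min_pot\<close>).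

  Isolated vertices may outnumber the edges without bound, so the program has one processor per arc
  and stores functions of vertices redundantly, at every arc leaving the vertex. Sums over a
  vertex's neighbours and over all vertices come from one prefix sum. The maximum degree is replaced by
  \<open>ln (\<Sum> exp (deg))\<close> over all arcs, which is again a single sum. As no step uses more than \<open>M = 2|E|\<close>
  processors, the work is at most a constant times \<open>M\<close> times the depth, and only the depth has to be
  computed.
\<close>

section \<open>Divergence and clipping on the real line\<close>

definition kl :: "real \<Rightarrow> real \<Rightarrow> real" where
  "kl u p = u * ln u - u * ln p - u + p"

text \<open>
  The unnormalised Kullback--Leibler divergence dominates the squared Hellinger distance: apply
  \<open>ln t \<le> t - 1\<close> to \<open>t = sqrt (p / u)\<close>. It is the only lower bound on \<open>kl\<close> that the analysis uses.
\<close>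

lemma kl_ge_hellinger:
  assumes "0 \<le> u" "0 < p"
  shows "(sqrt u - sqrt p)\<^sup>2 \<le> kl u p"
proof (cases "u = 0")
  case True
  then show ?thesis using assms by (simp add: kl_def)
next
  case False
  with assms have u: "0 < u" by simp
  have "ln (p / u) = 2 * ln (sqrt p / sqrt u)"
    using u assms by (simp add: ln_div ln_sqrt)
  also have "\<dots> \<le> 2 * (sqrt p / sqrt u - 1)"
    using u assms ln_le_minus_one[of "sqrt p / sqrt u"] by simp
  finally have "u * ln (p / u) \<le> u * (2 * (sqrt p / sqrt u - 1))"
    using u by (intro mult_left_mono) auto
  also have "\<dots> = 2 * sqrt u * sqrt p - 2 * u"
  proof -
    have "u / sqrt u = sqrt u" by (rule real_div_sqrt) (use u in simp)
    then have "u * (sqrt p / sqrt u) = sqrt u * sqrt p" by (metis mult.commute times_divide_eq_right)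
    then have "2 * (u * (sqrt p / sqrt u)) = 2 * (sqrt u * sqrt p)" by (rule arg_cong)
    then show ?thesis by (simp only: right_diff_distrib mult.assoc mult.left_commute[of u 2] mult_1_right)
  qed
  finally have "u * (ln p - ln u) \<le> 2 * sqrt u * sqrt p - 2 * u"
    using u assms by (simp add: ln_div)
  moreover have "(sqrt u - sqrt p)\<^sup>2 = u + p - 2 * sqrt u * sqrt p"
    using u assms by (simp add: power2_diff)
  ultimately show ?thesis by (simp add: kl_def algebra_simps)
qed

lemma kl_nonneg: "0 \<le> u \<Longrightarrow> 0 < p \<Longrightarrow> 0 \<le> kl u p"
  by (rule order_trans[OF zero_le_power2 kl_ge_hellinger])

lemma kl_ge_quadratic:
  assumes "0 \<le> u" "0 < p" "u \<le> 2 * w" "p \<le> 2 * w"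
  shows "(u - p)\<^sup>2 / w \<le> 8 * kl u p"
proof -
  have w: "0 < w" using assms by simp
  have "(u - p)\<^sup>2 = ((sqrt u - sqrt p) * (sqrt u + sqrt p))\<^sup>2"
    using assms by (simp add: algebra_simps)
  also have "\<dots> = (sqrt u - sqrt p)\<^sup>2 * (sqrt u + sqrt p)\<^sup>2"
    by (simp add: power_mult_distrib)
  also have "(sqrt u + sqrt p)\<^sup>2 \<le> 8 * w"
  proof -
    have "(sqrt u + sqrt p)\<^sup>2 + (sqrt u - sqrt p)\<^sup>2 = 2 * (u + p)"
      using assms by (simp add: power2_sum power2_diff)
    moreover have "2 * (u + p) \<le> 8 * w" using assms by simp
    ultimately show ?thesis using zero_le_power2[of "sqrt u - sqrt p"] by linarith
  qed
  finally have "(u - p)\<^sup>2 \<le> (sqrt u - sqrt p)\<^sup>2 * (8 * w)"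
    by (simp add: mult_left_mono)
  also have "\<dots> \<le> kl u p * (8 * w)"
    using kl_ge_hellinger[OF assms(1,2)] w by (intro mult_right_mono) auto
  finally show ?thesis using w by (simp add: field_simps)
qed

lemma young:
  fixes a b c :: real
  assumes "0 < c"
  shows "\<bar>a * b\<bar> \<le> (a\<^sup>2 / c + c * b\<^sup>2) / 2"
proof -
  have "0 \<le> (\<bar>a\<bar> - c * \<bar>b\<bar>)\<^sup>2 / c" using assms by simp
  also have "\<dots> = a\<^sup>2 / c + c * b\<^sup>2 - 2 * (\<bar>a\<bar> * \<bar>b\<bar>)"
    using assms by (simp add: power2_diff field_simps power2_eq_square)
  finally show ?thesis by (simp add: abs_mult)
qed

lemma cross_terms_le:
  fixes a b c d w :: real
  assumes "0 < w"
  shows "a * b - c * d \<le> (a\<^sup>2 / w + w * d\<^sup>2) / 2 + (c\<^sup>2 / w + w * b\<^sup>2) / 2"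
  using young[OF assms, of a b] young[OF assms, of c d] unfolding abs_le_iff add_divide_distrib by linarith

text \<open>
  The contribution of one arc to the Bregman divergence of the regulariser. The mixed term
  \<open>(u - p) * x * b\<close> can be negative, but because \<open>\<bar>x\<bar> \<le> 1\<close> it is paid for by the quadratic parts of the
  entropy and of the weighted square; this is where the constant 72 comes from. The
  reference weight \<open>w\<close> may be \<open>u\<close> or \<open>p\<close>, so that two consecutive divergences can be measured in the same
  weight.
\<close>

lemma arc_bregman_ge:
  assumes "0 \<le> u" "0 < p" "u \<le> 2 * w" "p \<le> 2 * w" "w \<le> 2 * u" "\<bar>x\<bar> \<le> 1"
  shows "((u - p)\<^sup>2 / w + w * b\<^sup>2) / 2 \<le> 72 * kl u p + 2 * (u * b\<^sup>2 + 2 * (u - p) * x * b)"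
proof -
  have w: "0 < w" using assms by simp
  define A B X Y where "A = (u - p)\<^sup>2 / w" and "B = w * b\<^sup>2"
    and "X = x * ((u - p) * b)" and "Y = \<bar>(u - p) * b\<bar>"
  have "\<bar>X\<bar> \<le> Y" unfolding X_def Y_def
    using mult_right_mono[OF assms(6), of "\<bar>(u - p) * b\<bar>"] by (simp only: abs_mult) simp
  moreover have "Y \<le> ((u - p)\<^sup>2 / (w / 4) + (w / 4) * b\<^sup>2) / 2" unfolding Y_def
    by (rule young) (use w in simp)
  then have "Y \<le> 2 * A + B / 8" by (simp add: A_def B_def)
  moreover have "B \<le> 2 * (u * b\<^sup>2)"
    unfolding B_def mult.assoc[symmetric] using assms by (intro mult_right_mono) auto
  moreover have "A \<le> 8 * kl u p" unfolding A_def by (rule kl_ge_quadratic) (use assms in auto)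
  moreover have "0 \<le> A" using w by (simp add: A_def)
  ultimately have "(A + B) / 2 \<le> 72 * kl u p + 2 * (u * b\<^sup>2 + 2 * X)" by (simp add: abs_le_iff)
  then show ?thesis by (simp add: A_def B_def X_def mult_ac)
qed

text \<open>
  For the comparison with an arbitrary strategy the weights \<open>u\<close> and \<open>p\<close> need not be close. If \<open>u\<close> is much
  smaller than \<open>p\<close>, the mixed term is at most linear in \<open>p - u\<close>, and so is the lower bound
  on \<open>kl\<close>.
\<close>

lemma arc_bregman_nonneg:
  assumes "0 \<le> u" "0 < p" "\<bar>x\<bar> \<le> 1" "\<bar>b\<bar> \<le> 2"
  shows "0 \<le> 72 * kl u p + 2 * (u * b\<^sup>2 + 2 * (u - p) * x * b)"
proof (cases "p \<le> 2 * u")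
  case True
  have "0 \<le> ((u - p)\<^sup>2 / max u p + max u p * b\<^sup>2) / 2" using assms by simp
  also have "\<dots> \<le> 72 * kl u p + 2 * (u * b\<^sup>2 + 2 * (u - p) * x * b)"
    using assms True by (intro arc_bregman_ge) auto
  finally show ?thesis .
next
  case False
  have "p / 2 * (p - u) \<le> (u - p) * (u - p)"
    using False assms mult_right_mono[of "p / 2" "p - u" "p - u"] by (simp add: algebra_simps)
  then have "p * (p - u) \<le> 2 * (u - p)\<^sup>2" by (simp add: power2_eq_square)
  also have "\<dots> \<le> 2 * (8 * kl u p * (p / 2))"
    using kl_ge_quadratic[OF assms(1,2), of "p / 2"] False assms(2) by (simp add: field_simps)
  finally have "p * (p - u) \<le> p * (8 * kl u p)" by simp
  then have "p - u \<le> 8 * kl u p" using assms(2) by simp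
  moreover have "\<bar>(u - p) * (x * b)\<bar> \<le> (p - u) * (1 * 2)"
    unfolding abs_mult using assms False by (intro mult_mono) auto
  moreover have "0 \<le> u * b\<^sup>2" using assms by simp
  moreover define X where "X = (u - p) * (x * b)"
  ultimately have "0 \<le> 72 * kl u p + 2 * (u * b\<^sup>2 + 2 * X)" by (simp add: abs_le_iff)
  then show ?thesis by (simp add: X_def algebra_simps)
qed

definition clip :: "real \<Rightarrow> real" where
  "clip t = max (-1) (min 1 t)"

lemma clip_minus: "clip (- t) = - clip t"
  by (simp add: clip_def max_def min_def)

lemma abs_clip_le: "\<bar>clip t\<bar> \<le> 1"
  by (simp add: clip_def)

text \<open>
  Scaling an argument by a factor close to 1 can move it far, but only outside the interval where
  \<open>clip\<close> sees the difference.
\<close>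

lemma clip_scale_close:
  assumes "0 \<le> \<theta>" "exp (- \<theta>) \<le> c" "c \<le> exp \<theta>"
  shows "\<bar>clip (c * t) - clip t\<bar> \<le> \<theta>"
proof -
  have pos: "\<bar>clip (c * t) - clip t\<bar> \<le> \<theta>" if t: "0 \<le> t" for t
  proof -
    have c: "0 < c" using assms(2) exp_gt_zero[of "-\<theta>"] by linarith
    have e1: "1 - \<theta> \<le> exp (- \<theta>)" using exp_ge_add_one_self[of "-\<theta>"] by simp
    show ?thesis
    proof (cases "c \<le> 1")
      case True
      have "(1 - \<theta>) * min 1 t \<le> c * min 1 t"
        using e1 assms t by (intro mult_right_mono) auto
      moreover have "c * min 1 t \<le> min 1 (c * t)"
        using True c t by (intro min.boundedI mult_left_mono mult_le_one) auto
      moreover have "min 1 (c * t) \<le> min 1 t"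
        using True t mult_left_le_one_le[of t c] c by (intro min.mono) auto
      moreover have "\<theta> * min 1 t \<le> \<theta>" using assms(1) by (simp add: mult_left_le)
      moreover have "clip (c * t) = min 1 (c * t)" "clip t = min 1 t"
        using t c by (auto simp: clip_def max_def min_def intro: order_trans[OF _ mult_nonneg_nonneg])
      ultimately show ?thesis unfolding abs_le_iff left_diff_distrib by linarith
    next
      case False
      let ?d = "1 / c"
      have d: "exp (-\<theta>) \<le> ?d" using assms(3) c by (simp add: exp_minus field_simps)
      define s where "s = c * t"
      have s: "0 \<le> s" "t = ?d * s" using c t by (auto simp: s_def)
      have "(1 - \<theta>) * min 1 s \<le> ?d * min 1 s"
        using e1 d s by (intro mult_right_mono) auto
      moreover have "?d * min 1 s \<le> min 1 (?d * s)" using False c by (simp add: min_def field_simps)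
      moreover have "min 1 (?d * s) \<le> min 1 s"
        using False s(1) mult_left_le_one_le[of s ?d] c by (intro min.mono) auto
      moreover have "\<theta> * min 1 s \<le> \<theta>" using assms(1) by (simp add: mult_left_le)
      ultimately have "\<bar>min 1 s - min 1 (?d * s)\<bar> \<le> \<theta>"
        unfolding abs_le_iff left_diff_distrib by linarith
      then show ?thesis using s(1) t unfolding s(2)[symmetric] by (simp add: clip_def s_def[symmetric])
    qed
  qed
  show ?thesis
  proof (cases "0 \<le> t")
    case False
    then show ?thesis using pos[of "-t"] clip_minus[of t] clip_minus[of "c * t"] by simp
  qed (rule pos)
qed

text \<open>
  First-order optimality of \<open>clip (- g / b)\<close> as the minimiser of \<open>b * t ^ 2 / 2 + g * t\<close> on
  \<open>{-1..1}\<close>.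
\<close>

lemma clip_variational:
  fixes b g u :: real
  assumes "0 < b" "\<bar>u\<bar> \<le> 1"
  shows "0 \<le> (b * clip (- g / b) + g) * (u - clip (- g / b))"
proof -
  consider "- g / b > 1" | "- g / b < -1" | "\<bar>- g / b\<bar> \<le> 1" by linarith
  then show ?thesis
  proof cases
    case 1
    then have "b + g \<le> 0" "clip (- g / b) = 1" using assms(1) by (auto simp: clip_def field_simps)
    then show ?thesis using assms(2) by (simp add: mult_nonpos_nonpos)
  next
    case 2
    then have "0 \<le> - b + g" "clip (- g / b) = -1" using assms(1) by (auto simp: clip_def field_simps)
    then show ?thesis using assms(2) by simp
  next
    case 3
    then have "-1 \<le> - g / b" "- g / b \<le> 1" by linarith+
    then have "clip (- g / b) = - g / b" unfolding clip_def by linarith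
    then show ?thesis using assms(1) by simp
  qed
qed

section \<open>The orientation game\<close>

text \<open>
  \<open>N i\<close> is the neighbourhood of the vertex \<open>i\<close> in an undirected graph on \<open>U\<close>, and \<open>D\<close> any upper bound
  on the degrees.
\<close>

locale density_game =
  fixes U :: "'v set" and N :: "'v \<Rightarrow> 'v set" and D :: real
  assumes fin_U: "finite U" and U_ne: "U \<noteq> {}"
    and N_sub: "i \<in> U \<Longrightarrow> N i \<subseteq> U"
    and N_sym: "i \<in> U \<Longrightarrow> j \<in> N i \<Longrightarrow> i \<in> N j"
    and deg_le: "i \<in> U \<Longrightarrow> real (card (N i)) \<le> D"
    and D_pos: "0 < D"
begin

lemma fin_N: "i \<in> U \<Longrightarrow> finite (N i)"
  using N_sub fin_U finite_subset by blast

abbreviation arc_sum :: "('v \<Rightarrow> 'v \<Rightarrow> real) \<Rightarrow> real" where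
  "arc_sum h \<equiv> \<Sum>i\<in>U. \<Sum>j\<in>N i. h i j"

lemma arc_sum_swap: "arc_sum h = arc_sum (\<lambda>i j. h j i)"
proof -
  have "arc_sum h = (\<Sum>(i, j)\<in>Sigma U N. h i j)"
    using fin_U fin_N by (simp add: sum.Sigma)
  also have "\<dots> = (\<Sum>(i, j)\<in>Sigma U N. h j i)"
    by (rule sum.reindex_bij_witness[where i = prod.swap and j = prod.swap])
       (auto dest: N_sym subsetD[OF N_sub])
  also have "\<dots> = arc_sum (\<lambda>i j. h j i)"
    using fin_U fin_N by (simp add: sum.Sigma)
  finally show ?thesis .
qed

lemma arc_sum_le_vertex_sum:
  assumes "\<And>i. i \<in> U \<Longrightarrow> 0 \<le> h i"
  shows "arc_sum (\<lambda>i j. h i) \<le> D * (\<Sum>i\<in>U. h i)"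
  unfolding sum_distrib_left using deg_le assms by (auto intro!: sum_mono mult_right_mono)

text \<open>
  The arc from \<open>i\<close> to \<open>j\<close> puts \<open>1 + x i j\<close> on \<open>i\<close> and the reverse arc puts \<open>1 - x i j\<close> on \<open>j\<close>: twice a
  fractional orientation of the edge. Antisymmetry replaces a choice of a direction for every edge.
\<close>

definition orientation :: "('v \<Rightarrow> 'v \<Rightarrow> real) \<Rightarrow> bool" where
  "orientation x \<longleftrightarrow> (\<forall>i j. x i j = - x j i \<and> \<bar>x i j\<bar> \<le> 1)"

definition distribution :: "('v \<Rightarrow> real) \<Rightarrow> bool" where
  "distribution y \<longleftrightarrow> (\<forall>i\<in>U. 0 \<le> y i) \<and> (\<Sum>i\<in>U. y i) = 1"

definition load :: "('v \<Rightarrow> 'v \<Rightarrow> real) \<Rightarrow> 'v \<Rightarrow> real" where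
  "load x i = (\<Sum>j\<in>N i. 1 + x i j)"

definition quad :: "('v \<Rightarrow> 'v \<Rightarrow> real) \<Rightarrow> 'v \<Rightarrow> real" where
  "quad x i = (\<Sum>j\<in>N i. (x i j)\<^sup>2)"

definition softmax :: "('v \<Rightarrow> real) \<Rightarrow> 'v \<Rightarrow> real" where
  "softmax q i = exp (q i / (72 * D)) / (\<Sum>k\<in>U. exp (q k / (72 * D)))"

definition best_y :: "('v \<Rightarrow> real) \<Rightarrow> ('v \<Rightarrow> 'v \<Rightarrow> real) \<Rightarrow> 'v \<Rightarrow> real" where
  "best_y L x = softmax (\<lambda>i. L i - 2 * quad x i)"

definition best_x :: "('v \<Rightarrow> real) \<Rightarrow> ('v \<Rightarrow> real) \<Rightarrow> 'v \<Rightarrow> 'v \<Rightarrow> real" where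
  "best_x Z y i j = clip ((Z j - Z i) / (4 * (y i + y j)))"

definition reg :: "('v \<Rightarrow> 'v \<Rightarrow> real) \<Rightarrow> ('v \<Rightarrow> real) \<Rightarrow> real" where
  "reg x y = 2 * arc_sum (\<lambda>i j. y i * (x i j)\<^sup>2) + 72 * D * (\<Sum>i\<in>U. y i * ln (y i))"

text \<open>
  \<open>Z\<close> is the sum of the distributions and \<open>L\<close> the sum of the loads played so far, so that apart from \<open>reg\<close> this is the
  accumulated linearised payoff. The gradient of the bilinear payoff with respect to \<open>x i j\<close> is \<open>y i\<close>, so
  a function of vertices suffices for the first player as well.
\<close>

definition pot :: "('v \<Rightarrow> real) \<Rightarrow> ('v \<Rightarrow> real) \<Rightarrow> ('v \<Rightarrow> 'v \<Rightarrow> real) \<Rightarrow> ('v \<Rightarrow> real) \<Rightarrow> real" where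
  "pot Z L x y = arc_sum (\<lambda>i j. Z i * x i j) - (\<Sum>i\<in>U. L i * y i) + reg x y"

text \<open>
  The Bregman divergence of \<open>reg\<close> from \<open>(x, y)\<close> to \<open>(u, v)\<close>.
\<close>

definition breg :: "('v \<Rightarrow> 'v \<Rightarrow> real) \<Rightarrow> ('v \<Rightarrow> real) \<Rightarrow> ('v \<Rightarrow> 'v \<Rightarrow> real) \<Rightarrow> ('v \<Rightarrow> real) \<Rightarrow> real" where
  "breg x y u v = 72 * D * (\<Sum>i\<in>U. kl (v i) (y i)) +
     2 * arc_sum (\<lambda>i j. v i * (u i j - x i j)\<^sup>2 + 2 * (v i - y i) * x i j * (u i j - x i j))"

text \<open>
  An approximate minimiser of \<open>pot Z L\<close>: \<open>x\<close> is the exact best reply to \<open>y\<close>, and \<open>y\<close> is the best reply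
  to some \<open>x'\<close> within \<open>\<tau>\<close> of \<open>x\<close> in the supremum norm. No exact minimiser is ever mentioned.
\<close>

definition near_min :: "real \<Rightarrow> ('v \<Rightarrow> real) \<Rightarrow> ('v \<Rightarrow> real) \<Rightarrow> ('v \<Rightarrow> 'v \<Rightarrow> real) \<Rightarrow> ('v \<Rightarrow> real) \<Rightarrow> bool" where
  "near_min \<tau> Z L x y \<longleftrightarrow> (\<exists>x'. orientation x' \<and> y = best_y L x' \<and> x = best_x Z y \<and>
     (\<forall>i\<in>U. \<forall>j\<in>N i. \<bar>x i j - x' i j\<bar> \<le> \<tau>))"

lemma softmax_denominator_pos: "0 < (\<Sum>k\<in>U. exp (q k / (72 * D)) :: real)"
  using fin_U U_ne by (intro sum_pos) auto

lemma softmax_pos: "0 < softmax q i"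
  using softmax_denominator_pos by (simp add: softmax_def)

lemma softmax_sum: "(\<Sum>i\<in>U. softmax q i) = 1"
  using softmax_denominator_pos[of q] by (simp add: softmax_def flip: sum_divide_distrib)

lemma softmax_distribution: "distribution (softmax q)"
  using softmax_sum less_imp_le[OF softmax_pos] by (simp add: distribution_def)

lemma ln_softmax: "72 * D * ln (softmax q i) = q i - 72 * D * ln (\<Sum>k\<in>U. exp (q k / (72 * D)))"
proof -
  have "ln (softmax q i) = q i / (72 * D) - ln (\<Sum>k\<in>U. exp (q k / (72 * D)))"
    using softmax_denominator_pos[of q] by (simp add: softmax_def ln_div)
  then show ?thesis using D_pos by (simp add: right_diff_distrib)
qed

lemma softmax_ratio:
  assumes "\<And>i. i \<in> U \<Longrightarrow> \<bar>q i - q' i\<bar> \<le> 36 * D * \<theta>" "i \<in> U"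
  shows "softmax q i \<le> exp \<theta> * softmax q' i"
proof -
  have le: "exp (p k / (72 * D)) \<le> exp (\<theta> / 2) * exp (p' k / (72 * D))"
    if "\<And>i. i \<in> U \<Longrightarrow> \<bar>p i - p' i\<bar> \<le> 36 * D * \<theta>" "k \<in> U" for p p' k
  proof -
    have "p k - p' k \<le> 36 * D * \<theta>" using that(1)[OF that(2)] by simp
    then have "p k / (72 * D) \<le> \<theta> / 2 + p' k / (72 * D)"
      using D_pos by (simp add: field_simps)
    then show ?thesis by (simp flip: exp_add)
  qed
  have "(\<Sum>k\<in>U. exp (q' k / (72 * D))) \<le> exp (\<theta> / 2) * (\<Sum>k\<in>U. exp (q k / (72 * D)))"
    unfolding sum_distrib_left using assms(1)
    by (intro sum_mono le) (simp_all add: abs_minus_commute)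
  then have "1 / (\<Sum>k\<in>U. exp (q k / (72 * D))) \<le> exp (\<theta> / 2) / (\<Sum>k\<in>U. exp (q' k / (72 * D)))"
    using softmax_denominator_pos[of q] softmax_denominator_pos[of q'] by (simp add: field_simps)
  moreover note le[of q q', OF assms(1) assms(2)]
  ultimately have "exp (q i / (72 * D)) * (1 / (\<Sum>k\<in>U. exp (q k / (72 * D))))
    \<le> (exp (\<theta> / 2) * exp (q' i / (72 * D))) * (exp (\<theta> / 2) / (\<Sum>k\<in>U. exp (q' k / (72 * D))))"
    using softmax_denominator_pos[of q] softmax_denominator_pos[of q'] by (intro mult_mono) auto
  also have "\<dots> = (exp (\<theta> / 2) * exp (\<theta> / 2)) * softmax q' i"
    by (simp add: softmax_def)
  also have "exp (\<theta> / 2) * exp (\<theta> / 2) = exp \<theta>" by (simp flip: exp_add)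
  finally show ?thesis by (simp add: softmax_def)
qed

lemma best_x_orientation: "orientation (best_x Z y)"
proof -
  have "best_x Z y i j = - best_x Z y j i" for i j
  proof -
    have "(Z j - Z i) / (4 * (y i + y j)) = - ((Z i - Z j) / (4 * (y j + y i)))"
      by (subst minus_divide_left) (simp add: add.commute[of "y i"])
    then show ?thesis by (simp only: best_x_def clip_minus)
  qed
  moreover have "\<bar>best_x Z y i j\<bar> \<le> 1" for i j
    by (simp add: best_x_def abs_clip_le)
  ultimately show ?thesis unfolding orientation_def by blast
qed

lemma orientation_abs: "orientation x \<Longrightarrow> \<bar>x i j\<bar> \<le> 1"
  unfolding orientation_def by blast

lemma quad_bounds:
  assumes "orientation x" "i \<in> U"
  shows "0 \<le> quad x i" "quad x i \<le> D"
proof -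
  show "0 \<le> quad x i" by (simp add: quad_def sum_nonneg)
  have "quad x i \<le> (\<Sum>j\<in>N i. 1)" unfolding quad_def
    using orientation_abs[OF assms(1)] by (intro sum_mono) (simp add: abs_square_le_1)
  then show "quad x i \<le> D" using deg_le[OF assms(2)] by simp
qed

lemma load_bounds:
  assumes "orientation x" "i \<in> U"
  shows "0 \<le> load x i" "load x i \<le> 2 * D"
proof -
  have b: "0 \<le> 1 + x i j" "1 + x i j \<le> 2" for j using orientation_abs[OF assms(1), of i j] by linarith+
  show "0 \<le> load x i" unfolding load_def using b by (intro sum_nonneg)
  have "load x i \<le> (\<Sum>j\<in>N i. 2)" unfolding load_def using b by (intro sum_mono)
  then show "load x i \<le> 2 * D" using deg_le[OF assms(2)] by simp
qed

lemma quad_lipschitz: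
  assumes "orientation x" "orientation x'" "i \<in> U" "\<And>j. j \<in> N i \<Longrightarrow> \<bar>x i j - x' i j\<bar> \<le> \<tau>" "0 \<le> \<tau>"
  shows "\<bar>quad x i - quad x' i\<bar> \<le> 2 * D * \<tau>"
proof -
  have "\<bar>quad x i - quad x' i\<bar> \<le> (\<Sum>j\<in>N i. \<bar>(x i j)\<^sup>2 - (x' i j)\<^sup>2\<bar>)"
    unfolding quad_def sum_subtractf[symmetric] by (rule sum_abs)
  also have "\<dots> \<le> (\<Sum>j\<in>N i. 2 * \<tau>)"
  proof (intro sum_mono)
    fix j assume j: "j \<in> N i"
    have "\<bar>(x i j)\<^sup>2 - (x' i j)\<^sup>2\<bar> = \<bar>x i j + x' i j\<bar> * \<bar>x i j - x' i j\<bar>"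
      by (simp add: abs_mult[symmetric] power2_eq_square algebra_simps)
    also have "\<dots> \<le> 2 * \<tau>"
      using assms(4)[OF j] orientation_abs[OF assms(1), of i j] orientation_abs[OF assms(2), of i j]
      by (intro mult_mono) auto
    finally show "\<bar>(x i j)\<^sup>2 - (x' i j)\<^sup>2\<bar> \<le> 2 * \<tau>" .
  qed
  also have "\<dots> \<le> 2 * D * \<tau>" using deg_le[OF assms(3)] assms(5) by (simp add: mult_right_mono)
  finally show ?thesis .
qed

lemma best_x_contract:
  assumes "0 \<le> \<theta>" "i \<in> U" "j \<in> U" "\<And>i. 0 < y i" "\<And>i. 0 < y' i"
    "\<And>i. i \<in> U \<Longrightarrow> y i \<le> exp \<theta> * y' i" "\<And>i. i \<in> U \<Longrightarrow> y' i \<le> exp \<theta> * y i"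
  shows "\<bar>best_x Z y' i j - best_x Z y i j\<bar> \<le> \<theta>"
proof -
  let ?s = "y i + y j" and ?s' = "y' i + y' j"
  have p: "0 < ?s" "0 < ?s'" using assms(4,5) by (simp_all add: add_pos_pos)
  have "?s \<le> exp \<theta> * ?s'" "?s' \<le> exp \<theta> * ?s"
    using assms(6,7)[OF assms(2)] assms(6,7)[OF assms(3)] by (simp_all add: distrib_left)
  then have c: "?s / ?s' \<le> exp \<theta>" "exp (- \<theta>) \<le> ?s / ?s'"
    using p by (simp_all add: exp_minus field_simps)
  have "(Z j - Z i) / (4 * ?s') = (?s / ?s') * ((Z j - Z i) / (4 * ?s))"
  proof -
    have "a / (4 * s') = (s / s') * (a / (4 * s))" if "0 < s" for a s s' :: real
      using that by simp
    from this[OF p(1)] show ?thesis .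
  qed
  then show ?thesis unfolding best_x_def by (simp only: clip_scale_close[OF assms(1) c(2,1)])
qed

text \<open>
  The alternation between best replies contracts. If \<open>x\<close> moves by \<open>\<tau>\<close>, then each \<open>quad x i\<close> moves by at most
  \<open>2 * D * \<tau>\<close>; the entropy has the large factor \<open>72 * D\<close>, so \<open>ln y\<close> moves by at most
  \<open>\<tau> / 2\<close>, and by \<open>clip_scale_close\<close> so does the next \<open>x\<close>, even on arcs whose weight \<open>y i + y j\<close> is tiny.
\<close>

lemma fixpoint_step:
  assumes "orientation x'" "y = best_y L x'" "x = best_x Z y" "0 \<le> \<tau>"
    "\<And>i j. i \<in> U \<Longrightarrow> j \<in> N i \<Longrightarrow> \<bar>x i j - x' i j\<bar> \<le> \<tau>" "i \<in> U" "j \<in> N i"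
  shows "\<bar>best_x Z (best_y L x) i j - x i j\<bar> \<le> \<tau> / 2"
proof -
  have ox: "orientation x" using best_x_orientation assms(3) by simp
  have q: "\<bar>(L i - 2 * quad x i) - (L i - 2 * quad x' i)\<bar> \<le> 36 * D * (\<tau> / 2)" if "i \<in> U" for i
  proof -
    have "\<bar>quad x i - quad x' i\<bar> \<le> 2 * D * \<tau>"
      using quad_lipschitz[OF ox assms(1) that _ assms(4)] assms(5)[OF that] by simp
    moreover have "0 \<le> D * \<tau>" using D_pos assms(4) by simp
    ultimately show ?thesis by (simp add: abs_le_iff)
  qed
  have "\<bar>best_x Z (best_y L x) i j - best_x Z y i j\<bar> \<le> \<tau> / 2"
  proof (rule best_x_contract)
    show "0 \<le> \<tau> / 2" "i \<in> U" "j \<in> U" using assms(4,6,7) N_sub by auto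
    show "0 < y k" "0 < best_y L x k" for k by (simp_all add: assms(2) best_y_def softmax_pos)
    show "y k \<le> exp (\<tau> / 2) * best_y L x k" if "k \<in> U" for k
      unfolding assms(2) best_y_def using q that by (intro softmax_ratio) (simp_all add: abs_minus_commute)
    show "best_y L x k \<le> exp (\<tau> / 2) * y k" if "k \<in> U" for k
      unfolding assms(2) best_y_def using q that by (intro softmax_ratio) simp_all
  qed
  then show ?thesis using assms(3) by simp
qed

lemma near_min_first:
  "near_min 1 Z L (best_x Z (best_y L (\<lambda>i j. 0))) (best_y L (\<lambda>i j. 0))"
  unfolding near_min_def using orientation_abs[OF best_x_orientation]
  by (intro exI[of _ "\<lambda>i j. 0"]) (auto simp: orientation_def)

lemma near_min_next:
  assumes "near_min \<tau> Z L x y" "0 \<le> \<tau>"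
  shows "near_min (\<tau> / 2) Z L (best_x Z (best_y L x)) (best_y L x)"
proof -
  obtain x' where x': "orientation x'" "y = best_y L x'" "x = best_x Z y"
    "\<And>i j. i \<in> U \<Longrightarrow> j \<in> N i \<Longrightarrow> \<bar>x i j - x' i j\<bar> \<le> \<tau>"
    using assms(1) by (auto simp: near_min_def)
  have "orientation x" using best_x_orientation x'(3) by simp
  then show ?thesis unfolding near_min_def
    using fixpoint_step[OF x'(1-3) assms(2) x'(4)] by (intro exI[of _ x]) simp
qed

lemma near_min_mono: "near_min \<tau> Z L x y \<Longrightarrow> \<tau> \<le> \<tau>' \<Longrightarrow> near_min \<tau>' Z L x y"
  unfolding near_min_def by (elim exE conjE) (intro exI conjI; auto intro: order_trans)

lemma near_min_exists:
  assumes "0 < \<tau>"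
  shows "\<exists>x y. near_min \<tau> Z L x y"
proof -
  have "\<exists>x y. near_min ((1 / 2) ^ k) Z L x y" for k
  proof (induction k)
    case 0
    then show ?case using near_min_first by auto
  next
    case (Suc k)
    then obtain x y where "near_min ((1 / 2) ^ k) Z L x y" by blast
    from near_min_next[OF this] show ?case by auto
  qed
  moreover obtain k where "(1 / 2) ^ k < \<tau>" using real_arch_pow_inv[OF assms, of "1 / 2"] by auto
  ultimately show ?thesis by (meson near_min_mono less_imp_le)
qed

lemma near_min_feasible:
  assumes "near_min \<tau> Z L x y"
  shows "orientation x" "distribution y" "\<And>i. 0 < y i"
  using assms by (auto simp: near_min_def best_y_def softmax_pos intro: best_x_orientation softmax_distribution)

lemma pot_expand:
  "pot Z L u v = pot Z L x y + breg x y u v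
    + arc_sum (\<lambda>i j. (Z i + 4 * y i * x i j) * (u i j - x i j))
    + (\<Sum>i\<in>U. (v i - y i) * (2 * quad x i - L i + 72 * D * ln (y i) + 72 * D))"
proof -
  have "(\<Sum>i\<in>U. (v i - y i) * (2 * quad x i - L i + 72 * D * ln (y i) + 72 * D)) =
    2 * arc_sum (\<lambda>i j. (v i - y i) * (x i j)\<^sup>2) - (\<Sum>i\<in>U. (v i - y i) * L i)
      + 72 * D * (\<Sum>i\<in>U. (v i - y i) * (ln (y i) + 1))"
  proof -
    have "arc_sum (\<lambda>i j. (v i - y i) * (x i j)\<^sup>2) = (\<Sum>i\<in>U. (v i - y i) * quad x i)"
      by (simp add: quad_def sum_distrib_left)
    note q = this
    show ?thesis
      unfolding q sum_distrib_left sum.distrib[symmetric] sum_subtractf[symmetric]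
      by (intro sum.cong refl) (simp add: algebra_simps)
  qed
  moreover have "72 * D * (\<Sum>i\<in>U. v i * ln (v i)) = 72 * D * (\<Sum>i\<in>U. y i * ln (y i))
      + 72 * D * (\<Sum>i\<in>U. kl (v i) (y i)) + 72 * D * (\<Sum>i\<in>U. (v i - y i) * (ln (y i) + 1))"
    unfolding distrib_left[symmetric] sum.distrib[symmetric]
    by (intro arg_cong[where f = "\<lambda>t. 72 * D * t"] sum.cong refl) (simp add: kl_def algebra_simps)
  moreover have "2 * arc_sum (\<lambda>i j. v i * (u i j)\<^sup>2) = 2 * arc_sum (\<lambda>i j. y i * (x i j)\<^sup>2)
     + 2 * arc_sum (\<lambda>i j. v i * (u i j - x i j)\<^sup>2 + 2 * (v i - y i) * x i j * (u i j - x i j))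
     + arc_sum (\<lambda>i j. 4 * y i * x i j * (u i j - x i j))
     + 2 * arc_sum (\<lambda>i j. (v i - y i) * (x i j)\<^sup>2)"
    unfolding sum_distrib_left sum.distrib[symmetric]
    by (intro sum.cong refl) (simp add: power2_eq_square algebra_simps)
  moreover have "arc_sum (\<lambda>i j. (Z i + 4 * y i * x i j) * (u i j - x i j)) =
      arc_sum (\<lambda>i j. Z i * u i j) - arc_sum (\<lambda>i j. Z i * x i j)
       + arc_sum (\<lambda>i j. 4 * y i * x i j * (u i j - x i j))"
    unfolding sum.distrib[symmetric] sum_subtractf[symmetric]
    by (intro sum.cong refl) (simp add: algebra_simps)
  moreover have "(\<Sum>i\<in>U. (v i - y i) * L i) = (\<Sum>i\<in>U. L i * v i) - (\<Sum>i\<in>U. L i * y i)"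
    by (simp add: sum_subtractf algebra_simps)
  ultimately show ?thesis unfolding pot_def reg_def breg_def by linarith
qed

text \<open>
  Convexity of \<open>pot\<close> with the approximate optimality conditions inserted. The condition for \<open>x\<close>
  is exact on every arc after adding the contributions of an arc and its reverse. The one for
  \<open>y\<close> is an equation that holds for \<open>x'\<close> instead of \<open>x\<close>, whence the error \<open>8 * D * \<tau>\<close>.
\<close>

lemma near_min_pot:
  assumes nm: "near_min \<tau> Z L x y" and \<tau>: "0 \<le> \<tau>"
    and u: "orientation u" and v: "distribution v"
  shows "pot Z L x y + breg x y u v - 8 * D * \<tau> \<le> pot Z L u v"
proof -
  obtain x' where x': "orientation x'" "y = best_y L x'" "x = best_x Z y"
    "\<And>i j. i \<in> U \<Longrightarrow> j \<in> N i \<Longrightarrow> \<bar>x i j - x' i j\<bar> \<le> \<tau>"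
    using nm by (auto simp: near_min_def)
  note feas = near_min_feasible[OF nm]
  have "0 \<le> arc_sum (\<lambda>i j. (Z i + 4 * y i * x i j) * (u i j - x i j))"
  proof -
    have anti: "x j i = - x i j" "u j i = - u i j" for i j
      using feas(1) u unfolding orientation_def by blast+
    let ?h = "\<lambda>i j. (Z i + 4 * y i * x i j) * (u i j - x i j)"
    have flip: "?h j i = (- Z j + 4 * y j * x i j) * (u i j - x i j)" for i j
      by (simp add: anti(1)[of j i] anti(2)[of j i] algebra_simps)
    have "2 * arc_sum ?h = arc_sum ?h + arc_sum (\<lambda>i j. ?h j i)"
      using arc_sum_swap[of ?h] by simp
    also have "\<dots> = arc_sum (\<lambda>i j. (4 * (y i + y j) * x i j + (Z i - Z j)) * (u i j - x i j))"
      unfolding sum.distrib[symmetric]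
    proof (intro sum.cong refl)
      fix i j
      show "?h i j + ?h j i = (4 * (y i + y j) * x i j + (Z i - Z j)) * (u i j - x i j)"
        unfolding flip[where i = i and j = j] by (simp add: algebra_simps)
    qed
    also have "\<dots> \<ge> 0"
    proof (intro sum_nonneg)
      fix i j
      have "0 < 4 * (y i + y j)" using feas(3) by (simp add: add_pos_pos)
      from clip_variational[OF this orientation_abs[OF u], of "Z i - Z j" i j]
      show "0 \<le> (4 * (y i + y j) * x i j + (Z i - Z j)) * (u i j - x i j)"
        by (simp add: x'(3) best_x_def)
    qed
    finally show ?thesis by simp
  qed
  moreover have "- (8 * D * \<tau>) \<le> (\<Sum>i\<in>U. (v i - y i) * (2 * quad x i - L i + 72 * D * ln (y i) + 72 * D))"
  proof -
    let ?c = "72 * D - 72 * D * ln (\<Sum>k\<in>U. exp ((L k - 2 * quad x' k) / (72 * D)))"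
    have "2 * quad x i - L i + 72 * D * ln (y i) + 72 * D = 2 * (quad x i - quad x' i) + ?c" for i
      unfolding x'(2) best_y_def ln_softmax by simp
    then have "(\<Sum>i\<in>U. (v i - y i) * (2 * quad x i - L i + 72 * D * ln (y i) + 72 * D)) =
        (\<Sum>i\<in>U. (v i - y i) * (2 * (quad x i - quad x' i))) + ?c * (\<Sum>i\<in>U. v i - y i)"
      by (simp only: distrib_left sum.distrib sum_distrib_right[symmetric] mult.commute[of ?c])
    also have "(\<Sum>i\<in>U. v i - y i) = 0"
      using v feas(2) by (simp add: distribution_def sum_subtractf)
    finally have eq: "(\<Sum>i\<in>U. (v i - y i) * (2 * quad x i - L i + 72 * D * ln (y i) + 72 * D)) =
        (\<Sum>i\<in>U. (v i - y i) * (2 * (quad x i - quad x' i)))" by simp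
    have "\<bar>\<Sum>i\<in>U. (v i - y i) * (2 * (quad x i - quad x' i))\<bar> \<le> (\<Sum>i\<in>U. (v i + y i) * (4 * D * \<tau>))"
    proof (rule order_trans[OF sum_abs], intro sum_mono)
      fix i assume i: "i \<in> U"
      have "\<bar>quad x i - quad x' i\<bar> \<le> 2 * D * \<tau>"
        using quad_lipschitz[OF feas(1) x'(1) i _ \<tau>] x'(4)[OF i] by simp
      moreover have "0 \<le> v i" "0 \<le> y i" using v feas(2) i by (auto simp: distribution_def)
      ultimately have "\<bar>v i - y i\<bar> * \<bar>2 * (quad x i - quad x' i)\<bar> \<le> (v i + y i) * (4 * D * \<tau>)"
        by (intro mult_mono) (auto simp: abs_le_iff)
      then show "\<bar>(v i - y i) * (2 * (quad x i - quad x' i))\<bar> \<le> (v i + y i) * (4 * D * \<tau>)"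
        by (simp only: abs_mult)
    qed
    also have "\<dots> = 8 * D * \<tau>"
      unfolding sum_distrib_right[symmetric] sum.distrib using v feas(2) by (simp add: distribution_def)
    finally show ?thesis using eq by (simp add: abs_le_iff)
  qed
  ultimately show ?thesis unfolding pot_expand[of Z L u v x y] by linarith
qed

lemma breg_ge:
  assumes "orientation x" "\<And>i. i \<in> U \<Longrightarrow> 0 < y i" "\<And>i. i \<in> U \<Longrightarrow> 0 \<le> v i"
    "\<And>i. i \<in> U \<Longrightarrow> v i \<le> 2 * w i" "\<And>i. i \<in> U \<Longrightarrow> y i \<le> 2 * w i" "\<And>i. i \<in> U \<Longrightarrow> w i \<le> 2 * v i"
  shows "arc_sum (\<lambda>i j. ((v i - y i)\<^sup>2 / w i + w i * (u i j - x i j)\<^sup>2) / 2) \<le> breg x y u v"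
proof -
  have "arc_sum (\<lambda>i j. ((v i - y i)\<^sup>2 / w i + w i * (u i j - x i j)\<^sup>2) / 2) \<le>
    arc_sum (\<lambda>i j. 72 * kl (v i) (y i) +
      2 * (v i * (u i j - x i j)\<^sup>2 + 2 * (v i - y i) * x i j * (u i j - x i j)))"
    using assms(2-6) orientation_abs[OF assms(1)] by (intro sum_mono arc_bregman_ge) auto
  also have "\<dots> = arc_sum (\<lambda>i j. 72 * kl (v i) (y i)) +
      2 * arc_sum (\<lambda>i j. v i * (u i j - x i j)\<^sup>2 + 2 * (v i - y i) * x i j * (u i j - x i j))"
    by (simp only: sum_distrib_left sum.distrib[symmetric])
  also have "arc_sum (\<lambda>i j. 72 * kl (v i) (y i)) \<le> D * (\<Sum>i\<in>U. 72 * kl (v i) (y i))"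
    using assms(2,3) by (intro arc_sum_le_vertex_sum) (simp add: kl_nonneg)
  also have "\<dots> = 72 * D * (\<Sum>i\<in>U. kl (v i) (y i))" by (simp only: sum_distrib_left[symmetric])
  finally show ?thesis by (simp add: breg_def)
qed

text \<open>
  Area convexity: the bilinear coupling along two consecutive moves, from \<open>z\<close> to \<open>w\<close> and from \<open>w\<close> to
  \<open>n\<close>, is absorbed by the two divergences. Each product pairs a change of \<open>y\<close> in one move with a change
  of \<open>x\<close> in the other; splitting it by Young's inequality with the weight \<open>yw\<close> gives the terms of \<open>arc_bregman_ge\<close>.
\<close>

lemma area_bound:
  assumes "orientation xz" "orientation xw"
    "\<And>i. i \<in> U \<Longrightarrow> 0 < yz i" "\<And>i. i \<in> U \<Longrightarrow> 0 < yw i" "\<And>i. i \<in> U \<Longrightarrow> 0 < yn i"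
    "\<And>i. i \<in> U \<Longrightarrow> yz i \<le> 2 * yw i" "\<And>i. i \<in> U \<Longrightarrow> yw i \<le> 2 * yz i"
    "\<And>i. i \<in> U \<Longrightarrow> yn i \<le> 2 * yw i" "\<And>i. i \<in> U \<Longrightarrow> yw i \<le> 2 * yn i"
  shows "arc_sum (\<lambda>i j. (yw i - yz i) * (xw i j - xn i j) - (yw i - yn i) * (xw i j - xz i j))
    \<le> breg xz yz xw yw + breg xw yw xn yn"
proof -
  have "arc_sum (\<lambda>i j. (yw i - yz i) * (xw i j - xn i j) - (yw i - yn i) * (xw i j - xz i j)) \<le>
    arc_sum (\<lambda>i j. ((yw i - yz i)\<^sup>2 / yw i + yw i * (xw i j - xz i j)\<^sup>2) / 2 +
      ((yn i - yw i)\<^sup>2 / yw i + yw i * (xn i j - xw i j)\<^sup>2) / 2)"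
  proof (intro sum_mono)
    fix i j assume i: "i \<in> U"
    show "(yw i - yz i) * (xw i j - xn i j) - (yw i - yn i) * (xw i j - xz i j) \<le>
      ((yw i - yz i)\<^sup>2 / yw i + yw i * (xw i j - xz i j)\<^sup>2) / 2 +
      ((yn i - yw i)\<^sup>2 / yw i + yw i * (xn i j - xw i j)\<^sup>2) / 2"
      unfolding power2_commute[of "yn i" "yw i"] power2_commute[of "xn i j" "xw i j"]
      by (rule cross_terms_le[OF assms(4)[OF i]])
  qed
  also have "\<dots> = arc_sum (\<lambda>i j. ((yw i - yz i)\<^sup>2 / yw i + yw i * (xw i j - xz i j)\<^sup>2) / 2) +
    arc_sum (\<lambda>i j. ((yn i - yw i)\<^sup>2 / yw i + yw i * (xn i j - xw i j)\<^sup>2) / 2)"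
    by (simp only: sum.distrib[symmetric])
  also have "\<dots> \<le> breg xz yz xw yw + breg xw yw xn yn"
    using assms by (intro add_mono breg_ge) (auto simp: less_imp_le)
  finally show ?thesis .
qed

lemma breg_nonneg:
  assumes "orientation x" "\<And>i. i \<in> U \<Longrightarrow> 0 < y i" "orientation u" "\<And>i. i \<in> U \<Longrightarrow> 0 \<le> v i"
  shows "0 \<le> breg x y u v"
proof -
  have "0 \<le> arc_sum (\<lambda>i j. 72 * kl (v i) (y i) +
      2 * (v i * (u i j - x i j)\<^sup>2 + 2 * (v i - y i) * x i j * (u i j - x i j)))"
  proof (intro sum_nonneg arc_bregman_nonneg)
    fix i j
    show "\<bar>x i j\<bar> \<le> 1" by (rule orientation_abs[OF assms(1)])
    show "\<bar>u i j - x i j\<bar> \<le> 2"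
      using orientation_abs[OF assms(1), of i j] orientation_abs[OF assms(3), of i j] by linarith
  qed (use assms in auto)
  also have "\<dots> = arc_sum (\<lambda>i j. 72 * kl (v i) (y i)) +
      2 * arc_sum (\<lambda>i j. v i * (u i j - x i j)\<^sup>2 + 2 * (v i - y i) * x i j * (u i j - x i j))"
    by (simp only: sum_distrib_left sum.distrib[symmetric])
  also have "arc_sum (\<lambda>i j. 72 * kl (v i) (y i)) \<le> D * (\<Sum>i\<in>U. 72 * kl (v i) (y i))"
    using assms(2,4) by (intro arc_sum_le_vertex_sum) (simp add: kl_nonneg)
  also have "\<dots> = 72 * D * (\<Sum>i\<in>U. kl (v i) (y i))" by (simp only: sum_distrib_left[symmetric])
  finally show ?thesis by (simp add: breg_def)
qed

text \<open>
  One gradient changes the exponent of the softmax by little compared with \<open>72 * D\<close>, so no coordinate of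
  \<open>y\<close> changes by more than a factor of 2. This is what makes the weights of consecutive points
  interchangeable.
\<close>

lemma near_min_stable:
  assumes "near_min \<tau> Z L x y" "near_min \<tau>' Z' L' x' y'"
    "\<And>i. i \<in> U \<Longrightarrow> \<bar>L i - L' i\<bar> \<le> 2 * D" "i \<in> U"
  shows "y i \<le> 2 * y' i"
proof -
  obtain q q' where q: "orientation q" "y = best_y L q" "orientation q'" "y' = best_y L' q'"
    using assms(1,2) by (auto simp: near_min_def)
  have "y i \<le> exp (1 / 9) * y' i" unfolding q best_y_def
  proof (rule softmax_ratio[OF _ assms(4)])
    fix k assume k: "k \<in> U"
    show "\<bar>L k - 2 * quad q k - (L' k - 2 * quad q' k)\<bar> \<le> 36 * D * (1 / 9)"
      using assms(3)[OF k] quad_bounds[OF q(1) k] quad_bounds[OF q(3) k] by (simp add: abs_le_iff)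
  qed
  moreover have "exp (1 / 9) \<le> (2 :: real)"
    using exp_bound[of "1 / 9"] by (simp add: power2_eq_square)
  then have "exp (1 / 9) * y' i \<le> 2 * y' i"
    using near_min_feasible(3)[OF assms(2), of i] by (intro mult_right_mono) auto
  ultimately show ?thesis by linarith
qed

lemma load_sum: "(\<Sum>i\<in>U. load x i * y i) = arc_sum (\<lambda>i j. y i * (1 + x i j))"
  by (simp add: load_def sum_distrib_left sum_distrib_right mult.commute)

lemma pot_shift:
  "pot (\<lambda>i. Z i + y' i) (\<lambda>i. L i + load x' i) x y =
    pot Z L x y + arc_sum (\<lambda>i j. y' i * x i j - y i * (1 + x' i j))"
  unfolding pot_def using load_sum[of x' y]
  by (simp add: distrib_right sum.distrib sum_subtractf)

text \<open>
  Up to the errors of the near minimisers, the minimum of the potential rises in one round by at least the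
  payoff \<open>- arc_sum (\<lambda>i j. yw i)\<close> of the
  linearised game at the point \<open>w\<close>, where its gradient is taken. In general it would rise by that payoff plus the
  two divergences minus the change of the gradient between \<open>z\<close> and \<open>w\<close> paired with the move from \<open>w\<close> to
  \<open>n\<close>; by \<open>area_bound\<close> that difference is not negative.
\<close>

lemma extragradient_step:
  assumes z: "near_min \<tau> Z L xz yz"
    and w: "near_min \<tau> (\<lambda>i. Z i + yz i) (\<lambda>i. L i + load xz i) xw yw"
    and n: "near_min \<tau> (\<lambda>i. Z i + yw i) (\<lambda>i. L i + load xw i) xn yn"
    and \<tau>: "0 \<le> \<tau>"
  shows "pot Z L xz yz - arc_sum (\<lambda>i j. yw i) - 16 * D * \<tau>
    \<le> pot (\<lambda>i. Z i + yw i) (\<lambda>i. L i + load xw i) xn yn"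
proof -
  note fz = near_min_feasible[OF z] and fw = near_min_feasible[OF w] and fn = near_min_feasible[OF n]
  let ?G = "pot (\<lambda>i. Z i + yz i) (\<lambda>i. L i + load xz i)"
  have lz: "\<bar>L i - (L i + load xz i)\<bar> \<le> 2 * D" "\<bar>(L i + load xz i) - L i\<bar> \<le> 2 * D"
    and lw: "\<bar>(L i + load xz i) - (L i + load xw i)\<bar> \<le> 2 * D"
      "\<bar>(L i + load xw i) - (L i + load xz i)\<bar> \<le> 2 * D" if "i \<in> U" for i
    using load_bounds[OF fz(1) that] load_bounds[OF fw(1) that] by linarith+
  (* All three points lie within one gradient of each other, hence near_min_stable applies in both directions. *)
  have area: "arc_sum (\<lambda>i j. (yw i - yz i) * (xw i j - xn i j) - (yw i - yn i) * (xw i j - xz i j))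
    \<le> breg xz yz xw yw + breg xw yw xn yn"
    using fz fw fn near_min_stable[OF z w lz(1)] near_min_stable[OF w z lz(2)]
      near_min_stable[OF w n lw(1)] near_min_stable[OF n w lw(2)]
    by (intro area_bound) auto
  (* What remains after the two inequalities of near_min_pot is the game value at w minus the coupling of area_bound. *)
  have split: "arc_sum (\<lambda>i j. yz i * xw i j - yw i * (1 + xz i j)) +
      (arc_sum (\<lambda>i j. yw i * xn i j - yn i * (1 + xw i j)) -
       arc_sum (\<lambda>i j. yz i * xn i j - yn i * (1 + xz i j))) =
    - arc_sum (\<lambda>i j. yw i) -
    arc_sum (\<lambda>i j. (yw i - yz i) * (xw i j - xn i j) - (yw i - yn i) * (xw i j - xz i j))"
    unfolding sum.distrib[symmetric] sum_subtractf[symmetric] sum_negf[symmetric]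
    by (intro sum.cong refl) (simp add: algebra_simps)
  have "pot Z L xz yz + breg xz yz xw yw - 8 * D * \<tau> \<le> pot Z L xw yw"
    by (rule near_min_pot[OF z \<tau> fw(1,2)])
  moreover have "?G xw yw + breg xw yw xn yn - 8 * D * \<tau> \<le> ?G xn yn"
    by (rule near_min_pot[OF w \<tau> fn(1,2)])
  moreover have "?G xw yw = pot Z L xw yw + arc_sum (\<lambda>i j. yz i * xw i j - yw i * (1 + xz i j))"
    by (rule pot_shift)
  moreover have "?G xn yn = pot Z L xn yn + arc_sum (\<lambda>i j. yz i * xn i j - yn i * (1 + xz i j))"
    by (rule pot_shift)
  moreover have "pot (\<lambda>i. Z i + yw i) (\<lambda>i. L i + load xw i) xn yn =
      pot Z L xn yn + arc_sum (\<lambda>i j. yw i * xn i j - yn i * (1 + xw i j))"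
    by (rule pot_shift)
  ultimately show ?thesis using area split by linarith
qed

section \<open>Regret of the extragradient method\<close>

definition inner_arcs :: "'v set \<Rightarrow> real" where
  "inner_arcs I = (\<Sum>i\<in>I. real (card (N i \<inter> I)))"

text \<open>
  Every edge inside \<open>I\<close> puts its whole load on \<open>I\<close>, however it is oriented.
\<close>

lemma load_sum_ge_inner_arcs:
  assumes "orientation x" "I \<subseteq> U"
  shows "inner_arcs I \<le> (\<Sum>i\<in>I. load x i)"
proof (cases "I = {}")
  case False
  (* Antisymmetric terms cancel over the arcs inside I, which form a graph of their own. *)
  interpret sub: density_game I "\<lambda>i. N i \<inter> I" D
  proof
    fix i assume i: "i \<in> I"
    then have "card (N i \<inter> I) \<le> card (N i)" using assms(2) fin_N by (intro card_mono) auto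
    then show "real (card (N i \<inter> I)) \<le> D" using deg_le[of i] i assms(2) by force
  qed (use assms(2) finite_subset[OF assms(2) fin_U] False D_pos in \<open>auto intro: N_sym\<close>)
  have "sub.arc_sum x = sub.arc_sum (\<lambda>i j. - x i j)"
  proof -
    have "sub.arc_sum x = sub.arc_sum (\<lambda>i j. x j i)" by (rule sub.arc_sum_swap)
    moreover have "(\<lambda>i j. x j i) = (\<lambda>i j. - x i j)"
      using assms(1) unfolding orientation_def by (intro ext) blast
    then have "sub.arc_sum (\<lambda>i j. x j i) = sub.arc_sum (\<lambda>i j. - x i j)"
      by (rule arg_cong[where f = "\<lambda>h. sub.arc_sum h"])
    ultimately show ?thesis by (rule trans)
  qed
  then have "sub.arc_sum x = 0" by (simp add: sum_negf)
  then have "inner_arcs I = (\<Sum>i\<in>I. \<Sum>j\<in>N i \<inter> I. 1 + x i j)"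
    by (simp add: inner_arcs_def sum.distrib)
  also have "\<dots> \<le> (\<Sum>i\<in>I. load x i)" unfolding load_def
  proof (intro sum_mono sum_mono2)
    fix i j assume "i \<in> I"
    then show "finite (N i)" using assms(2) fin_N by auto
    show "0 \<le> 1 + x i j" using orientation_abs[OF assms(1), of i j] by linarith
  qed auto
  finally show ?thesis .
qed (simp add: inner_arcs_def)

text \<open>
  The first part is the regret bound, with \<open>- arc_sum (\<lambda>i j. Z i)\<close> as the total linearised payoff of the first
  \<open>k\<close> rounds. The second part is all that has to be remembered of the orientations played in them.
\<close>

definition regret_inv :: "real \<Rightarrow> nat \<Rightarrow> ('v \<Rightarrow> real) \<Rightarrow> ('v \<Rightarrow> real) \<Rightarrow> bool" where
  "regret_inv \<tau> k Z L \<longleftrightarrow>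
    (\<forall>x y. near_min \<tau> Z L x y \<longrightarrow>
      - (72 * D * ln (real (card U))) - arc_sum (\<lambda>i j. Z i) - real k * (16 * D * \<tau>) \<le> pot Z L x y) \<and>
    (\<forall>I\<subseteq>U. real k * inner_arcs I \<le> (\<Sum>i\<in>I. L i))"

lemma card_U_pos: "0 < real (card U)"
  using fin_U U_ne by (simp add: card_gt_0_iff)

text \<open>
  The least value of \<open>reg\<close> is at least \<open>- 72 * D * ln (card U)\<close>, by comparing \<open>y\<close> with the uniform
  distribution.
\<close>

lemma regret_inv_init: "regret_inv \<tau> 0 (\<lambda>i. 0) (\<lambda>i. 0)"
proof -
  have "- (72 * D * ln (real (card U))) \<le> pot (\<lambda>i. 0) (\<lambda>i. 0) x y"
    if nm: "near_min \<tau> (\<lambda>i. 0) (\<lambda>i. 0) x y" for x y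
  proof -
    note f = near_min_feasible[OF nm]
    have "0 \<le> (\<Sum>i\<in>U. kl (y i) (1 / real (card U)))"
      using f(3) card_U_pos by (intro sum_nonneg kl_nonneg) (auto simp: less_imp_le)
    also have "\<dots> = (\<Sum>i\<in>U. y i * ln (y i) + y i * ln (real (card U)) - y i + 1 / real (card U))"
      using card_U_pos by (intro sum.cong refl) (simp add: kl_def ln_div)
    also have "\<dots> = (\<Sum>i\<in>U. y i * ln (y i)) + ln (real (card U))"
      using f(2) card_U_pos unfolding distribution_def
      by (simp add: sum.distrib sum_subtractf flip: sum_distrib_right)
    finally have "72 * D * (- ln (real (card U))) \<le> 72 * D * (\<Sum>i\<in>U. y i * ln (y i))"
      using D_pos by (intro mult_left_mono) auto
    moreover have "0 \<le> 2 * arc_sum (\<lambda>i j. y i * (x i j)\<^sup>2)"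
      using f(3) by (intro mult_nonneg_nonneg sum_nonneg) (auto simp: less_imp_le)
    ultimately show ?thesis by (simp add: pot_def reg_def)
  qed
  then show ?thesis by (simp add: regret_inv_def)
qed

lemma regret_inv_step:
  assumes inv: "regret_inv \<tau> k Z L" and z: "near_min \<tau> Z L xz yz"
    and w: "near_min \<tau> (\<lambda>i. Z i + yz i) (\<lambda>i. L i + load xz i) xw yw" and \<tau>: "0 \<le> \<tau>"
  shows "regret_inv \<tau> (Suc k) (\<lambda>i. Z i + yw i) (\<lambda>i. L i + load xw i)"
  unfolding regret_inv_def
proof (intro conjI allI impI)
  fix x y assume n: "near_min \<tau> (\<lambda>i. Z i + yw i) (\<lambda>i. L i + load xw i) x y"
  have "- (72 * D * ln (real (card U))) - arc_sum (\<lambda>i j. Z i) - real k * (16 * D * \<tau>) \<le> pot Z L xz yz"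
    using inv z by (simp add: regret_inv_def)
  with extragradient_step[OF z w n \<tau>]
  show "- (72 * D * ln (real (card U))) - arc_sum (\<lambda>i j. Z i + yw i) - real (Suc k) * (16 * D * \<tau>)
    \<le> pot (\<lambda>i. Z i + yw i) (\<lambda>i. L i + load xw i) x y"
    by (simp add: sum.distrib algebra_simps)
next
  fix I assume I: "I \<subseteq> U"
  then have "real k * inner_arcs I \<le> (\<Sum>i\<in>I. L i)" using inv by (simp add: regret_inv_def)
  with load_sum_ge_inner_arcs[OF near_min_feasible(1)[OF w] I]
  show "real (Suc k) * inner_arcs I \<le> (\<Sum>i\<in>I. L i + load xw i)"
    by (simp add: sum.distrib algebra_simps)
qed

text \<open>
  Compare the minimum of the potential with its value at a particular pair. The distribution is
  uniform on \<open>I\<close>, which turns the accumulated loads into the density of \<open>I\<close>. The orientation \<open>sgn (Z j - Z i)\<close>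
  loads the end with the smaller weight, which turns the accumulated distributions into the sum of
  minima.
\<close>

lemma regret_inv_density:
  assumes inv: "regret_inv \<tau> k Z L" and \<tau>: "0 < \<tau>" and I: "I \<subseteq> U" "I \<noteq> {}"
  shows "real k * (inner_arcs I / real (card I)) \<le>
    arc_sum (\<lambda>i j. min (Z i) (Z j)) + 2 * D + 72 * D * ln (real (card U)) + (2 * real k + 1) * (8 * D * \<tau>)"
proof -
  obtain x y where nm: "near_min \<tau> Z L x y" using near_min_exists[OF \<tau>] by blast
  note f = near_min_feasible[OF nm]
  define u where "u i j = sgn (Z j - Z i)" for i j
  define v where "v i = (if i \<in> I then 1 / real (card I) else 0)" for i
  have finI: "finite I" using I fin_U finite_subset by blast
  then have cI: "0 < real (card I)" using I by (simp add: card_gt_0_iff)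
  have sumv: "(\<Sum>i\<in>U. h i * v i) = (\<Sum>i\<in>I. h i) / real (card I)" for h
  proof -
    have "(\<Sum>i\<in>U. h i * v i) = (\<Sum>i\<in>I. h i * v i)"
      using I fin_U by (intro sum.mono_neutral_right) (auto simp: v_def)
    then show ?thesis by (simp add: v_def sum_divide_distrib)
  qed
  have ou: "orientation u"
    unfolding orientation_def u_def by (auto simp: sgn_if)
  have dv: "distribution v"
    using sumv[of "\<lambda>i. 1"] cI by (simp add: distribution_def v_def)
  have v0: "0 \<le> v i" for i by (simp add: v_def)
  have "reg u v \<le> 2 * D"
  proof -
    have "arc_sum (\<lambda>i j. v i * (u i j)\<^sup>2) \<le> arc_sum (\<lambda>i j. v i)"
      using v0 orientation_abs[OF ou] by (intro sum_mono mult_left_le) (auto simp: abs_square_le_1)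
    also have "\<dots> \<le> D * (\<Sum>i\<in>U. v i)" using v0 by (intro arc_sum_le_vertex_sum)
    also have "\<dots> = D" using dv by (simp add: distribution_def)
    finally have "arc_sum (\<lambda>i j. v i * (u i j)\<^sup>2) \<le> D" .
    moreover have "(\<Sum>i\<in>U. v i * ln (v i)) \<le> 0"
      using cI by (intro sum_nonpos) (auto simp: v_def ln_div)
    then have "72 * D * (\<Sum>i\<in>U. v i * ln (v i)) \<le> 0"
      using D_pos by (simp add: mult_nonneg_nonpos)
    ultimately show ?thesis by (simp add: reg_def)
  qed
  moreover have "arc_sum (\<lambda>i j. Z i) + arc_sum (\<lambda>i j. Z i * u i j) = arc_sum (\<lambda>i j. min (Z i) (Z j))"
  proof -
    have "2 * (arc_sum (\<lambda>i j. Z i * (1 + u i j))) =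
       arc_sum (\<lambda>i j. Z i * (1 + u i j)) + arc_sum (\<lambda>i j. Z j * (1 + u j i))"
      using arc_sum_swap[of "\<lambda>i j. Z i * (1 + u i j)"] by simp
    also have "\<dots> = 2 * arc_sum (\<lambda>i j. min (Z i) (Z j))"
      unfolding sum.distrib[symmetric] sum_distrib_left
      by (intro sum.cong refl) (auto simp: u_def sgn_if min_def)
    finally show ?thesis by (simp add: distrib_left sum.distrib)
  qed
  moreover have "real k * (inner_arcs I / real (card I)) \<le> (\<Sum>i\<in>U. L i * v i)"
    unfolding sumv using inv I cI by (simp add: regret_inv_def divide_right_mono)
  moreover have "- (72 * D * ln (real (card U))) - arc_sum (\<lambda>i j. Z i) - real k * (16 * D * \<tau>) \<le> pot Z L x y"
    using inv nm by (simp add: regret_inv_def)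
  moreover have "pot Z L x y + breg x y u v - 8 * D * \<tau> \<le> pot Z L u v"
    by (rule near_min_pot[OF nm _ ou dv]) (use \<tau> in simp)
  moreover have "0 \<le> breg x y u v" using f ou v0 by (intro breg_nonneg) auto
  ultimately show ?thesis unfolding pot_def[of Z L u v] by (simp add: algebra_simps)
qed

section \<open>Level sets\<close>

text \<open>
  Layer cake: lower all positive values of \<open>y\<close> by their minimum. The sum of minima then drops by that
  amount times the number of arcs inside the support, the sum of \<open>y\<close> by that amount times the size of
  the support.
\<close>

lemma min_sum_le_density:
  assumes dens: "\<And>I. I \<subseteq> U \<Longrightarrow> inner_arcs I \<le> \<kappa> * real (card I)"
    and "\<And>i. i \<in> U \<Longrightarrow> 0 \<le> y i"
  shows "arc_sum (\<lambda>i j. min (y i) (y j)) \<le> \<kappa> * (\<Sum>i\<in>U. y i)"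
  using assms(2)
proof (induction "card {i \<in> U. 0 < y i}" arbitrary: y rule: less_induct)
  case less
  define S where "S = {i \<in> U. 0 < y i}"
  have S: "S \<subseteq> U" "finite S" using fin_U by (auto simp: S_def)
  show ?case
  proof (cases "S = {}")
    case True
    then have "y i = 0" if "i \<in> U" for i using less.prems[OF that] that by (force simp: S_def)
    moreover have "j \<in> U" if "i \<in> U" "j \<in> N i" for i j using N_sub that by blast
    ultimately show ?thesis by simp
  next
    case False
    define m where "m = Min (y ` S)"
    define y' where "y' i = (if i \<in> S then y i - m else 0)" for i
    have m: "m \<le> y i" if "i \<in> S" for i unfolding m_def using that S by simp
    obtain i0 where i0: "i0 \<in> S" "y i0 = m"
      using Min_in[of "y ` S"] S False unfolding m_def by fastforce
    have m0: "0 < m" using i0 by (auto simp: S_def)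
    have out: "y i = 0" if "i \<in> U" "i \<notin> S" for i using less.prems[OF that(1)] that by (auto simp: S_def)
    have y0: "0 \<le> y' i" for i using m by (simp add: y'_def)
    have "{i \<in> U. 0 < y' i} \<subseteq> S - {i0}" using i0 by (auto simp: y'_def split: if_splits)
    then have "card {i \<in> U. 0 < y' i} < card {i \<in> U. 0 < y i}"
      unfolding S_def[symmetric] using S(2) i0(1) by (meson card_Diff1_less card_mono finite_Diff le_less_trans)
    from less.hyps[OF this y0] have IH: "arc_sum (\<lambda>i j. min (y' i) (y' j)) \<le> \<kappa> * (\<Sum>i\<in>U. y' i)" .
    have "arc_sum (\<lambda>i j. min (y i) (y j)) =
        arc_sum (\<lambda>i j. min (y' i) (y' j) + (if i \<in> S \<and> j \<in> S then m else 0))"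
    proof (intro sum.cong refl)
      fix i j assume "i \<in> U" "j \<in> N i"
      then have "i \<in> U" "j \<in> U" using N_sub by auto
      then show "min (y i) (y j) = min (y' i) (y' j) + (if i \<in> S \<and> j \<in> S then m else 0)"
        using out[of i] out[of j] m[of i] m[of j] m0 by (auto simp: y'_def min_def)
    qed
    also have "\<dots> = arc_sum (\<lambda>i j. min (y' i) (y' j)) + m * inner_arcs S"
    proof -
      have "arc_sum (\<lambda>i j. if i \<in> S \<and> j \<in> S then m else 0) = (\<Sum>i\<in>S. \<Sum>j\<in>N i. if j \<in> S then m else 0)"
        using S fin_U by (intro sum.mono_neutral_cong_right) (auto intro!: fin_N)
      also have "\<dots> = (\<Sum>i\<in>S. \<Sum>j\<in>N i \<inter> S. m)"
        using S(1) by (intro sum.cong refl sum.inter_restrict[symmetric] fin_N) auto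
      finally show ?thesis by (simp add: sum.distrib inner_arcs_def sum_distrib_left mult.commute)
    qed
    also have "\<dots> \<le> \<kappa> * (\<Sum>i\<in>U. y' i) + m * (\<kappa> * real (card S))"
      using IH dens[OF S(1)] m0 by (intro add_mono mult_left_mono) auto
    also have "(\<Sum>i\<in>U. y i) = (\<Sum>i\<in>U. y' i) + m * real (card S)"
    proof -
      have "(\<Sum>i\<in>U. y i) = (\<Sum>i\<in>U. y' i + (if i \<in> S then m else 0))"
        using out by (intro sum.cong refl) (auto simp: y'_def)
      also have "\<dots> = (\<Sum>i\<in>U. y' i) + (\<Sum>i\<in>U \<inter> S. m)"
        using fin_U by (simp only: sum.distrib sum.inter_restrict)
      finally show ?thesis using S(1) by (simp add: Int_absorb1 mult.commute)
    qed
    then have "\<kappa> * (\<Sum>i\<in>U. y' i) + m * (\<kappa> * real (card S)) = \<kappa> * (\<Sum>i\<in>U. y i)"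
      by (simp add: algebra_simps)
    finally show ?thesis .
  qed
qed

end

section \<open>Adjacency arrays\<close>

locale adjacency =
  fixes nb :: "nat list list"
  assumes distinct_nb: "i < length nb \<Longrightarrow> distinct (nb ! i)"
    and nb_range: "i < length nb \<Longrightarrow> set (nb ! i) \<subseteq> {..<length nb}"
    and nb_sym: "i < length nb \<Longrightarrow> j \<in> set (nb ! i) \<Longrightarrow> i \<in> set (nb ! j)"
    and nb_nonempty: "concat nb \<noteq> []"
begin

definition n :: nat where "n = length nb"

definition M :: nat where "M = length (concat nb)"

definition nbhd :: "nat \<Rightarrow> nat set" where "nbhd i = set (nb ! i)"

text \<open>
  Only the vertices of positive degree take part in the game.
\<close>

definition U :: "nat set" where "U = {i. i < n \<and> nbhd i \<noteq> {}}"

definition off :: "nat \<Rightarrow> nat" where "off i = length (concat (take i nb))"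

definition tgt :: "nat \<Rightarrow> nat" where "tgt a = concat nb ! a"

definition src :: "nat \<Rightarrow> nat" where "src a = (LEAST i. a < off (Suc i))"

lemma M_pos: "0 < M"
  using nb_nonempty by (simp add: M_def)

lemma off_0: "off 0 = 0"
  by (simp add: off_def)

lemma off_n: "off n = M"
  by (simp add: off_def n_def M_def)

lemma off_Suc: "i < n \<Longrightarrow> off (Suc i) = off i + card (nbhd i)"
  by (simp add: off_def n_def nbhd_def take_Suc_conv_app_nth distinct_nb distinct_card)

lemma off_mono: "i \<le> j \<Longrightarrow> off i \<le> off j"
proof -
  assume "i \<le> j"
  then have "take i nb = take i (take j nb)" by (simp add: min_def)
  then have "concat (take j nb) = concat (take i nb) @ concat (drop i (take j nb))"
    by (metis append_take_drop_id concat_append)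
  then show ?thesis by (simp add: off_def)
qed

lemma src_eq: "off i \<le> a \<Longrightarrow> a < off (Suc i) \<Longrightarrow> src a = i"
  unfolding src_def
proof (rule Least_equality)
  fix k assume "off i \<le> a" "a < off (Suc k)"
  then show "i \<le> k" using off_mono[of "Suc k" i] by (meson leD le_trans not_less_eq_eq)
qed

lemma src_bounds:
  assumes "a < M"
  shows "off (src a) \<le> a" "a < off (Suc (src a))" "src a < n"
proof -
  have ex: "a < off (Suc (n - 1))"
    using assms off_n off_0 by (cases n) auto
  show s: "a < off (Suc (src a))" unfolding src_def by (rule LeastI[of "\<lambda>i. a < off (Suc i)", OF ex])
  have "src a \<le> n - 1" unfolding src_def by (rule Least_le[of "\<lambda>i. a < off (Suc i)", OF ex])
  moreover have "0 < n" using off_n off_0 M_pos by (cases n) auto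
  ultimately show "src a < n" by simp
  show "off (src a) \<le> a"
  proof (cases "src a")
    case (Suc k)
    then have "\<not> a < off (Suc k)" unfolding src_def using not_less_Least[of k "\<lambda>i. a < off (Suc i)"] by simp
    then show ?thesis using Suc by simp
  qed (simp add: off_0)
qed

lemma tgt_nth: "i < n \<Longrightarrow> k < length (nb ! i) \<Longrightarrow> tgt (off i + k) = nb ! i ! k"
proof -
  assume i: "i < n" "k < length (nb ! i)"
  have "nb = take i nb @ nb ! i # drop (Suc i) nb" using i by (simp add: n_def id_take_nth_drop)
  then have "concat nb = concat (take i nb) @ nb ! i @ concat (drop (Suc i) nb)"
    by (metis concat.simps(2) concat_append)
  then show ?thesis using i by (simp add: tgt_def off_def nth_append)
qed

lemma tgt_in_nbhd:
  assumes "a < M"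
  shows "tgt a \<in> nbhd (src a)"
proof -
  note s = src_bounds[OF assms]
  have "card (nbhd (src a)) = length (nb ! src a)"
    using s by (simp add: nbhd_def distinct_card distinct_nb n_def)
  then have k: "a - off (src a) < length (nb ! src a)" using s off_Suc[OF s(3)] by simp
  have "tgt (off (src a) + (a - off (src a))) = nb ! src a ! (a - off (src a))"
    by (rule tgt_nth[OF s(3) k])
  then show ?thesis using s k by (simp add: nbhd_def)
qed

lemma src_in_U: "a < M \<Longrightarrow> src a \<in> U"
  using tgt_in_nbhd[of a] src_bounds[of a] by (auto simp: U_def)

lemma nbhd_U: "i \<in> U \<Longrightarrow> nbhd i \<subseteq> U"
  using nb_range[of i] nb_sym[of i] by (fastforce simp: U_def n_def nbhd_def)

lemma tgt_in_U: "a < M \<Longrightarrow> tgt a \<in> U"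
  using tgt_in_nbhd nbhd_U src_in_U by blast

lemma off_less_M: "i \<in> U \<Longrightarrow> off i < M"
proof -
  assume i: "i \<in> U"
  then have "0 < card (nbhd i)" by (simp add: U_def nbhd_def card_gt_0_iff)
  then have "off i < off (Suc i)" using off_Suc i by (simp add: U_def)
  also have "\<dots> \<le> M" using off_mono[of "Suc i" n] off_n i by (simp add: U_def)
  finally show ?thesis .
qed

lemma src_off: "i \<in> U \<Longrightarrow> src (off i) = i"
proof -
  assume i: "i \<in> U"
  then have "0 < card (nbhd i)" by (simp add: U_def nbhd_def card_gt_0_iff)
  then show ?thesis using off_Suc i by (intro src_eq) (auto simp: U_def)
qed

lemma segment_sum:
  fixes h :: "nat \<Rightarrow> real"
  assumes "i < n"
  shows "(\<Sum>a\<in>{off i..<off (Suc i)}. h (tgt a)) = (\<Sum>j\<in>nbhd i. h j)"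
proof -
  have d: "distinct (nb ! i)" using assms distinct_nb by (simp add: n_def)
  have "(\<Sum>j\<in>nbhd i. h j) = (\<Sum>k<length (nb ! i). h (nb ! i ! k))"
    unfolding nbhd_def by (rule sum.reindex_bij_betw[symmetric], rule bij_betw_nth[OF d]) auto
  also have "\<dots> = (\<Sum>k<length (nb ! i). h (tgt (off i + k)))"
    using tgt_nth[OF assms] by simp
  also have "\<dots> = (\<Sum>a\<in>{off i..<off i + length (nb ! i)}. h (tgt a))"
    using sum.shift_bounds_nat_ivl[of "\<lambda>a. h (tgt a)" 0 "off i" "length (nb ! i)"]
    by (simp add: lessThan_atLeast0 add.commute)
  finally show ?thesis using off_Suc[OF assms] d by (simp add: nbhd_def distinct_card)
qed

lemma segment_src: "a \<in> {off i..<off (Suc i)} \<Longrightarrow> src a = i"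
  by (simp add: src_eq)

lemma sum_by_segments:
  fixes g :: "nat \<Rightarrow> real"
  shows "(\<Sum>a<M. g a) = (\<Sum>i<n. \<Sum>a\<in>{off i..<off (Suc i)}. g a)"
proof -
  have "(\<Sum>a<off k. g a) = (\<Sum>i<k. \<Sum>a\<in>{off i..<off (Suc i)}. g a)" for k
  proof (induction k)
    case (Suc k)
    have "{..<off (Suc k)} = {..<off k} \<union> {off k..<off (Suc k)}"
      using off_mono[of k "Suc k"] by auto
    then have "(\<Sum>a<off (Suc k). g a) = (\<Sum>a<off k. g a) + (\<Sum>a\<in>{off k..<off (Suc k)}. g a)"
      by (simp add: sum.union_disjoint ivl_disj_int)
    then show ?case using Suc by simp
  qed (simp add: off_0)
  from this[of n] show ?thesis by (simp add: off_n)
qed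

lemma sum_n_eq_U: "(\<And>i. nbhd i = {} \<Longrightarrow> h i = 0) \<Longrightarrow> (\<Sum>i<n. h i :: real) = (\<Sum>i\<in>U. h i)"
  by (rule sum.mono_neutral_right) (auto simp: U_def)

lemma arc_sum_eq:
  fixes h :: "nat \<Rightarrow> nat \<Rightarrow> real"
  shows "(\<Sum>a<M. h (src a) (tgt a)) = (\<Sum>i\<in>U. \<Sum>j\<in>nbhd i. h i j)"
proof -
  have "(\<Sum>a<M. h (src a) (tgt a)) = (\<Sum>i<n. \<Sum>a\<in>{off i..<off (Suc i)}. h i (tgt a))"
    unfolding sum_by_segments[of "\<lambda>a. h (src a) (tgt a)"]
  proof (intro sum.cong refl)
    fix i a assume "a \<in> {off i..<off (Suc i)}"
    from segment_src[OF this] show "h (src a) (tgt a) = h i (tgt a)" by simp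
  qed
  also have "\<dots> = (\<Sum>i<n. \<Sum>j\<in>nbhd i. h i j)"
    by (intro sum.cong refl segment_sum) simp
  also have "\<dots> = (\<Sum>i\<in>U. \<Sum>j\<in>nbhd i. h i j)" by (rule sum_n_eq_U) simp
  finally show ?thesis .
qed

lemma vertex_sum_eq: "(\<Sum>a<M. y (src a) / real (card (nbhd (src a)))) = (\<Sum>i\<in>U. y i :: real)"
  unfolding arc_sum_eq[of "\<lambda>i j. y i / real (card (nbhd i))"]
  by (intro sum.cong refl) (auto simp: U_def nbhd_def)

lemma card_U_le_M: "card U \<le> M"
proof -
  have "inj_on off U" by (metis inj_onI src_off)
  moreover have "off ` U \<subseteq> {..<M}" using off_less_M by auto
  ultimately show ?thesis by (metis card_inj_on_le card_lessThan finite_lessThan)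
qed

lemma finite_U: "finite U"
  by (simp add: U_def)

lemma density_game: "0 < D \<Longrightarrow> (\<And>i. i \<in> U \<Longrightarrow> real (card (nbhd i)) \<le> D) \<Longrightarrow> density_game U nbhd D"
proof
  assume *: "\<And>i. i \<in> U \<Longrightarrow> real (card (nbhd i)) \<le> D"
  show "U \<noteq> {}" using src_in_U M_pos by blast
  show "i \<in> nbhd j" if "i \<in> U" "j \<in> nbhd i" for i j
    using that nb_sym by (auto simp: U_def n_def nbhd_def)
  show "real (card (nbhd i)) \<le> D" if "i \<in> U" for i using * that .
qed (use finite_U nbhd_U in auto)

end

section \<open>Densities in terms of vertex numbers\<close>

locale adjacency_graph =
  fixes V :: "'a set" and E :: "'a set set" and vs :: "'a list" and nb :: "nat list list"
  assumes graph: "simple_graph V E" and edges: "E \<noteq> {}" and adj: "adjacency_lists V E vs nb"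
begin

lemma vs: "distinct vs" "set vs = V" "length nb = length vs"
  using adj by (auto simp: adjacency_lists_def)

lemma nb: "i < length vs \<Longrightarrow> distinct (nb ! i)"
  "i < length vs \<Longrightarrow> set (nb ! i) = {j. j < length vs \<and> {vs ! i, vs ! j} \<in> E}"
  using adj by (auto simp: adjacency_lists_def)

lemma edge_indices:
  assumes "e \<in> E"
  obtains i j where "i < length vs" "j < length vs" "i \<noteq> j" "e = {vs ! i, vs ! j}"
proof -
  have "e \<subseteq> V" "card e = 2" using graph assms by (auto simp: simple_graph_def)
  then obtain u v where "e = {u, v}" "u \<noteq> v" "u \<in> V" "v \<in> V" by (auto simp: card_2_iff)
  then show ?thesis using that vs(2) by (metis in_set_conv_nth)
qed

lemma finite_E: "finite E"
proof -
  have "E \<subseteq> Pow V" "finite V" using graph by (auto simp: simple_graph_def)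
  then show ?thesis using finite_subset by blast
qed

text \<open>
  Every edge joins exactly two ordered pairs of vertex numbers.
\<close>

lemma card_arcs:
  assumes "E' \<subseteq> E"
  shows "(\<Sum>i<length vs. card {j. j < length vs \<and> {vs ! i, vs ! j} \<in> E'}) = 2 * card E'"
proof -
  let ?n = "length vs"
  let ?P = "\<lambda>e. {(i, j). i < ?n \<and> j < ?n \<and> {vs ! i, vs ! j} = e}"
  have card2: "card (?P e) = 2" if "e \<in> E'" for e
  proof -
    have "e \<in> E" using that assms by blast
    then obtain a b where ab: "a < ?n" "b < ?n" "a \<noteq> b" "e = {vs ! a, vs ! b}"
      by (rule edge_indices)
    have "?P e = {(a, b), (b, a)}"
      using ab vs(1) by (auto simp: doubleton_eq_iff nth_eq_iff_index_eq)
    then show ?thesis using ab(3) by simp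
  qed
  have fin: "finite (?P e)" for e
    by (rule finite_subset[of _ "{..<?n} \<times> {..<?n}"]) auto
  have "(\<Sum>i<?n. card {j. j < ?n \<and> {vs ! i, vs ! j} \<in> E'}) =
      card (SIGMA i:{..<?n}. {j. j < ?n \<and> {vs ! i, vs ! j} \<in> E'})"
    by simp
  also have "(SIGMA i:{..<?n}. {j. j < ?n \<and> {vs ! i, vs ! j} \<in> E'}) = (\<Union>e\<in>E'. ?P e)"
    by auto
  also have "card \<dots> = (\<Sum>e\<in>E'. card (?P e))"
    using finite_subset[OF assms finite_E] fin by (intro card_UN_disjoint) auto
  also have "\<dots> = 2 * card E'" using card2 by simp
  finally show ?thesis .
qed

sublocale adjacency nb
proof
  fix i assume i: "i < length nb"
  then show "distinct (nb ! i)" "set (nb ! i) \<subseteq> {..<length nb}" using nb vs by auto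
  show "i \<in> set (nb ! j)" if "j \<in> set (nb ! i)" for j
    using i that nb vs(3) by (auto simp: insert_commute)
next
  obtain e where "e \<in> E" using edges by blast
  then obtain i j where "i < length vs" "j < length vs" "{vs ! i, vs ! j} \<in> E"
    using edge_indices by metis
  then have "j \<in> set (nb ! i)" "nb ! i \<in> set nb" using nb(2) vs(3) by auto
  then have "j \<in> set (concat nb)" by auto
  then show "concat nb \<noteq> []" by (metis empty_iff empty_set)
qed

lemma n_eq: "n = length vs" "n = card V"
  using vs distinct_card[of vs] by (auto simp: n_def)

lemma nbhd_eq: "i < n \<Longrightarrow> nbhd i = {j. j < length vs \<and> {vs ! i, vs ! j} \<in> E}"
  using nb(2) by (simp add: nbhd_def n_eq)

lemma M_eq: "M = 2 * card E"
proof -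
  have "real M = (\<Sum>i\<in>U. \<Sum>j\<in>nbhd i. 1)" using arc_sum_eq[of "\<lambda>_ _. 1"] by simp
  also have "\<dots> = (\<Sum>i<n. \<Sum>j\<in>nbhd i. 1)" by (rule sum_n_eq_U[symmetric]) simp
  also have "\<dots> = real (\<Sum>i<n. card (nbhd i))" by simp
  also have "(\<Sum>i<n. card (nbhd i)) = 2 * card E"
    using card_arcs[of E] by (simp add: nbhd_eq n_eq(1)[symmetric])
  finally show ?thesis by linarith
qed

lemma degree_eq:
  assumes "i < n"
  shows "card (nbhd i) = vertex_degree E (vs ! i)"
proof -
  have "bij_betw (\<lambda>j. {vs ! i, vs ! j}) (nbhd i) {e \<in> E. vs ! i \<in> e}"
    unfolding bij_betw_def
  proof (intro conjI inj_onI subset_antisym subsetI)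
    fix j k assume "j \<in> nbhd i" "k \<in> nbhd i" "{vs ! i, vs ! j} = {vs ! i, vs ! k}"
    then show "j = k" using assms vs(1)
      by (auto simp: nbhd_eq doubleton_eq_iff nth_eq_iff_index_eq n_eq)
  next
    fix e assume e: "e \<in> {e \<in> E. vs ! i \<in> e}"
    then obtain a b where "a < length vs" "b < length vs" "a \<noteq> b" "e = {vs ! a, vs ! b}"
      using edge_indices by blast
    with e show "e \<in> (\<lambda>j. {vs ! i, vs ! j}) ` nbhd i" using assms vs(1)
      by (auto simp: nbhd_eq nth_eq_iff_index_eq n_eq(1) insert_commute)
  qed (use assms in \<open>auto simp: nbhd_eq\<close>)
  then show ?thesis by (simp add: vertex_degree_def bij_betw_same_card)
qed

lemma degree_le_max: "i < n \<Longrightarrow> card (nbhd i) \<le> max_degree V E"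
  unfolding max_degree_def degree_eq using graph vs n_eq(1)
  by (intro Max_ge) (auto simp: simple_graph_def)

lemma inner_arcs_eq:
  assumes "I \<subseteq> {..<n}"
  shows "(\<Sum>i\<in>I. card (nbhd i \<inter> I)) = 2 * card (induced_edges E ((!) vs ` I))"
proof -
  have mem: "vs ! k \<in> (!) vs ` I \<longleftrightarrow> k \<in> I" if "k < n" for k
    using that assms vs(1) n_eq(1) by (auto simp: nth_eq_iff_index_eq)
  have "2 * card (induced_edges E ((!) vs ` I)) =
     (\<Sum>i<n. card {j. j < length vs \<and> {vs ! i, vs ! j} \<in> induced_edges E ((!) vs ` I)})"
    unfolding n_eq(1) by (rule card_arcs[symmetric]) (auto simp: induced_edges_def)
  also have "\<dots> = (\<Sum>i<n. card (if i \<in> I then nbhd i \<inter> I else {}))"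
    using mem by (intro sum.cong refl arg_cong[where f = card])
      (auto simp: induced_edges_def nbhd_eq n_eq(1)[symmetric])
  also have "\<dots> = (\<Sum>i\<in>I. card (nbhd i \<inter> I))"
    using assms by (intro sum.mono_neutral_cong_right) auto
  finally show ?thesis by simp
qed

abbreviation "\<rho> \<equiv> max_subgraph_density V E"

lemma density_finite: "finite ((\<lambda>S. real (card (induced_edges E S)) / real (card S)) ` {S. S \<subseteq> V \<and> S \<noteq> {}})"
proof -
  have "finite V" using graph by (simp add: simple_graph_def)
  then show ?thesis by simp
qed

lemma density_le: "S \<subseteq> V \<Longrightarrow> S \<noteq> {} \<Longrightarrow> real (card (induced_edges E S)) / real (card S) \<le> \<rho>"
  unfolding max_subgraph_density_def using density_finite by (intro Max_ge) auto

lemma density_ge_half: "1 / 2 \<le> \<rho>"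
proof -
  obtain e where e: "e \<in> E" using edges by blast
  then have eV: "e \<subseteq> V" "card e = 2" using graph by (auto simp: simple_graph_def)
  have "{e} \<subseteq> induced_edges E e" using e by (auto simp: induced_edges_def)
  then have "card {e} \<le> card (induced_edges E e)"
    using finite_E by (intro card_mono) (auto simp: induced_edges_def)
  then have "1 / 2 \<le> real (card (induced_edges E e)) / real (card e)" using eV by simp
  also have "\<dots> \<le> \<rho>" using eV by (intro density_le) auto
  finally show ?thesis .
qed

lemma inner_arcs_le_density:
  assumes "I \<subseteq> U"
  shows "(\<Sum>i\<in>I. real (card (nbhd i \<inter> I))) \<le> 2 * \<rho> * real (card I)"
proof (cases "I = {}")
  case False
  have I: "I \<subseteq> {..<n}" using assms by (auto simp: U_def)
  then have inj: "inj_on ((!) vs) I"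
    using inj_on_nth[OF vs(1)] n_eq(1) by auto
  have "(!) vs ` I \<subseteq> V" using I vs n_eq(1) by auto
  then have "real (card (induced_edges E ((!) vs ` I))) / real (card I) \<le> \<rho>"
    using density_le[of "(!) vs ` I"] False card_image[OF inj] by simp
  moreover have "0 < card I" using False I by (simp add: card_gt_0_iff finite_subset)
  ultimately show ?thesis using inner_arcs_eq[OF I]
    by (simp add: field_simps flip: of_nat_sum)
qed simp

text \<open>
  Isolated vertices are removed from a densest set, which cannot decrease its density.
\<close>

lemma densest_set:
  obtains I where "I \<subseteq> U" "I \<noteq> {}" "2 * \<rho> \<le> (\<Sum>i\<in>I. real (card (nbhd i \<inter> I))) / real (card I)"
proof -
  have "E \<noteq> {} \<Longrightarrow> {S. S \<subseteq> V \<and> S \<noteq> {}} \<noteq> {}"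
    using graph by (fastforce simp: simple_graph_def)
  then have "\<rho> \<in> (\<lambda>S. real (card (induced_edges E S)) / real (card S)) ` {S. S \<subseteq> V \<and> S \<noteq> {}}"
    unfolding max_subgraph_density_def using density_finite edges by (intro Max_in) auto
  then obtain S where S: "S \<subseteq> V" "S \<noteq> {}" "\<rho> = real (card (induced_edges E S)) / real (card S)"
    by auto
  define J where "J = {i. i < n \<and> vs ! i \<in> S}"
  define I where "I = J \<inter> U"
  have J: "J \<subseteq> {..<n}" by (auto simp: J_def)
  have SJ: "(!) vs ` J = S" using S(1) vs n_eq(1) by (auto simp: J_def) (metis (mono_tags) image_eqI in_set_conv_nth mem_Collect_eq subset_iff)
  have "inj_on ((!) vs) J" using inj_on_nth[OF vs(1)] J n_eq(1) by auto
  then have cJ: "card J = card S" using card_image SJ by metis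
  have finJ: "finite J" using J finite_subset by blast
  have eq: "(\<Sum>i\<in>J. card (nbhd i \<inter> J)) = (\<Sum>i\<in>I. card (nbhd i \<inter> I))"
  proof (rule sum.mono_neutral_cong_right[OF finJ])
    show "\<forall>i\<in>J - I. card (nbhd i \<inter> J) = 0" using J by (auto simp: I_def U_def)
    show "card (nbhd i \<inter> J) = card (nbhd i \<inter> I)" if "i \<in> I" for i
    proof -
      have "nbhd i \<subseteq> U" using that nbhd_U by (simp add: I_def)
      then have "nbhd i \<inter> J = nbhd i \<inter> I" by (auto simp: I_def)
      then show ?thesis by simp
    qed
  qed (auto simp: I_def)
  have two: "(\<Sum>i\<in>I. card (nbhd i \<inter> I)) = 2 * card (induced_edges E S)"
    using inner_arcs_eq[OF J] eq SJ by simp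
  have "0 < card (induced_edges E S)"
    using S(3) density_ge_half by (cases "card (induced_edges E S)") auto
  then have ne: "I \<noteq> {}" using two by auto
  have "card I \<le> card S" unfolding cJ[symmetric] using finJ by (intro card_mono) (auto simp: I_def)
  moreover have "0 < card I" using ne finJ by (simp add: I_def card_gt_0_iff)
  ultimately have "2 * \<rho> \<le> 2 * real (card (induced_edges E S)) / real (card I)"
    unfolding S(3) by (simp add: frac_le)
  also have "\<dots> = (\<Sum>i\<in>I. real (card (nbhd i \<inter> I))) / real (card I)"
    using two by (simp flip: of_nat_sum)
  finally show ?thesis using that[of I] ne by (auto simp: I_def)
qed

end

section \<open>Programs whose work is bounded by their depth\<close>

text \<open>
  \<open>p\<close> bounds the number of processors that any step uses. The work of a step is then at most \<open>p\<close> times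
  the size of its expressions, for which 100 is ample, so the bound on the work is preserved by sequencing
  and loops, and \<open>d\<close> is the only quantity to keep track of.
\<close>

definition executes :: "nat \<Rightarrow> com \<Rightarrow> store \<Rightarrow> nat \<Rightarrow> (store \<Rightarrow> bool) \<Rightarrow> bool" where
  "executes p c s d Q \<longleftrightarrow> (\<exists>w d' t. runs c s w d' t \<and> w \<le> 100 * p * d' \<and> d' \<le> d \<and> Q t)"

lemma executes_mono:
  "executes p c s d Q \<Longrightarrow> d \<le> d' \<Longrightarrow> (\<And>t. Q t \<Longrightarrow> R t) \<Longrightarrow> executes p c s d' R"
  unfolding executes_def by (meson order_trans)

lemma executes_Assign:
  assumes "0 < p" "1 + expr_work e \<le> 100"
    "Q (s\<lparr>scalars := (scalars s)(x := expr_val e s 0)\<rparr>)"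
  shows "executes p (Assign x e) s (1 + expr_depth e) Q"
proof -
  have "1 + expr_work e \<le> 100 * p * (1 + expr_depth e)"
    using assms(1,2) mult_le_mono[of 1 p 1 "1 + expr_depth e"] by simp
  then show ?thesis unfolding executes_def using assms(3) runs.Assign by blast
qed

lemma executes_ParAssign:
  assumes "0 < p" "2 + expr_work b + expr_work e \<le> 100" "nat \<lceil>expr_val b s 0\<rceil> \<le> p"
    "Q (s\<lparr>arrays := (arrays s)(a := map (expr_val e s) [0..<nat \<lceil>expr_val b s 0\<rceil>])\<rparr>)"
  shows "executes p (ParAssign a b e) s (1 + expr_depth b + (1 + expr_depth e)) Q"
proof -
  have "nat \<lceil>expr_val b s 0\<rceil> * (1 + expr_work e) \<le> p * (1 + expr_work e)"
    using assms(3) by (intro mult_le_mono1)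
  moreover have "1 + expr_work b \<le> p * (1 + expr_work b)"
    using assms(1) mult_le_mono1[of 1 p "1 + expr_work b"] by simp
  moreover have "p * (1 + expr_work b) + p * (1 + expr_work e) \<le> p * 100"
    unfolding distrib_left[symmetric] using assms(2) by (intro mult_le_mono2) simp
  moreover have "p * 100 \<le> 100 * p * (1 + expr_depth b + (1 + expr_depth e))" by simp
  ultimately have "1 + expr_work b + nat \<lceil>expr_val b s 0\<rceil> * (1 + expr_work e)
    \<le> 100 * p * (1 + expr_depth b + (1 + expr_depth e))" by linarith
  then show ?thesis unfolding executes_def using assms(4) runs.ParAssign[OF refl] by blast
qed

lemma executes_Seq:
  assumes "executes p c s d (\<lambda>t. executes p c' t d' Q)"
  shows "executes p (Seq c c') s (d + d') Q"
proof -
  obtain w e t where 1: "runs c s w e t" "w \<le> 100 * p * e" "e \<le> d" "executes p c' t d' Q"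
    using assms unfolding executes_def[of p c s] by blast
  then obtain w' e' u where 2: "runs c' t w' e' u" "w' \<le> 100 * p * e'" "e' \<le> d'" "Q u"
    by (auto simp: executes_def)
  have "w + w' \<le> 100 * p * (e + e')" using 1 2 by (simp add: distrib_left)
  then show ?thesis unfolding executes_def using runs.Seq[OF 1(1) 2(1)] 1(3) 2(3,4) by (meson add_mono)
qed

lemma executes_WhileLess:
  fixes I :: "nat \<Rightarrow> store \<Rightarrow> bool"
  assumes p: "0 < p" and cheap: "1 + expr_work e + expr_work f \<le> 100" and init: "I 0 s"
    and step: "\<And>k t. I k t \<Longrightarrow> expr_val e t 0 < expr_val f t 0 \<Longrightarrow> k < m \<and> executes p c t d (I (Suc k))"
    and final: "\<And>k t. I k t \<Longrightarrow> \<not> expr_val e t 0 < expr_val f t 0 \<Longrightarrow> Q t"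
  shows "executes p (WhileLess e f c) s
    (m * (1 + max (expr_depth e) (expr_depth f) + d) + (1 + max (expr_depth e) (expr_depth f))) Q"
proof -
  define b where "b = 1 + max (expr_depth e) (expr_depth f)"
  have wb: "1 + expr_work e + expr_work f \<le> 100 * p * b"
    using cheap p mult_le_mono[of 1 p 1 b] by (simp add: b_def)
  have "executes p (WhileLess e f c) t ((m - k) * (b + d) + b) Q" if "I k t" for k t
    using that
  proof (induction "m - k" arbitrary: k t rule: less_induct)
    case less
    show ?case
    proof (cases "expr_val e t 0 < expr_val f t 0")
      case False
      have "b \<le> (m - k) * (b + d) + b" by simp
      then show ?thesis unfolding executes_def
        using runs.WhileFalse[OF False] wb final[OF less.prems False] unfolding b_def by blast
    next
      case True
      with step[OF less.prems] have k: "k < m" and "executes p c t d (I (Suc k))" by auto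
      then obtain w e' u where 1: "runs c t w e' u" "w \<le> 100 * p * e'" "e' \<le> d" "I (Suc k) u"
        by (auto simp: executes_def)
      have "m - Suc k < m - k" using k by simp
      from less.hyps[OF this 1(4)] obtain w' e'' v where 2: "runs (WhileLess e f c) u w' e'' v"
        "w' \<le> 100 * p * e''" "e'' \<le> (m - Suc k) * (b + d) + b" "Q v"
        by (auto simp: executes_def)
      have "1 + expr_work e + expr_work f + w + w' \<le> 100 * p * (b + e' + e'')"
        using wb 1(2) 2(2) by (simp add: distrib_left)
      moreover have "m - k = Suc (m - Suc k)" using k by simp
      then have "b + e' + e'' \<le> (m - k) * (b + d) + b" using 1(3) 2(3) by simp
      ultimately show ?thesis unfolding executes_def
        using runs.WhileTrue[OF True 1(1) 2(1)] 2(4) unfolding b_def by blast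
    qed
  qed
  from this[OF init] show ?thesis by (simp add: b_def)
qed

section \<open>Prefix sums\<close>

lemma array_read_nat: "array_read xs (real i) = (if i < length xs then xs ! i else 0)"
  by (simp add: array_read_def)

lemma array_read_diff:
  "array_read xs (real i - real j) = (if j \<le> i then array_read xs (real (i - j)) else 0)"
proof (cases "j \<le> i")
  case True
  then show ?thesis by (simp add: of_nat_diff)
next
  case False
  then have "real i - real j \<notin> \<nat>" by (auto elim!: Nats_cases)
  with False show ?thesis by (simp add: array_read_def)
qed

definition prefix_sums :: "real list \<Rightarrow> real list" where
  "prefix_sums xs = map (\<lambda>i. \<Sum>k\<le>i. xs ! k) [0..<length xs]"

lemma read_prefix_sums:
  assumes "m \<le> length xs"
  shows "array_read (prefix_sums xs) (real m - 1) = (\<Sum>k<m. xs ! k)"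
proof (cases m)
  case 0
  then show ?thesis using array_read_diff[of _ 0 1] by simp
next
  case (Suc m')
  then show ?thesis using assms array_read_nat[of "prefix_sums xs" m']
    by (simp add: prefix_sums_def lessThan_Suc_atMost)
qed

text \<open>
  Prefix sums by doubling. A read at a negative position yields 0, which is just what is needed to the left of the
  first entry.
\<close>

definition scan :: com where
  "scan = Seq (Assign ''d'' (Lit 1))
     (WhileLess (Scalar ''d'') (Len ''B'')
       (Seq (ParAssign ''B'' (Len ''B'') (Add (Read ''B'' Self) (Read ''B'' (Sub Self (Scalar ''d'')))))
            (Assign ''d'' (Mul (Scalar ''d'') (Lit 2)))))"

definition lg :: "real \<Rightarrow> nat" where
  "lg r = nat \<lceil>log 2 r\<rceil>"

lemma less_lg: "2 ^ k < r \<Longrightarrow> k < lg r"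
proof -
  assume r: "2 ^ k < r"
  then have "0 < r" using zero_less_power[of "2::real" k] by linarith
  then have "real k < log 2 r" using r by (simp add: less_log_iff powr_realpow)
  then show ?thesis unfolding lg_def by linarith
qed

text \<open>
  The array after the window has grown to length \<open>l\<close>; near the left end the truncated subtraction
  shortens the window.
\<close>

definition window_sums :: "nat \<Rightarrow> real list \<Rightarrow> real list" where
  "window_sums l xs = map (\<lambda>i. \<Sum>j\<in>{Suc i - l..i}. xs ! j) [0..<length xs]"

lemma window_sums_double:
  assumes "i < length xs" "0 < l"
  shows "array_read (window_sums l xs) (real i) + array_read (window_sums l xs) (real i - real l)
    = window_sums (2 * l) xs ! i"
proof (cases "l \<le> i")
  case True
  have split: "{Suc i - 2 * l..i} = {Suc (i - l) - l..i - l} \<union> {Suc i - l..i}"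
    using True assms(2) by auto
  have "(\<Sum>j\<in>{Suc i - 2 * l..i}. xs ! j) =
    (\<Sum>j\<in>{Suc (i - l) - l..i - l}. xs ! j) + (\<Sum>j\<in>{Suc i - l..i}. xs ! j)"
    unfolding split using True assms(2) by (intro sum.union_disjoint) auto
  moreover have "array_read (window_sums l xs) (real i - real l) = (\<Sum>j\<in>{Suc (i - l) - l..i - l}. xs ! j)"
    using True assms unfolding array_read_diff array_read_nat by (simp add: window_sums_def)
  moreover have "array_read (window_sums l xs) (real i) = (\<Sum>j\<in>{Suc i - l..i}. xs ! j)"
    using assms unfolding array_read_nat by (simp add: window_sums_def)
  moreover have "window_sums (2 * l) xs ! i = (\<Sum>j\<in>{Suc i - 2 * l..i}. xs ! j)"
    using assms by (simp add: window_sums_def)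
  ultimately show ?thesis by linarith
next
  case False
  then have "Suc i - l = Suc i - 2 * l" by simp
  with False show ?thesis using assms
    unfolding array_read_diff array_read_nat by (simp add: window_sums_def)
qed

lemma executes_scan:
  assumes len: "length (arrays s ''B'') = p" and p: "0 < p"
    and Q: "\<And>v. Q (s\<lparr>scalars := (scalars s)(''d'' := v),
      arrays := (arrays s)(''B'' := prefix_sums (arrays s ''B''))\<rparr>)"
  shows "executes p scan s (20 * lg (real p) + 10) Q"
proof -
  define xs where "xs = arrays s ''B''"
  define I where "I k t \<longleftrightarrow> t = s\<lparr>scalars := (scalars s)(''d'' := real (2 ^ k)),
      arrays := (arrays s)(''B'' := window_sums (2 ^ k) xs)\<rparr>" for k t
  have lx: "length xs = p" "length (window_sums l xs) = p" for l
    using len by (simp_all add: xs_def window_sums_def)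
  have w1: "window_sums (Suc 0) xs = xs"
    by (rule nth_equalityI) (simp_all add: window_sums_def)
  have step: "k < lg (real p) \<and>
      executes p (Seq (ParAssign ''B'' (Len ''B'') (Add (Read ''B'' Self) (Read ''B'' (Sub Self (Scalar ''d'')))))
            (Assign ''d'' (Mul (Scalar ''d'') (Lit 2)))) t
       (1 + 1 + (1 + 4) + (1 + 2)) (I (Suc k))"
    if t: "I k t" and c: "expr_val (Scalar ''d'') t 0 < expr_val (Len ''B'') t 0" for k t
  proof
    show "k < lg (real p)" using t c by (intro less_lg) (simp add: I_def lx)
    have B: "map (expr_val (Add (Read ''B'' Self) (Read ''B'' (Sub Self (Scalar ''d'')))) t) [0..<p]
      = window_sums (2 ^ Suc k) xs"
    proof (rule nth_equalityI)
      fix i assume "i < length (map (expr_val (Add (Read ''B'' Self) (Read ''B'' (Sub Self (Scalar ''d'')))) t) [0..<p])"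
      then show "map (expr_val (Add (Read ''B'' Self) (Read ''B'' (Sub Self (Scalar ''d'')))) t) [0..<p] ! i
         = window_sums (2 ^ Suc k) xs ! i"
        using window_sums_double[of i xs "2 ^ k"] t by (simp add: I_def lx)
    qed (simp add: lx)
    have "executes p (Seq (ParAssign ''B'' (Len ''B'') (Add (Read ''B'' Self) (Read ''B'' (Sub Self (Scalar ''d'')))))
            (Assign ''d'' (Mul (Scalar ''d'') (Lit 2)))) t
       (1 + expr_depth (Len ''B'') + (1 + expr_depth (Add (Read ''B'' Self) (Read ''B'' (Sub Self (Scalar ''d'')))))
        + (1 + expr_depth (Mul (Scalar ''d'') (Lit 2)))) (I (Suc k))"
    proof (intro executes_Seq executes_ParAssign executes_Assign p)
      have n: "nat \<lceil>expr_val (Len ''B'') t 0\<rceil> = p" using t by (simp add: I_def lx)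
      then show "nat \<lceil>expr_val (Len ''B'') t 0\<rceil> \<le> p" by simp
      show "I (Suc k)
        (t\<lparr>arrays := (arrays t)(''B'' := map (expr_val (Add (Read ''B'' Self) (Read ''B'' (Sub Self (Scalar ''d'')))) t)
             [0..<nat \<lceil>expr_val (Len ''B'') t 0\<rceil>])\<rparr>
         \<lparr>scalars := (scalars (t\<lparr>arrays := (arrays t)(''B'' := map (expr_val (Add (Read ''B'' Self) (Read ''B'' (Sub Self (Scalar ''d'')))) t)
             [0..<nat \<lceil>expr_val (Len ''B'') t 0\<rceil>])\<rparr>))(''d'' :=
            expr_val (Mul (Scalar ''d'') (Lit 2)) (t\<lparr>arrays := (arrays t)(''B'' := map (expr_val (Add (Read ''B'' Self) (Read ''B'' (Sub Self (Scalar ''d'')))) t)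
             [0..<nat \<lceil>expr_val (Len ''B'') t 0\<rceil>])\<rparr>) 0)\<rparr>)"
        unfolding n B I_def using t by (intro store.equality) (simp_all add: I_def mult.commute)
    qed simp_all
    then show "executes p (Seq (ParAssign ''B'' (Len ''B'') (Add (Read ''B'' Self) (Read ''B'' (Sub Self (Scalar ''d'')))))
            (Assign ''d'' (Mul (Scalar ''d'') (Lit 2)))) t
       (1 + 1 + (1 + 4) + (1 + 2)) (I (Suc k))" by (rule executes_mono) simp_all
  qed
  have fin: "Q t" if t: "I k t" and c: "\<not> expr_val (Scalar ''d'') t 0 < expr_val (Len ''B'') t 0" for k t
  proof -
    have "p \<le> 2 ^ k" using t c by (simp add: I_def lx flip: of_nat_power)
    then have "window_sums (2 ^ k) xs = prefix_sums xs"
      by (auto simp: window_sums_def prefix_sums_def lx atLeast0AtMost)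
    then show ?thesis using t Q by (simp add: I_def xs_def)
  qed
  have init: "I 0 (s\<lparr>scalars := (scalars s)(''d'' := 1)\<rparr>)"
    unfolding I_def by (rule store.equality) (simp_all add: w1, simp add: xs_def)
  have "executes p scan s (1 + expr_depth (Lit 1) +
     (lg (real p) * (1 + max (expr_depth (Scalar ''d'')) (expr_depth (Len ''B'')) + (1 + 1 + (1 + 4) + (1 + 2)))
       + (1 + max (expr_depth (Scalar ''d'')) (expr_depth (Len ''B''))))) Q"
    unfolding scan_def
    by (intro executes_Seq executes_Assign executes_WhileLess[where I = I] p step fin)
       (simp_all add: init)
  then show ?thesis by (rule executes_mono) simp_all
qed

section \<open>Solving one regularised subproblem and iterating\<close>

lemma executes_depth_mono: "executes p c s d Q \<Longrightarrow> d \<le> d' \<Longrightarrow> executes p c s d' Q"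
  by (rule executes_mono)

definition changes :: "vname set \<Rightarrow> vname set \<Rightarrow> store \<Rightarrow> store \<Rightarrow> bool" where
  "changes As Xs s t \<longleftrightarrow> (\<forall>a. a \<notin> As \<longrightarrow> arrays t a = arrays s a) \<and>
     (\<forall>x. x \<notin> Xs \<longrightarrow> scalars t x = scalars s x)"

definition par :: "vname \<Rightarrow> expr \<Rightarrow> com" where
  "par a e = ParAssign a (Len ''adj'') e"

text \<open>
  The sum of the original entries over the arcs leaving the source of the executing
  processor's arc, once \<open>''B''\<close> holds prefix sums. For the first vertex the second read is at position \<open>-1\<close>.
\<close>

definition segment_total :: expr where
  "segment_total = Sub (Read ''B'' (Sub (Read ''hi'' Self) (Lit 1))) (Read ''B'' (Sub (Read ''lo'' Self) (Lit 1)))"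

definition total :: expr where
  "total = Read ''B'' (Sub (Len ''adj'') (Lit 1))"

text \<open>
  The softmax. Since the weight of a vertex is stored at every arc leaving it, the normalising
  sum runs over the weights divided by the degrees.
\<close>

definition update_y :: com where
  "update_y =
     Seq (par ''B'' (Mul (Read ''X'' Self) (Read ''X'' Self)))
     (Seq scan
     (Seq (par ''Y'' (EExp (Quot (Sub (Read ''L1'' Self) (Mul (Lit 2) segment_total)) (Mul (Lit 72) (Scalar ''D'')))))
     (Seq (par ''B'' (Quot (Read ''Y'' Self) (Sub (Read ''hi'' Self) (Read ''lo'' Self))))
     (Seq scan
          (par ''Y'' (Quot (Read ''Y'' Self) total))))))"

definition update_x :: com where
  "update_x =
     Seq (par ''X'' (Quot (Sub (Read ''Z1'' (Read ''dst'' Self)) (Read ''Z1'' Self))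
            (Mul (Lit 4) (Add (Read ''Y'' Self) (Read ''Y'' (Read ''dst'' Self))))))
         (par ''X'' (IfLess (Read ''X'' Self) (Lit 1)
            (IfLess (Lit (- 1)) (Read ''X'' Self) (Read ''X'' Self) (Lit (- 1))) (Lit 1)))"

text \<open>
  Consecutive iterates differ by at most \<open>2 * th\<close>, because their distance halves in each turn. The loop can
  therefore stop when \<open>th\<close> is half the desired precision.
\<close>

definition solve :: com where
  "solve =
     Seq (par ''X'' (Lit 0))
     (Seq (Assign ''th'' (Lit 1))
     (WhileLess (Quot (Scalar ''eps'') (Mul (Lit 192) (Scalar ''D''))) (Scalar ''th'')
       (Seq update_y (Seq update_x (Assign ''th'' (Quot (Scalar ''th'') (Lit 2)))))))"

text \<open>
  Both halves of an extragradient step: solve for \<open>(Z1, L1)\<close>, then add the gradient at the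
  solution to the starting point \<open>(Z, L)\<close>.
\<close>

definition half_step :: com where
  "half_step =
     Seq solve
     (Seq (par ''B'' (Add (Lit 1) (Read ''X'' Self)))
     (Seq scan
     (Seq (par ''L1'' (Add (Read ''L'' Self) segment_total))
          (par ''Z1'' (Add (Read ''Z'' Self) (Read ''Y'' Self))))))"

text \<open>
  \<open>(Z1, L1) = (Z, L)\<close> at the start of each round. The first half step leaves there the tentative
  point at which the second one takes its gradient.
\<close>

definition iterate :: com where
  "iterate =
     WhileLess (Scalar ''t'') (Scalar ''T'')
       (Seq half_step
       (Seq half_step
       (Seq (par ''Z'' (Read ''Z1'' Self))
       (Seq (par ''L'' (Read ''L1'' Self))
            (Assign ''t'' (Add (Scalar ''t'') (Lit 1)))))))"

definition read_off :: com where
  "read_off =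
     Seq (par ''B'' (IfLess (Read ''Z'' Self) (Read ''Z'' (Read ''dst'' Self))
            (Read ''Z'' Self) (Read ''Z'' (Read ''dst'' Self))))
     (Seq scan
          (Assign ''out'' (Quot total (Mul (Lit 2) (Scalar ''t'')))))"

context adjacency
begin

text \<open>
  A function of vertices is stored at every arc, by its source. Its value at the target of an arc is read at
  the position \<open>off\<close> of the target, which is an arc leaving that vertex.
\<close>

definition vertex_array :: "(nat \<Rightarrow> real) \<Rightarrow> real list" where
  "vertex_array y = map (\<lambda>a. y (src a)) [0..<M]"

definition arc_array :: "(nat \<Rightarrow> nat \<Rightarrow> real) \<Rightarrow> real list" where
  "arc_array x = map (\<lambda>a. x (src a) (tgt a)) [0..<M]"

lemma length_arrays [simp]: "length (vertex_array y) = M" "length (arc_array x) = M"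
  by (simp_all add: vertex_array_def arc_array_def)

lemma read_vertex_array: "a < M \<Longrightarrow> array_read (vertex_array y) (real a) = y (src a)"
  by (simp add: array_read_nat vertex_array_def)

lemma read_arc_array: "a < M \<Longrightarrow> array_read (arc_array x) (real a) = x (src a) (tgt a)"
  by (simp add: array_read_nat arc_array_def)

lemma read_vertex_array_tgt: "a < M \<Longrightarrow> array_read (vertex_array y) (real (off (tgt a))) = y (tgt a)"
  using tgt_in_U[of a] by (simp add: read_vertex_array off_less_M src_off)

lemma read_arcs_total: "array_read (prefix_sums (arc_array x)) (real M - 1) = (\<Sum>i\<in>U. \<Sum>j\<in>nbhd i. x i j)"
  using read_prefix_sums[of M "arc_array x"] arc_sum_eq[of x] by (simp add: arc_array_def)

lemma read_vertices_total:
  "array_read (prefix_sums (vertex_array (\<lambda>i. y i / real (card (nbhd i))))) (real M - 1) = (\<Sum>i\<in>U. y i)"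
  using read_prefix_sums[of M "vertex_array (\<lambda>i. y i / real (card (nbhd i)))"] vertex_sum_eq[of y]
  by (simp add: vertex_array_def)

lemma off_le_M: "i \<le> n \<Longrightarrow> off i \<le> M"
  using off_mono[of i n] by (simp add: off_n)

lemma read_segment:
  assumes "a < M"
  shows "array_read (prefix_sums (arc_array x)) (real (off (Suc (src a))) - 1) -
    array_read (prefix_sums (arc_array x)) (real (off (src a)) - 1) = (\<Sum>j\<in>nbhd (src a). x (src a) j)"
proof -
  let ?i = "src a" and ?f = "\<lambda>k. arc_array x ! k"
  have i: "?i < n" by (rule src_bounds(3)[OF assms])
  have b: "off (Suc ?i) \<le> M" "off ?i \<le> M" "off ?i \<le> off (Suc ?i)"
    using off_le_M i off_mono by simp_all
  have "(\<Sum>k<off (Suc ?i). ?f k) = (\<Sum>k<off ?i. ?f k) + (\<Sum>k\<in>{off ?i..<off (Suc ?i)}. ?f k)"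
    using b(3) by (simp add: lessThan_atLeast0 sum.atLeastLessThan_concat)
  also have "(\<Sum>k\<in>{off ?i..<off (Suc ?i)}. ?f k) = (\<Sum>k\<in>{off ?i..<off (Suc ?i)}. x ?i (tgt k))"
  proof (intro sum.cong refl)
    fix k assume k: "k \<in> {off ?i..<off (Suc ?i)}"
    then have "k < M" using b by simp
    then show "?f k = x ?i (tgt k)" using segment_src[OF k] by (simp add: arc_array_def)
  qed
  also have "\<dots> = (\<Sum>j\<in>nbhd ?i. x ?i j)" by (rule segment_sum[OF i])
  finally show ?thesis using b by (simp add: read_prefix_sums)
qed

lemma executes_par_vertex:
  assumes "length (arrays s ''adj'') = M" "expr_work e \<le> 97"
    "\<And>a. a < M \<Longrightarrow> expr_val e s a = y (src a)"
    "Q (s\<lparr>arrays := (arrays s)(b := vertex_array y)\<rparr>)"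
  shows "executes M (par b e) s (3 + expr_depth e) Q"
proof -
  have "map (expr_val e s) [0..<M] = vertex_array y" using assms(3) by (simp add: vertex_array_def)
  then have "executes M (par b e) s (1 + expr_depth (Len ''adj'') + (1 + expr_depth e)) Q"
    unfolding par_def using M_pos assms by (intro executes_ParAssign) simp_all
  then show ?thesis by (rule executes_depth_mono) simp
qed

lemma executes_par_arc:
  assumes "length (arrays s ''adj'') = M" "expr_work e \<le> 97"
    "\<And>a. a < M \<Longrightarrow> expr_val e s a = x (src a) (tgt a)"
    "Q (s\<lparr>arrays := (arrays s)(b := arc_array x)\<rparr>)"
  shows "executes M (par b e) s (3 + expr_depth e) Q"
proof -
  have "map (expr_val e s) [0..<M] = arc_array x" using assms(3) by (simp add: arc_array_def)
  then have "executes M (par b e) s (1 + expr_depth (Len ''adj'') + (1 + expr_depth e)) Q"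
    unfolding par_def using M_pos assms by (intro executes_ParAssign) simp_all
  then show ?thesis by (rule executes_depth_mono) simp
qed

definition graph_ready :: "real \<Rightarrow> real \<Rightarrow> store \<Rightarrow> bool" where
  "graph_ready \<epsilon> D s \<longleftrightarrow> length (arrays s ''adj'') = M \<and>
     arrays s ''lo'' = vertex_array (\<lambda>i. real (off i)) \<and>
     arrays s ''hi'' = vertex_array (\<lambda>i. real (off (Suc i))) \<and>
     arrays s ''dst'' = arc_array (\<lambda>i j. real (off j)) \<and>
     scalars s ''eps'' = \<epsilon> \<and> scalars s ''D'' = D"

lemmas read_simps = read_vertex_array read_arc_array read_vertex_array_tgt read_segment
  read_arcs_total read_vertices_total

end

locale solver = adjacency nb + game: density_game "adjacency.U nb" "adjacency.nbhd nb" D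
  for nb :: "nat list list" and D :: real +
  fixes \<epsilon> :: real
  assumes eps_pos: "0 < \<epsilon>" and eps_less: "\<epsilon> < 1" and D_ge: "1 \<le> D"
begin

abbreviation "ready \<equiv> graph_ready \<epsilon> D"

lemma executes_update_y:
  assumes r: "ready s" and x: "arrays s ''X'' = arc_array x" and l: "arrays s ''L1'' = vertex_array L"
  shows "executes M update_y s (40 * lg (real M) + 100)
    (\<lambda>t. changes {''B'', ''Y''} {''d''} s t \<and> arrays t ''Y'' = vertex_array (game.best_y L x))"
  unfolding update_y_def
  apply (rule executes_depth_mono)
   apply (rule executes_Seq)
   apply (rule executes_par_arc[where x = "\<lambda>i j. (x i j)\<^sup>2"])
      apply (use r in \<open>simp add: graph_ready_def\<close>)
     apply simp
    apply (use x in \<open>simp add: read_simps power2_eq_square\<close>)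
   apply (rule executes_Seq)
   apply (rule executes_scan)
     apply simp
    apply (rule M_pos)
   apply (rule executes_Seq)
   apply (rule executes_par_vertex[where y = "\<lambda>i. exp ((L i - 2 * game.quad x i) / (72 * D))"])
      apply (use r in \<open>simp add: graph_ready_def\<close>)
     apply (simp add: segment_total_def)
    apply (use r l in \<open>simp add: segment_total_def read_simps graph_ready_def game.quad_def\<close>)
   apply (rule executes_Seq)
   apply (rule executes_par_vertex[where y = "\<lambda>i. exp ((L i - 2 * game.quad x i) / (72 * D)) / real (card (nbhd i))"])
      apply (use r in \<open>simp add: graph_ready_def\<close>)
     apply simp
    apply (use r in \<open>simp add: read_simps graph_ready_def off_Suc src_bounds\<close>)
   apply (rule executes_Seq)
   apply (rule executes_scan)
     apply simp
    apply (rule M_pos)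
   apply (rule executes_par_vertex[where y = "game.best_y L x"])
      apply (use r in \<open>simp add: graph_ready_def\<close>)
     apply (simp add: total_def)
    apply (use r in \<open>simp add: total_def read_simps graph_ready_def game.best_y_def game.softmax_def\<close>)
   apply (simp add: changes_def)
  apply (simp add: total_def segment_total_def)
  done

lemma executes_update_x:
  assumes r: "ready s" and y: "arrays s ''Y'' = vertex_array y" and z: "arrays s ''Z1'' = vertex_array Z"
  shows "executes M update_x s 50
    (\<lambda>t. changes {''X''} {} s t \<and> arrays t ''X'' = arc_array (game.best_x Z y))"
  unfolding update_x_def
  apply (rule executes_depth_mono)
   apply (rule executes_Seq)
   apply (rule executes_par_arc[where x = "\<lambda>i j. (Z j - Z i) / (4 * (y i + y j))"])
      apply (use r in \<open>simp add: graph_ready_def\<close>)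
     apply simp
    apply (use r y z in \<open>simp add: read_simps graph_ready_def\<close>)
   apply (rule executes_par_arc[where x = "game.best_x Z y"])
      apply (use r in \<open>simp add: graph_ready_def\<close>)
     apply simp
    apply (auto simp add: read_simps game.best_x_def clip_def)[1]
   apply (simp add: changes_def)
  apply simp
  done

lemma ready_changes:
  assumes *: "ready s" "changes As Xs s t" "As \<inter> {''adj'', ''lo'', ''hi'', ''dst''} = {}"
    "Xs \<inter> {''eps'', ''D''} = {}"
  shows "ready t"
proof -
  from * have "''adj'' \<notin> As" "''lo'' \<notin> As" "''hi'' \<notin> As" "''dst'' \<notin> As" "''eps'' \<notin> Xs" "''D'' \<notin> Xs"
    by blast+
  then show ?thesis using *(1,2) by (simp add: graph_ready_def changes_def)
qed

definition solve_depth :: nat where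
  "solve_depth = lg (192 * D / \<epsilon>) * (40 * lg (real M) + 200) + 20"

lemma executes_solve:
  assumes r: "ready s" and z: "arrays s ''Z1'' = vertex_array Z" and l: "arrays s ''L1'' = vertex_array L"
  shows "executes M solve s solve_depth
    (\<lambda>t. changes {''B'', ''X'', ''Y''} {''d'', ''th''} s t \<and>
      (\<exists>x y. game.near_min (\<epsilon> / (96 * D)) Z L x y \<and>
        arrays t ''X'' = arc_array x \<and> arrays t ''Y'' = vertex_array y))"
proof -
  (* For k = 0 the zero orientation plays the role of x' in the first near minimiser. *)
  define I where "I k t \<longleftrightarrow> changes {''B'', ''X'', ''Y''} {''d'', ''th''} s t \<and>
      scalars t ''th'' = (1 / 2) ^ k \<and>
      (\<exists>x. arrays t ''X'' = arc_array x \<and>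
        (if k = 0 then x = (\<lambda>_ _. 0)
         else \<exists>y. arrays t ''Y'' = vertex_array y \<and> game.near_min (2 * (1 / 2) ^ k) Z L x y))" for k t
  let ?c = "expr_val (Quot (Scalar ''eps'') (Mul (Lit 192) (Scalar ''D'')))"
  let ?body = "Seq update_y (Seq update_x (Assign ''th'' (Quot (Scalar ''th'') (Lit 2))))"
  have cond: "?c t 0 = \<epsilon> / (192 * D)" if "I k t" for k t
    using r that by (simp add: I_def changes_def graph_ready_def)
  have step: "k < lg (192 * D / \<epsilon>) \<and> executes M ?body t (40 * lg (real M) + 190) (I (Suc k))"
    if I: "I k t" and c: "?c t 0 < expr_val (Scalar ''th'') t 0" for k t
  proof
    have "\<epsilon> / (192 * D) < 1 / 2 ^ k" using c cond[OF I] I by (simp add: I_def power_one_over)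
    then have "2 ^ k < 192 * D / \<epsilon>" using eps_pos D_ge by (simp add: field_simps)
    then show "k < lg (192 * D / \<epsilon>)" by (rule less_lg)
    obtain x where x: "arrays t ''X'' = arc_array x"
      "if k = 0 then x = (\<lambda>_ _. 0)
         else \<exists>y. arrays t ''Y'' = vertex_array y \<and> game.near_min (2 * (1 / 2) ^ k) Z L x y"
      using I by (auto simp: I_def)
    have ct: "changes {''B'', ''X'', ''Y''} {''d'', ''th''} s t" using I by (simp add: I_def)
    have rt: "ready t" by (rule ready_changes[OF r ct]) simp_all
    have zt: "arrays t ''Z1'' = vertex_array Z" "arrays t ''L1'' = vertex_array L"
      using ct z l by (simp_all add: changes_def)
    let ?y = "game.best_y L x"
    have nm: "game.near_min (2 * (1 / 2) ^ Suc k) Z L (game.best_x Z ?y) ?y"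
    proof (cases "k = 0")
      case True
      then show ?thesis using x(2) game.near_min_first[of Z L] by simp
    next
      case False
      then obtain y where "game.near_min (2 * (1 / 2) ^ k) Z L x y" using x(2) by auto
      from game.near_min_next[OF this] show ?thesis by simp
    qed
    have "executes M ?body t ((40 * lg (real M) + 100) + (50 + (1 + expr_depth (Quot (Scalar ''th'') (Lit 2))))) (I (Suc k))"
    proof (rule executes_Seq, rule executes_mono[OF executes_update_y[OF rt x(1) zt(2)] order_refl])
      fix u assume u: "changes {''B'', ''Y''} {''d''} t u \<and> arrays u ''Y'' = vertex_array ?y"
      have ru: "ready u" by (rule ready_changes[OF rt conjunct1[OF u]]) simp_all
      have zu: "arrays u ''Z1'' = vertex_array Z" using u zt by (simp add: changes_def)
      show "executes M (Seq update_x (Assign ''th'' (Quot (Scalar ''th'') (Lit 2)))) u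
         (50 + (1 + expr_depth (Quot (Scalar ''th'') (Lit 2)))) (I (Suc k))"
      proof (rule executes_Seq, rule executes_mono[OF executes_update_x[OF ru conjunct2[OF u] zu] order_refl])
        fix v assume v: "changes {''X''} {} u v \<and> arrays v ''X'' = arc_array (game.best_x Z ?y)"
        have th: "scalars v ''th'' = (1 / 2) ^ k" "arrays v ''Y'' = vertex_array ?y"
          using u v I by (simp_all add: changes_def I_def)
        have cv: "changes {''B'', ''X'', ''Y''} {''d'', ''th''} s v"
          using ct u v by (simp add: changes_def)
        show "executes M (Assign ''th'' (Quot (Scalar ''th'') (Lit 2))) v
          (1 + expr_depth (Quot (Scalar ''th'') (Lit 2))) (I (Suc k))"
        proof (rule executes_Assign[OF M_pos])
          show "I (Suc k) (v\<lparr>scalars := (scalars v)(''th'' := expr_val (Quot (Scalar ''th'') (Lit 2)) v 0)\<rparr>)"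
            unfolding I_def using cv v th nm by (auto simp: changes_def)
        qed simp
      qed
    qed
    then show "executes M ?body t (40 * lg (real M) + 190) (I (Suc k))"
      by (rule executes_depth_mono) simp
  qed
  show ?thesis unfolding solve_def
    apply (rule executes_depth_mono)
     apply (rule executes_Seq)
     apply (rule executes_par_arc[where x = "\<lambda>i j. 0"])
        apply (use r in \<open>simp add: graph_ready_def\<close>)
       apply simp
      apply simp
     apply (rule executes_Seq)
     apply (rule executes_Assign[OF M_pos])
      apply simp
     apply (rule executes_WhileLess[where I = I, OF M_pos])
        apply simp
       apply (simp add: I_def changes_def)
      apply (erule (1) step)
  proof -
    fix k t assume I: "I k t" and c: "\<not> ?c t 0 < expr_val (Scalar ''th'') t 0"
    have le: "(1 / 2) ^ k \<le> \<epsilon> / (192 * D)" using c cond[OF I] I by (simp add: I_def)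
    have "\<epsilon> / (192 * D) < 1" using eps_less D_ge by (simp add: field_simps)
    then have "k \<noteq> 0" using le by (cases k) auto
    then obtain x y where xy: "arrays t ''X'' = arc_array x" "arrays t ''Y'' = vertex_array y"
      "game.near_min (2 * (1 / 2) ^ k) Z L x y" using I by (auto simp: I_def)
    have "2 * (1 / 2) ^ k \<le> \<epsilon> / (96 * D)" using le D_ge by (simp add: field_simps)
    from game.near_min_mono[OF xy(3) this] xy I
    show "changes {''B'', ''X'', ''Y''} {''d'', ''th''} s t \<and>
      (\<exists>x y. game.near_min (\<epsilon> / (96 * D)) Z L x y \<and>
        arrays t ''X'' = arc_array x \<and> arrays t ''Y'' = vertex_array y)"
      by (auto simp: I_def)
  qed (simp add: solve_depth_def algebra_simps)
qed

definition half_depth :: nat where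
  "half_depth = solve_depth + 20 * lg (real M) + 100"

lemma executes_half_step:
  assumes r: "ready s" and z1: "arrays s ''Z1'' = vertex_array Z1" and l1: "arrays s ''L1'' = vertex_array L1"
    and z: "arrays s ''Z'' = vertex_array Z" and l: "arrays s ''L'' = vertex_array L"
  shows "executes M half_step s half_depth
    (\<lambda>t. changes {''B'', ''X'', ''Y'', ''L1'', ''Z1''} {''d'', ''th''} s t \<and>
      (\<exists>x y. game.near_min (\<epsilon> / (96 * D)) Z1 L1 x y \<and>
        arrays t ''L1'' = vertex_array (\<lambda>i. L i + game.load x i) \<and>
        arrays t ''Z1'' = vertex_array (\<lambda>i. Z i + y i)))"
    (is "executes M half_step s half_depth ?Q")
proof -
  let ?rest = "Seq (par ''B'' (Add (Lit 1) (Read ''X'' Self)))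
     (Seq scan
     (Seq (par ''L1'' (Add (Read ''L'' Self) segment_total))
          (par ''Z1'' (Add (Read ''Z'' Self) (Read ''Y'' Self)))))"
  have "executes M half_step s (solve_depth + (20 * lg (real M) + 100)) ?Q"
    unfolding half_step_def
  proof (rule executes_Seq, rule executes_mono[OF executes_solve[OF r z1 l1] order_refl], elim conjE exE)
    fix t x y
    assume t: "changes {''B'', ''X'', ''Y''} {''d'', ''th''} s t" "game.near_min (\<epsilon> / (96 * D)) Z1 L1 x y"
      "arrays t ''X'' = arc_array x" "arrays t ''Y'' = vertex_array y"
    have rt: "ready t" by (rule ready_changes[OF r t(1)]) simp_all
    have zt: "arrays t ''Z'' = vertex_array Z" "arrays t ''L'' = vertex_array L"
      using t(1) z l by (simp_all add: changes_def)
    show "executes M ?rest t (20 * lg (real M) + 100) ?Q"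
      apply (rule executes_depth_mono)
       apply (rule executes_Seq)
       apply (rule executes_par_arc[where x = "\<lambda>i j. 1 + x i j"])
          apply (use rt in \<open>simp add: graph_ready_def\<close>)
         apply simp
        apply (simp add: t(3) read_simps)
       apply (rule executes_Seq)
       apply (rule executes_scan)
         apply simp
        apply (rule M_pos)
       apply (rule executes_Seq)
       apply (rule executes_par_vertex[where y = "\<lambda>i. L i + game.load x i"])
          apply (use rt in \<open>simp add: graph_ready_def\<close>)
         apply (simp add: segment_total_def)
        apply (use rt zt in \<open>simp add: segment_total_def read_simps graph_ready_def game.load_def\<close>)
       apply (rule executes_par_vertex[where y = "\<lambda>i. Z i + y i"])
          apply (use rt in \<open>simp add: graph_ready_def\<close>)
         apply simp
        apply (use zt t(4) in \<open>simp add: read_simps\<close>)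
       apply (use t(1,2) in \<open>auto simp: changes_def\<close>)[1]
      apply (simp add: segment_total_def)
      done
  qed
  then show ?thesis by (simp add: half_depth_def add.assoc)
qed

text \<open>
  Each round is an instance of \<open>regret_inv_step\<close>, with the points that the two half steps compute. The
  loop stops at the first natural number not below \<open>T\<close>.
\<close>

lemma executes_iterate:
  assumes r: "ready s" and T: "scalars s ''T'' = T" "scalars s ''t'' = 0"
    and init: "arrays s ''Z1'' = vertex_array (\<lambda>i. 0)" "arrays s ''L1'' = vertex_array (\<lambda>i. 0)"
      "arrays s ''Z'' = vertex_array (\<lambda>i. 0)" "arrays s ''L'' = vertex_array (\<lambda>i. 0)"
  shows "executes M iterate s (nat \<lceil>T\<rceil> * (2 * half_depth + 40) + 10)
    (\<lambda>t. ready t \<and> (\<exists>k Z L. T \<le> real k \<and> scalars t ''t'' = real k \<and> arrays t ''Z'' = vertex_array Z \<and>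
      game.regret_inv (\<epsilon> / (96 * D)) k Z L \<and> (\<forall>i\<in>U. 0 \<le> Z i) \<and> (\<Sum>i\<in>U. Z i) = real k))"
    (is "executes M iterate s ?d ?Q")
proof -
  let ?\<tau> = "\<epsilon> / (96 * D)"
  define I where "I k t \<longleftrightarrow> ready t \<and> scalars t ''T'' = T \<and> scalars t ''t'' = real k \<and>
    (\<exists>Z L. arrays t ''Z'' = vertex_array Z \<and> arrays t ''L'' = vertex_array L \<and>
       arrays t ''Z1'' = vertex_array Z \<and> arrays t ''L1'' = vertex_array L \<and>
       game.regret_inv ?\<tau> k Z L \<and> (\<forall>i\<in>U. 0 \<le> Z i) \<and> (\<Sum>i\<in>U. Z i) = real k)" for k t
  let ?tail = "Seq (par ''Z'' (Read ''Z1'' Self))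
       (Seq (par ''L'' (Read ''L1'' Self)) (Assign ''t'' (Add (Scalar ''t'') (Lit 1))))"
  let ?body = "Seq half_step (Seq half_step ?tail)"
  have step: "k < nat \<lceil>T\<rceil> \<and> executes M ?body t (half_depth + (half_depth + 30)) (I (Suc k))"
    if I: "I k t" and c: "expr_val (Scalar ''t'') t 0 < expr_val (Scalar ''T'') t 0" for k t
  proof
    show "k < nat \<lceil>T\<rceil>" using I c by (simp add: I_def) linarith
    obtain Z L where ZL: "arrays t ''Z'' = vertex_array Z" "arrays t ''L'' = vertex_array L"
       "arrays t ''Z1'' = vertex_array Z" "arrays t ''L1'' = vertex_array L"
       and inv: "game.regret_inv ?\<tau> k Z L" "\<forall>i\<in>U. 0 \<le> Z i" "(\<Sum>i\<in>U. Z i) = real k"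
      using I by (auto simp: I_def)
    have rt: "ready t" using I by (simp add: I_def)
    show "executes M ?body t (half_depth + (half_depth + 30)) (I (Suc k))"
    proof (rule executes_Seq, rule executes_mono[OF executes_half_step[OF rt ZL(3,4,1,2)] order_refl],
        elim conjE exE)
      fix u xz yz
      assume u: "changes {''B'', ''X'', ''Y'', ''L1'', ''Z1''} {''d'', ''th''} t u"
        and z: "game.near_min ?\<tau> Z L xz yz"
        and u1: "arrays u ''L1'' = vertex_array (\<lambda>i. L i + game.load xz i)"
          "arrays u ''Z1'' = vertex_array (\<lambda>i. Z i + yz i)"
      have ru: "ready u" by (rule ready_changes[OF rt u]) simp_all
      have ZLu: "arrays u ''Z'' = vertex_array Z" "arrays u ''L'' = vertex_array L"
        using u ZL by (simp_all add: changes_def)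
      show "executes M (Seq half_step ?tail) u (half_depth + 30) (I (Suc k))"
      proof (rule executes_Seq, rule executes_mono[OF executes_half_step[OF ru u1(2,1) ZLu] order_refl],
          elim conjE exE)
        fix v xw yw
        assume v: "changes {''B'', ''X'', ''Y'', ''L1'', ''Z1''} {''d'', ''th''} u v"
          and w: "game.near_min ?\<tau> (\<lambda>i. Z i + yz i) (\<lambda>i. L i + game.load xz i) xw yw"
          and v1: "arrays v ''L1'' = vertex_array (\<lambda>i. L i + game.load xw i)"
            "arrays v ''Z1'' = vertex_array (\<lambda>i. Z i + yw i)"
        have rv: "ready v" by (rule ready_changes[OF ru v]) simp_all
        have tv: "scalars v ''t'' = real k" "scalars v ''T'' = T"
          using u v I by (simp_all add: changes_def I_def)
        have "0 \<le> ?\<tau>" using eps_pos D_ge by simp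
        then have inv': "game.regret_inv ?\<tau> (Suc k) (\<lambda>i. Z i + yw i) (\<lambda>i. L i + game.load xw i)"
          by (rule game.regret_inv_step[OF inv(1) z w])
        have yw: "\<forall>i\<in>U. 0 \<le> yw i" "(\<Sum>i\<in>U. yw i) = 1"
          using game.near_min_feasible(2)[OF w] by (simp_all add: game.distribution_def)
        have nn: "\<forall>i\<in>U. 0 \<le> Z i + yw i" "(\<Sum>i\<in>U. Z i + yw i) = real (Suc k)"
          using yw inv by (simp_all add: sum.distrib)
        show "executes M ?tail v 30 (I (Suc k))"
          apply (rule executes_depth_mono)
           apply (rule executes_Seq)
           apply (rule executes_par_vertex[where y = "\<lambda>i. Z i + yw i"])
              apply (use rv in \<open>simp add: graph_ready_def\<close>)
             apply simp
            apply (simp add: v1 read_simps)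
           apply (rule executes_Seq)
           apply (rule executes_par_vertex[where y = "\<lambda>i. L i + game.load xw i"])
              apply (use rv in \<open>simp add: graph_ready_def\<close>)
             apply simp
            apply (simp add: v1 read_simps)
           apply (rule executes_Assign[OF M_pos])
            apply simp
           apply (unfold I_def)
           apply (intro conjI)
              apply (use rv in \<open>simp add: graph_ready_def\<close>)
             apply (use tv in simp)
            apply (use tv in simp)
           apply (rule exI[of _ "\<lambda>i. Z i + yw i"], rule exI[of _ "\<lambda>i. L i + game.load xw i"])
           apply (use v1 nn inv' in simp)
          apply simp
          done
      qed
    qed
  qed
  show ?thesis unfolding iterate_def
    apply (rule executes_depth_mono)
     apply (rule executes_WhileLess[where I = I, OF M_pos])
        apply simp
       apply (use r T init game.regret_inv_init[of ?\<tau>] in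
          \<open>auto simp: I_def intro!: exI[of _ "\<lambda>i. 0 :: real"]\<close>)[1]
      apply (erule (1) step)
     apply (auto simp: I_def)[1]
    apply (simp add: algebra_simps)
    done
qed

lemma executes_read_off:
  assumes r: "ready s" and z: "arrays s ''Z'' = vertex_array Z" and t: "scalars s ''t'' = real k"
  shows "executes M read_off s (20 * lg (real M) + 50)
    (\<lambda>t. output_value t = (\<Sum>i\<in>U. \<Sum>j\<in>nbhd i. min (Z i) (Z j)) / (2 * real k))"
  unfolding read_off_def
  apply (rule executes_depth_mono)
   apply (rule executes_Seq)
   apply (rule executes_par_arc[where x = "\<lambda>i j. min (Z i) (Z j)"])
      apply (use r in \<open>simp add: graph_ready_def\<close>)
     apply simp
    apply (use r z in \<open>simp add: read_simps graph_ready_def min_def\<close>)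
   apply (rule executes_Seq)
   apply (rule executes_scan)
     apply simp
    apply (rule M_pos)
   apply (rule executes_Assign[OF M_pos])
    apply (simp add: total_def)
   apply (use r t in \<open>simp add: total_def read_simps graph_ready_def output_value_def\<close>)
  apply (simp add: total_def)
  done

end

section \<open>Finding the arcs and the parameters\<close>

text \<open>
  The source of each arc, by binary search in the array of offsets. Without a rounding operation
  midpoints are not available, so the search adds decreasing powers of 2 to a lower bound; it ends after the step of
  length 1, when \<open>''st''\<close> has become \<open>1/2\<close>.
\<close>

definition locate :: com where
  "locate =
     Seq (Assign ''st'' (Lit 1))
     (Seq (WhileLess (Scalar ''st'') (Len ''off'') (Assign ''st'' (Mul (Scalar ''st'') (Lit 2))))
     (Seq (par ''src'' (Lit 0))
     (WhileLess (Quot (Lit 1) (Lit 2)) (Scalar ''st'')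
       (Seq (par ''src''
              (IfLess (Add (Read ''src'' Self) (Scalar ''st'')) (Len ''off'')
                (IfLess Self (Read ''off'' (Add (Read ''src'' Self) (Scalar ''st'')))
                  (Read ''src'' Self) (Add (Read ''src'' Self) (Scalar ''st'')))
                (Read ''src'' Self)))
            (Assign ''st'' (Quot (Scalar ''st'') (Lit 2)))))))"

definition index_arcs :: com where
  "index_arcs =
     Seq (par ''lo'' (Read ''off'' (Read ''src'' Self)))
     (Seq (par ''hi'' (Read ''off'' (Add (Read ''src'' Self) (Lit 1))))
          (par ''dst'' (Read ''off'' (Read ''adj'' Self))))"

definition set_parameters :: com where
  "set_parameters =
     Seq (par ''B'' (EExp (Sub (Read ''hi'' Self) (Read ''lo'' Self))))
     (Seq scan
     (Seq (Assign ''D'' (ELog total))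
          (Assign ''T'' (Quot (Mul (Mul (Lit 8) (Scalar ''D''))
            (Add (Lit 1) (Mul (Lit 36) (ELog (Len ''adj''))))) (Scalar ''eps'')))))"

definition reset :: com where
  "reset =
     Seq (Assign ''t'' (Lit 0))
     (Seq (par ''Z'' (Lit 0))
     (Seq (par ''L'' (Lit 0))
     (Seq (par ''Z1'' (Lit 0))
          (par ''L1'' (Lit 0)))))"

definition density_program :: com where
  "density_program = Seq locate (Seq index_arcs (Seq set_parameters (Seq reset (Seq iterate read_off))))"

context adjacency
begin

definition input_ready :: "real \<Rightarrow> store \<Rightarrow> bool" where
  "input_ready \<epsilon> s \<longleftrightarrow> arrays s ''off'' = map (\<lambda>i. real (off i)) [0..<Suc n] \<and>
     arrays s ''adj'' = map (\<lambda>a. real (tgt a)) [0..<M] \<and> scalars s ''eps'' = \<epsilon>"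

lemma input_ready_input_store: "input_ready \<epsilon> (input_store \<epsilon> nb)"
proof -
  have "map real (concat nb) = map (\<lambda>a. real (tgt a)) [0..<M]"
    by (rule nth_equalityI) (simp_all add: M_def tgt_def)
  moreover have "map (\<lambda>i. real (length (concat (take i nb)))) [0..<Suc (length nb)] =
      map (\<lambda>i. real (off i)) [0..<Suc n]"
    by (simp only: off_def n_def)
  ultimately show ?thesis unfolding input_ready_def input_store_def by simp
qed

lemma read_off_array: "i \<le> n \<Longrightarrow> array_read (map (\<lambda>i. real (off i)) [0..<Suc n]) (real i) = real (off i)"
  by (simp add: array_read_nat nth_append less_Suc_eq_le)

definition locate_depth :: nat where
  "locate_depth = 40 * lg (real n + 1) + 60"

lemma executes_locate:
  assumes s: "input_ready \<epsilon> s"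
  shows "executes M locate s locate_depth
    (\<lambda>t. input_ready \<epsilon> t \<and> arrays t ''src'' = vertex_array (\<lambda>i. real i))"
    (is "executes M locate s locate_depth ?Q")
proof -
  have len: "length (arrays s ''off'') = Suc n" "length (arrays s ''adj'') = M"
    if "input_ready \<epsilon> s" for s using that by (simp_all add: input_ready_def)
  define I where "I k t \<longleftrightarrow> input_ready \<epsilon> t \<and> scalars t ''st'' = 2 ^ k \<and> k \<le> lg (real n + 1)" for k t
  (* While r steps remain, the source lies at least at p a and, if the vertex exists, before p a + 2 ^ r. *)
  define J where "J e k t \<longleftrightarrow> input_ready \<epsilon> t \<and> (\<exists>r p. r + k = Suc e \<and> scalars t ''st'' = 2 ^ r / 2 \<and>
      arrays t ''src'' = map (\<lambda>a. real (p a)) [0..<M] \<and>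
      (\<forall>a<M. off (p a) \<le> a \<and> p a \<le> n \<and> (p a + 2 ^ r \<le> n \<longrightarrow> a < off (p a + 2 ^ r))))" for e k t
  let ?search = "IfLess (Add (Read ''src'' Self) (Scalar ''st'')) (Len ''off'')
                (IfLess Self (Read ''off'' (Add (Read ''src'' Self) (Scalar ''st'')))
                  (Read ''src'' Self) (Add (Read ''src'' Self) (Scalar ''st'')))
                (Read ''src'' Self)"
  let ?half = "Assign ''st'' (Quot (Scalar ''st'') (Lit 2))"
  let ?loop = "WhileLess (Quot (Lit 1) (Lit 2)) (Scalar ''st'') (Seq (par ''src'' ?search) ?half)"
  have double: "k < lg (real n + 1) \<and> executes M (Assign ''st'' (Mul (Scalar ''st'') (Lit 2))) t
      (1 + expr_depth (Mul (Scalar ''st'') (Lit 2))) (I (Suc k))"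
    if I: "I k t" and c: "expr_val (Scalar ''st'') t 0 < expr_val (Len ''off'') t 0" for k t
  proof
    show k: "k < lg (real n + 1)" using I c len by (intro less_lg) (simp add: I_def add.commute)
    show "executes M (Assign ''st'' (Mul (Scalar ''st'') (Lit 2))) t
      (1 + expr_depth (Mul (Scalar ''st'') (Lit 2))) (I (Suc k))"
      by (rule executes_Assign[OF M_pos]) (use I k in \<open>simp_all add: I_def input_ready_def\<close>)
  qed
  have search: "k < Suc e \<and> executes M (Seq (par ''src'' ?search) ?half) t 30 (J e (Suc k))"
    if J: "J e k t" and c: "expr_val (Quot (Lit 1) (Lit 2)) t 0 < expr_val (Scalar ''st'') t 0" for e k t
  proof -
    obtain r p where r: "r + k = Suc e" "scalars t ''st'' = 2 ^ r / 2"
      and p: "arrays t ''src'' = map (\<lambda>a. real (p a)) [0..<M]"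
        "\<And>a. a < M \<Longrightarrow> off (p a) \<le> a \<and> p a \<le> n \<and> (p a + 2 ^ r \<le> n \<longrightarrow> a < off (p a + 2 ^ r))"
      and t: "input_ready \<epsilon> t"
      using J unfolding J_def by blast
    have "r \<noteq> 0" using c r(2) by (cases r) auto
    then obtain q where q: "r = Suc q" by (cases r) auto
    have st: "scalars t ''st'' = real (2 ^ q)" using r(2) q by simp
    define p' where "p' a = (if p a + 2 ^ q \<le> n \<and> off (p a + 2 ^ q) \<le> a then p a + 2 ^ q else p a)" for a
    have val: "expr_val ?search t a = real (p' a)" if a: "a < M" for a
    proof -
      have "array_read (arrays t ''src'') (real a) = real (p a)" using a p(1) by (simp add: array_read_nat)
      moreover have "array_read (arrays t ''off'') (real (p a + 2 ^ q)) = real (off (p a + 2 ^ q))"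
        if "p a + 2 ^ q \<le> n" using that t read_off_array by (simp only: input_ready_def)
      moreover have "real (p a) + real (2 ^ q) = real (p a + 2 ^ q)" by simp
      ultimately show ?thesis
        by (simp only: expr_val.simps st len[OF t] of_nat_less_iff less_Suc_eq_le)
           (auto simp: p'_def less_Suc_eq_le simp flip: of_nat_add of_nat_power)
    qed
    have p': "off (p' a) \<le> a \<and> p' a \<le> n \<and> (p' a + 2 ^ q \<le> n \<longrightarrow> a < off (p' a + 2 ^ q))" if "a < M" for a
      using p(2)[OF that] by (auto simp: p'_def q mult_2 add.assoc)
    have "executes M (par ''src'' ?search) t (1 + expr_depth (Len ''adj'') + (1 + expr_depth ?search))
      (\<lambda>u. u = t\<lparr>arrays := (arrays t)(''src'' := map (\<lambda>a. real (p' a)) [0..<M])\<rparr>)"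
      unfolding par_def
    proof (rule executes_ParAssign[OF M_pos])
      have "nat \<lceil>expr_val (Len ''adj'') t 0\<rceil> = M" using len[OF t] by simp
      moreover have "map (expr_val ?search t) [0..<M] = map (\<lambda>a. real (p' a)) [0..<M]"
        using val by simp
      ultimately show "t\<lparr>arrays := (arrays t)(''src'' := map (expr_val ?search t)
         [0..<nat \<lceil>expr_val (Len ''adj'') t 0\<rceil>])\<rparr> = t\<lparr>arrays := (arrays t)(''src'' := map (\<lambda>a. real (p' a)) [0..<M])\<rparr>"
        by (simp only:)
    qed (use len[OF t] in simp_all)
    then have "executes M (Seq (par ''src'' ?search) ?half) t
      (1 + expr_depth (Len ''adj'') + (1 + expr_depth ?search) + (1 + expr_depth (Quot (Scalar ''st'') (Lit 2))))
      (J e (Suc k))"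
    proof (intro executes_Seq, elim executes_mono[OF _ order_refl])
      fix u assume u: "u = t\<lparr>arrays := (arrays t)(''src'' := map (\<lambda>a. real (p' a)) [0..<M])\<rparr>"
      show "executes M ?half u (1 + expr_depth (Quot (Scalar ''st'') (Lit 2))) (J e (Suc k))"
      proof (rule executes_Assign[OF M_pos])
        show "J e (Suc k) (u\<lparr>scalars := (scalars u)(''st'' := expr_val (Quot (Scalar ''st'') (Lit 2)) u 0)\<rparr>)"
          unfolding J_def
        proof (intro conjI exI[of _ q] exI[of _ p'])
          show "q + Suc k = Suc e" using r(1) q by simp
        qed (use t u st p' in \<open>simp_all add: input_ready_def\<close>)
      qed simp
    qed
    then show ?thesis using r q by (auto elim: executes_depth_mono)
  qed
  have found: "?Q t" if J: "J e k t" and c: "\<not> expr_val (Quot (Lit 1) (Lit 2)) t 0 < expr_val (Scalar ''st'') t 0"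
    for e k t
  proof -
    obtain r p where r: "scalars t ''st'' = 2 ^ r / 2"
      and p: "arrays t ''src'' = map (\<lambda>a. real (p a)) [0..<M]"
        "\<And>a. a < M \<Longrightarrow> off (p a) \<le> a \<and> p a \<le> n \<and> (p a + 2 ^ r \<le> n \<longrightarrow> a < off (p a + 2 ^ r))"
      and t: "input_ready \<epsilon> t"
      using J unfolding J_def by blast
    have "r = 0"
    proof (rule ccontr)
      assume "r \<noteq> 0"
      then have "(1::real) < 2 ^ r" by simp
      then show False using c r by simp
    qed
    have "src a = p a" if a: "a < M" for a
    proof (rule src_eq)
      have "p a \<noteq> n" using p(2)[OF a] a off_n by auto
      then show "off (p a) \<le> a" "a < off (Suc (p a))" using p(2)[OF a] \<open>r = 0\<close> by auto
    qed
    then show ?thesis using p(1) t by (simp add: vertex_array_def)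
  qed
  have main: "executes M (Seq (par ''src'' (Lit 0)) ?loop) t (35 * lg (real n + 1) + 50) ?Q"
    if I: "I e t" and c: "\<not> expr_val (Scalar ''st'') t 0 < expr_val (Len ''off'') t 0" for e t
  proof -
    have t: "input_ready \<epsilon> t" using I by (simp add: I_def)
    have e: "e \<le> lg (real n + 1)" "n < 2 ^ e"
    proof -
      show "e \<le> lg (real n + 1)" using I by (simp add: I_def)
      have "real (Suc n) \<le> real (2 ^ e)" using I c len[OF t] by (simp add: I_def)
      then show "n < 2 ^ e" by (simp only: of_nat_le_iff Suc_le_eq)
    qed
    have "executes M (Seq (par ''src'' (Lit 0)) ?loop) t
      ((3 + expr_depth (Lit 0)) + (Suc e * (1 + max (expr_depth (Quot (Lit 1) (Lit 2))) (expr_depth (Scalar ''st'')) + 30)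
         + (1 + max (expr_depth (Quot (Lit 1) (Lit 2))) (expr_depth (Scalar ''st''))))) ?Q"
    proof (rule executes_Seq, rule executes_par_vertex[where y = "\<lambda>i. 0"])
      show "executes M ?loop (t\<lparr>arrays := (arrays t)(''src'' := vertex_array (\<lambda>i. 0))\<rparr>)
        (Suc e * (1 + max (expr_depth (Quot (Lit 1) (Lit 2))) (expr_depth (Scalar ''st'')) + 30)
         + (1 + max (expr_depth (Quot (Lit 1) (Lit 2))) (expr_depth (Scalar ''st'')))) ?Q"
      proof (rule executes_WhileLess[where I = "J e", OF M_pos])
        show "J e 0 (t\<lparr>arrays := (arrays t)(''src'' := vertex_array (\<lambda>i. 0))\<rparr>)"
          unfolding J_def
        proof (intro conjI exI[of _ "Suc e"] exI[of _ "\<lambda>a. 0"])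
          show "\<forall>a<M. off 0 \<le> a \<and> 0 \<le> n \<and> (0 + 2 ^ Suc e \<le> n \<longrightarrow> a < off (0 + 2 ^ Suc e))"
            using e(2) by (auto simp: off_0)
        qed (use t I in \<open>simp_all add: input_ready_def I_def vertex_array_def\<close>)
      qed (simp, erule (1) search, erule (1) found)
    qed (use len[OF t] in simp_all)
    then show ?thesis by (rule executes_depth_mono) (use e(1) in simp)
  qed
  show ?thesis unfolding locate_def
    apply (rule executes_depth_mono)
     apply (rule executes_Seq)
     apply (rule executes_Assign[OF M_pos])
      apply simp
     apply (rule executes_Seq)
     apply (rule executes_WhileLess[where I = I, OF M_pos])
        apply simp
       apply (use s in \<open>simp add: I_def input_ready_def\<close>)
      apply (erule (1) double)
     apply (erule (1) main)
    apply (simp add: locate_depth_def)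
    done
qed

text \<open>
  A bound on the degrees that is computed with a single sum and exceeds the maximum degree by at
  most \<open>ln M\<close>.
\<close>

definition width :: real where
  "width = ln (\<Sum>i\<in>U. \<Sum>j\<in>nbhd i. exp (real (card (nbhd i))))"

lemma degree_le_width:
  assumes "i \<in> U"
  shows "real (card (nbhd i)) \<le> width"
proof -
  have fin: "finite (nbhd k)" for k by (simp add: nbhd_def)
  have "0 < card (nbhd i)" using assms fin by (simp add: U_def card_gt_0_iff)
  then have "exp (real (card (nbhd i))) \<le> (\<Sum>j\<in>nbhd i. exp (real (card (nbhd i))))" by simp
  also have "\<dots> \<le> (\<Sum>i\<in>U. \<Sum>j\<in>nbhd i. exp (real (card (nbhd i))))"
    using assms finite_U by (intro member_le_sum) (auto intro: sum_nonneg)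
  finally have "ln (exp (real (card (nbhd i)))) \<le> width"
    unfolding width_def by (subst ln_le_cancel_iff) (auto intro: less_le_trans[OF exp_gt_zero])
  then show ?thesis by simp
qed

lemma U_nonempty: "U \<noteq> {}"
  using src_in_U M_pos by blast

lemma width_ge_1: "1 \<le> width"
proof -
  obtain i where i: "i \<in> U" using U_nonempty by blast
  then have "0 < card (nbhd i)" by (simp add: U_def nbhd_def card_gt_0_iff)
  then show ?thesis using degree_le_width[OF i] by linarith
qed

lemma width_le:
  assumes "\<And>i. i \<in> U \<Longrightarrow> card (nbhd i) \<le> \<Delta>"
  shows "width \<le> real \<Delta> + ln (real M)"
proof -
  let ?S = "\<Sum>i\<in>U. \<Sum>j\<in>nbhd i. exp (real (card (nbhd i)))"
  have "?S \<le> (\<Sum>i\<in>U. \<Sum>j\<in>nbhd i. exp (real \<Delta>))"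
    using assms by (intro sum_mono) simp
  also have "\<dots> = (\<Sum>a<M. exp (real \<Delta>))"
    by (rule arc_sum_eq[of "\<lambda>i j. exp (real \<Delta>)", symmetric])
  also have "\<dots> = real M * exp (real \<Delta>)" by simp
  finally have le: "?S \<le> real M * exp (real \<Delta>)" .
  have "?S \<noteq> 0" using width_ge_1 unfolding width_def by (auto simp: ln_0)
  moreover have "0 \<le> ?S" by (intro sum_nonneg) simp
  ultimately have "0 < ?S" by linarith
  then have "width \<le> ln (real M * exp (real \<Delta>))" unfolding width_def using le M_pos by simp
  also have "\<dots> = ln (real M) + real \<Delta>" using M_pos by (simp add: ln_mult)
  finally show ?thesis by simp
qed

text \<open>
  Chosen such that the range of the regulariser, at most \<open>2 * width * (1 + 36 * ln M)\<close>, is a quarter of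
  \<open>rounds \<epsilon> * \<epsilon>\<close>.
\<close>

definition rounds :: "real \<Rightarrow> real" where
  "rounds \<epsilon> = 8 * width * (1 + 36 * ln (real M)) / \<epsilon>"

definition arcs_indexed :: "real \<Rightarrow> store \<Rightarrow> bool" where
  "arcs_indexed \<epsilon> s \<longleftrightarrow> length (arrays s ''adj'') = M \<and> scalars s ''eps'' = \<epsilon> \<and>
     arrays s ''lo'' = vertex_array (\<lambda>i. real (off i)) \<and>
     arrays s ''hi'' = vertex_array (\<lambda>i. real (off (Suc i))) \<and>
     arrays s ''dst'' = arc_array (\<lambda>i j. real (off j))"

lemma executes_index_arcs:
  assumes s: "input_ready \<epsilon> s" and src: "arrays s ''src'' = vertex_array (\<lambda>i. real i)"
  shows "executes M index_arcs s 30 (arcs_indexed \<epsilon>)"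
proof -
  have off: "array_read (arrays s ''off'') (real (src a)) = real (off (src a))"
    "array_read (arrays s ''off'') (real (src a) + 1) = real (off (Suc (src a)))"
    "array_read (arrays s ''off'') (real (tgt a)) = real (off (tgt a))"
    "array_read (arrays s ''adj'') (real a) = real (tgt a)"
    if "a < M" for a
  proof -
    have offs: "arrays s ''off'' = map (\<lambda>i. real (off i)) [0..<Suc n]"
      using s by (simp only: input_ready_def)
    have "tgt a < n" using tgt_in_U[OF that] by (simp add: U_def)
    then show "array_read (arrays s ''off'') (real (tgt a)) = real (off (tgt a))"
      unfolding offs by (intro read_off_array) simp
    have src: "src a < n" by (rule src_bounds(3)[OF that])
    then show "array_read (arrays s ''off'') (real (src a)) = real (off (src a))"
      unfolding offs by (intro read_off_array) simp
    show "array_read (arrays s ''off'') (real (src a) + 1) = real (off (Suc (src a)))"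
      unfolding offs using read_off_array[of "Suc (src a)"] src
      by (simp only: of_nat_Suc add.commute[of 1] Suc_le_eq)
    show "array_read (arrays s ''adj'') (real a) = real (tgt a)"
      using s that by (simp add: array_read_nat input_ready_def)
  qed
  have len: "length (arrays s ''adj'') = M" and eps: "scalars s ''eps'' = \<epsilon>"
    using s by (simp_all add: input_ready_def)
  show ?thesis
    unfolding index_arcs_def
    apply (rule executes_depth_mono)
     apply (rule executes_Seq)
     apply (rule executes_par_vertex[where y = "\<lambda>i. real (off i)"])
        apply (simp add: len)
       apply simp
      apply (simp add: src read_simps off)
     apply (rule executes_Seq)
     apply (rule executes_par_vertex[where y = "\<lambda>i. real (off (Suc i))"])
        apply (simp add: len)
       apply simp
      apply (simp add: src read_simps off)
     apply (rule executes_par_arc[where x = "\<lambda>i j. real (off j)"])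
        apply (simp add: len)
       apply simp
      apply (simp add: off)
     apply (simp add: arcs_indexed_def len eps)
    apply simp
    done
qed

lemma executes_set_parameters:
  assumes s: "arcs_indexed \<epsilon> s"
  shows "executes M set_parameters s (20 * lg (real M) + 50)
    (\<lambda>t. graph_ready \<epsilon> width t \<and> scalars t ''T'' = rounds \<epsilon>)"
  unfolding set_parameters_def
  apply (rule executes_depth_mono)
   apply (rule executes_Seq)
   apply (rule executes_par_arc[where x = "\<lambda>i j. exp (real (card (nbhd i)))"])
      apply (use s in \<open>simp add: arcs_indexed_def\<close>)
     apply simp
    apply (use s in \<open>simp add: arcs_indexed_def read_simps off_Suc src_bounds\<close>)
   apply (rule executes_Seq)
   apply (rule executes_scan)
     apply simp
    apply (rule M_pos)
   apply (rule executes_Seq)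
   apply (rule executes_Assign[OF M_pos])
    apply (simp add: total_def)
   apply (rule executes_Assign[OF M_pos])
    apply simp
   apply (use s in \<open>simp add: arcs_indexed_def graph_ready_def total_def read_simps rounds_def width_def\<close>)
  apply (simp add: total_def)
  done

lemma executes_reset:
  assumes s: "graph_ready \<epsilon> D s" "scalars s ''T'' = T"
  shows "executes M reset s 40
    (\<lambda>t. graph_ready \<epsilon> D t \<and> scalars t ''T'' = T \<and> scalars t ''t'' = 0 \<and>
      arrays t ''Z1'' = vertex_array (\<lambda>i. 0) \<and> arrays t ''L1'' = vertex_array (\<lambda>i. 0) \<and>
      arrays t ''Z'' = vertex_array (\<lambda>i. 0) \<and> arrays t ''L'' = vertex_array (\<lambda>i. 0))"
proof -
  have zero: "executes M (par b (Lit 0)) t 4 Q"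
    if "length (arrays t ''adj'') = M" "Q (t\<lparr>arrays := (arrays t)(b := vertex_array (\<lambda>i. 0))\<rparr>)" for b t Q
    using executes_par_vertex[of t "Lit 0" "\<lambda>i. 0" Q b] that by simp
  have len: "length (arrays s ''adj'') = M" using s by (simp add: graph_ready_def)
  show ?thesis
    unfolding reset_def
    by (rule executes_depth_mono, (rule executes_Seq executes_Assign[OF M_pos] zero | simp add: len)+)
       (use s in \<open>simp_all add: graph_ready_def\<close>)
qed

end

section \<open>Correctness and depth\<close>

context solver
begin

text \<open>
  The error \<open>\<epsilon> / 2\<close> has two equal parts: the range of the regulariser, spread over \<open>k\<close> rounds, and
  the error of the approximate minimisers, which is \<open>8 * D * \<tau> = \<epsilon> / 12\<close> per half step.
\<close>

lemma density_le_average: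
  assumes inv: "game.regret_inv (\<epsilon> / (96 * D)) k Z L" and k: "8 * D * (1 + 36 * ln (real M)) / \<epsilon> \<le> real k"
    and I: "I \<subseteq> U" "I \<noteq> {}"
  shows "game.inner_arcs I / real (card I) \<le> game.arc_sum (\<lambda>i j. min (Z i) (Z j)) / real k + \<epsilon> / 2"
proof -
  have lnM: "0 \<le> ln (real M)" using M_pos by simp
  have "0 < 8 * D * (1 + 36 * ln (real M)) / \<epsilon>" using D_ge eps_pos lnM by (intro divide_pos_pos mult_pos_pos) auto
  then have kpos: "0 < real k" using k by linarith
  have "ln (real (card U)) \<le> ln (real M)"
    using card_U_le_M game.card_U_pos by simp
  then have "72 * D * ln (real (card U)) \<le> 72 * D * ln (real M)"
    using D_ge by (intro mult_left_mono) auto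
  then have "2 * D + 72 * D * ln (real (card U)) \<le> (8 * D * (1 + 36 * ln (real M)) / \<epsilon>) * \<epsilon> / 4"
  proof -
    have "(8 * D * (1 + 36 * ln (real M)) / \<epsilon>) * \<epsilon> / 4 = 2 * D * (1 + 36 * ln (real M))"
      using eps_pos by simp
    also have "\<dots> = 2 * D + 72 * D * ln (real M)" by (simp add: algebra_simps)
    finally show ?thesis using \<open>72 * D * ln (real (card U)) \<le> 72 * D * ln (real M)\<close> by linarith
  qed
  also have "\<dots> \<le> real k * \<epsilon> / 4" using k eps_pos by (intro divide_right_mono mult_right_mono) auto
  finally have 1: "2 * D + 72 * D * ln (real (card U)) \<le> real k * \<epsilon> / 4" .
  have "(2 * real k + 1) * (8 * D * (\<epsilon> / (96 * D))) = (2 * real k + 1) * (\<epsilon> / 12)"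
    using D_ge by simp
  also have "\<dots> \<le> (3 * real k) * (\<epsilon> / 12)"
    using kpos eps_pos by (intro mult_right_mono) auto
  also have "\<dots> = real k * \<epsilon> / 4" by simp
  finally have 2: "(2 * real k + 1) * (8 * D * (\<epsilon> / (96 * D))) \<le> real k * \<epsilon> / 4" .
  have "0 < \<epsilon> / (96 * D)" using eps_pos D_ge by simp
  from game.regret_inv_density[OF inv this I] 1 2
  have "real k * (game.inner_arcs I / real (card I)) \<le> game.arc_sum (\<lambda>i j. min (Z i) (Z j)) + real k * \<epsilon> / 2"
    by linarith
  then have "game.inner_arcs I / real (card I) \<le> (game.arc_sum (\<lambda>i j. min (Z i) (Z j)) + real k * \<epsilon> / 2) / real k"
    using kpos by (simp add: pos_le_divide_eq mult.commute)
  then show ?thesis using kpos by (simp add: add_divide_distrib)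
qed

end

context adjacency
begin

lemma solver: "0 < \<epsilon> \<Longrightarrow> \<epsilon> < 1 \<Longrightarrow> solver nb width \<epsilon>"
proof -
  assume e: "0 < \<epsilon>" "\<epsilon> < 1"
  interpret density_game U nbhd width
    by (rule density_game) (use width_ge_1 degree_le_width in auto)
  show "solver nb width \<epsilon>" by unfold_locales (use e width_ge_1 in auto)
qed

definition program_depth :: "real \<Rightarrow> nat" where
  "program_depth \<epsilon> = locate_depth + (30 + ((20 * lg (real M) + 50) + (40 +
     ((nat \<lceil>rounds \<epsilon>\<rceil> * (2 * solver.half_depth nb width \<epsilon> + 40) + 10) + (20 * lg (real M) + 50)))))"

lemma executes_density_program:
  assumes e: "0 < \<epsilon>" "\<epsilon> < 1"
  shows "executes M density_program (input_store \<epsilon> nb) (program_depth \<epsilon>)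
    (\<lambda>t. \<exists>k Z L. rounds \<epsilon> \<le> real k \<and> density_game.regret_inv U nbhd width (\<epsilon> / (96 * width)) k Z L \<and>
      (\<forall>i\<in>U. 0 \<le> Z i) \<and> (\<Sum>i\<in>U. Z i) = real k \<and>
      output_value t = (\<Sum>i\<in>U. \<Sum>j\<in>nbhd i. min (Z i) (Z j)) / (2 * real k))"
proof -
  interpret solver nb width \<epsilon> by (rule solver[OF e])
  show ?thesis
    unfolding density_program_def program_depth_def
    apply (rule executes_Seq)
    apply (rule executes_mono[OF executes_locate[OF input_ready_input_store] order_refl])
    apply (rule executes_Seq)
    apply (erule conjE)
    apply (rule executes_mono[OF executes_index_arcs order_refl], assumption, assumption)
    apply (rule executes_Seq)
    apply (rule executes_mono[OF executes_set_parameters order_refl], assumption)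
    apply (erule conjE)
    apply (rule executes_Seq)
    apply (rule executes_mono[OF executes_reset order_refl], assumption, assumption)
    apply (elim conjE)
    apply (rule executes_Seq)
    apply (rule executes_mono[OF executes_iterate order_refl], assumption+)
    apply (elim conjE exE)
    apply (rule executes_mono[OF executes_read_off order_refl], assumption+)
    apply blast
    done
qed

end

lemma lg_le: "1 \<le> r \<Longrightarrow> real (lg r) \<le> 2 * ln r + 1"
proof -
  assume r: "1 \<le> r"
  have "log 2 r \<le> 2 * ln r"
  proof -
    have "(1::real) \<le> 2 * ln 2" using ln_le_minus_one[of "1 / 2"] by (simp add: ln_div)
    then have "1 * ln r \<le> (2 * ln 2) * ln r" using r by (intro mult_right_mono) auto
    then show ?thesis by (simp add: log_def field_simps)
  qed
  moreover have "0 \<le> log 2 r" using r by simp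
  ultimately show ?thesis unfolding lg_def by linarith
qed

context adjacency_graph
begin

lemma max_degree_bounds: "1 \<le> max_degree V E" "max_degree V E \<le> card E"
proof -
  obtain i where i: "i \<in> U" using U_nonempty by blast
  then have "0 < card (nbhd i)" by (simp add: U_def nbhd_def card_gt_0_iff)
  moreover have "card (nbhd i) \<le> max_degree V E" using i by (intro degree_le_max) (simp add: U_def)
  ultimately show "1 \<le> max_degree V E" by simp
  have "finite V" "V \<noteq> {}" using graph i n_eq by (auto simp: simple_graph_def U_def)
  then show "max_degree V E \<le> card E"
    unfolding max_degree_def vertex_degree_def using finite_E by (auto intro!: card_mono)
qed

text \<open>
  With \<open>P\<close> the base of the polylogarithmic factor, the width is \<open>O(P \<Delta>)\<close>, hence there are \<open>O(P\<^sup>2 \<Delta> / \<epsilon>)\<close>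
  rounds. Each of them takes \<open>O(P)\<close> alternations, and each alternation \<open>O(P)\<close> steps for the prefix sums.
\<close>

lemma program_depth_le:
  assumes e: "0 < \<epsilon>" "\<epsilon> < 1"
  shows "real (program_depth \<epsilon>) \<le>
    9000000 * polylog 4 (card V) (card E) \<epsilon> * (real (max_degree V E) / \<epsilon>)"
proof -
  interpret solver nb width \<epsilon> by (rule solver[OF e])
  define P where "P = 1 + ln (real (card V)) + ln (real (card E)) + ln (1 / \<epsilon>)"
  define \<Delta> where "\<Delta> = real (max_degree V E)"
  define inner where "inner = lg (192 * width / \<epsilon>)"
  have m: "1 \<le> real (card E)" "1 \<le> \<Delta>" "\<Delta> \<le> real (card E)"
    using max_degree_bounds by (simp_all add: \<Delta>_def)
  have nV: "1 \<le> real (card V)" using src_bounds(3)[OF M_pos] n_eq(2) by simp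
  have lns: "0 \<le> ln (real (card V))" "0 \<le> ln (real (card E))" "0 \<le> ln (1 / \<epsilon>)"
    using m nV e by (simp_all add: ln_div)
  have P1: "1 \<le> P" "1 + ln (real (card V)) \<le> P" "ln (real (card E)) + ln (1 / \<epsilon>) \<le> P"
    using lns by (simp_all add: P_def)
  have ln2: "ln 2 \<le> (1::real)" using ln_le_minus_one[of 2] by simp
  have lnM: "0 \<le> ln (real M)" "ln (real M) \<le> P"
  proof -
    have "ln (real M) = ln 2 + ln (real (card E))" using m by (simp add: M_eq ln_mult)
    then show "ln (real M) \<le> P" using ln2 lns by (simp add: P_def)
    show "0 \<le> ln (real M)" using M_pos by simp
  qed
  have lgM: "real (lg (real M)) \<le> 3 * P" using lg_le[of "real M"] M_pos lnM P1 by simp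
  have lgn: "real (lg (real n + 1)) \<le> 3 * P"
  proof -
    have "ln (real n + 1) \<le> ln (2 * real (card V))" using nV n_eq(2) by simp
    also have "\<dots> \<le> 1 + ln (real (card V))" using nV ln2 by (simp add: ln_mult)
    finally have "2 * ln (real n + 1) + 1 \<le> 3 + 2 * ln (real (card V))" by simp
    also have "\<dots> \<le> 3 * P" using P1 by simp
    finally show ?thesis using lg_le[of "real n + 1"] by simp
  qed
  have w: "width \<le> 2 * P * \<Delta>"
  proof -
    have "width \<le> \<Delta> + P"
      using width_le[of "max_degree V E"] degree_le_max lnM(2) by (force simp: U_def \<Delta>_def)
    also have "\<dots> \<le> P * \<Delta> + P * \<Delta>" using P1 m(2) by (intro add_mono) auto
    finally show ?thesis by simp
  qed
  have inner: "real inner \<le> 23 * P"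
  proof -
    have "192 * width / \<epsilon> \<le> 512 * P * \<Delta> * (1 / \<epsilon>)"
    proof -
      have "192 * width \<le> 192 * (2 * P * \<Delta>)" using w by simp
      also have "\<dots> \<le> 512 * P * \<Delta>" using P1 m(2) by simp
      finally show ?thesis using e by (simp add: divide_right_mono)
    qed
    moreover have big: "1 \<le> 192 * width / \<epsilon>" using width_ge_1 e by (simp add: field_simps)
    ultimately have "ln (192 * width / \<epsilon>) \<le> ln (512 * P * \<Delta> * (1 / \<epsilon>))" by (intro ln_mono) auto
    also have "\<dots> = ln 512 + ln P + ln \<Delta> + ln (1 / \<epsilon>)"
      using P1 m(2) e by (simp add: ln_mult ln_div)
    also have "\<dots> \<le> 9 + P + ln (real (card E)) + ln (1 / \<epsilon>)"
    proof -
      have "ln (512::real) = ln (2 ^ 9)" by simp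
      also have "\<dots> = 9 * ln 2" by (subst ln_realpow) simp_all
      finally have "ln (512::real) \<le> 9" using ln2 by simp
      moreover have "ln P \<le> P" using ln_le_minus_one[of P] P1 by simp
      moreover have "ln \<Delta> \<le> ln (real (card E))" using m by simp
      ultimately show ?thesis by linarith
    qed
    also have "\<dots> \<le> 11 * P" using P1 by linarith
    finally show ?thesis using lg_le[OF big] P1 unfolding inner_def by linarith
  qed
  have PP: "P \<le> P ^ 2" "1 \<le> P ^ 2" using P1(1) by (simp_all add: self_le_power)
  have half: "real half_depth \<le> 7540 * P ^ 2"
  proof -
    have "real inner * (40 * real (lg (real M)) + 200) \<le> (23 * P) * (320 * P)"
      using inner lgM P1 by (intro mult_mono) auto
    then have "real inner * (40 * real (lg (real M)) + 200) \<le> 7360 * P ^ 2"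
      by (simp add: power2_eq_square)
    then show ?thesis unfolding half_depth_def solve_depth_def inner_def[symmetric]
      using lgM PP by simp
  qed
  have De: "1 \<le> \<Delta> / \<epsilon>" using m(2) e by (simp add: field_simps)
  have rounds: "real (nat \<lceil>rounds \<epsilon>\<rceil>) \<le> 593 * P ^ 2 * (\<Delta> / \<epsilon>)"
  proof -
    have "width * (1 + 36 * ln (real M)) \<le> (2 * P * \<Delta>) * (37 * P)"
      using w lnM P1 m(2) width_ge_1 by (intro mult_mono) auto
    then have "8 * (width * (1 + 36 * ln (real M))) / \<epsilon> \<le> 8 * ((2 * P * \<Delta>) * (37 * P)) / \<epsilon>"
      using e by (intro divide_right_mono mult_left_mono) auto
    then have "rounds \<epsilon> \<le> 592 * P ^ 2 * (\<Delta> / \<epsilon>)"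
      by (simp add: rounds_def power2_eq_square mult_ac)
    moreover have "1 * 1 \<le> P ^ 2 * (\<Delta> / \<epsilon>)" using PP(2) De by (intro mult_mono) auto
    moreover have "0 \<le> rounds \<epsilon>" unfolding rounds_def using lnM width_ge_1 e by simp
    ultimately show ?thesis by linarith
  qed
  define B where "B = P ^ 4 * (\<Delta> / \<epsilon>)"
  have PB: "P \<le> B" "1 \<le> B"
  proof -
    have "P ^ 1 \<le> P ^ 4" using P1 by (intro power_increasing) auto
    then have "P * 1 \<le> P ^ 4 * (\<Delta> / \<epsilon>)" using P1 De by (intro mult_mono) auto
    then show "P \<le> B" by (simp add: B_def)
    then show "1 \<le> B" using P1 by linarith
  qed
  have "real (nat \<lceil>rounds \<epsilon>\<rceil>) * (2 * real half_depth + 40) \<le> (593 * P ^ 2 * (\<Delta> / \<epsilon>)) * (15120 * P ^ 2)"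
    using rounds half PP De by (intro mult_mono) auto
  also have "\<dots> = 8966160 * B"
  proof -
    have "P ^ 2 * P ^ 2 = P ^ 4" by (simp flip: power_add)
    then show ?thesis by (simp add: B_def mult_ac)
  qed
  finally have main: "real (nat \<lceil>rounds \<epsilon>\<rceil>) * (2 * real half_depth + 40) \<le> 8966160 * B" .
  have "real (program_depth \<epsilon>) =
    (40 * real (lg (real n + 1)) + 60) + (30 + ((20 * real (lg (real M)) + 50) + (40 +
     ((real (nat \<lceil>rounds \<epsilon>\<rceil>) * (2 * real half_depth + 40) + 10) + (20 * real (lg (real M)) + 50)))))"
    by (simp add: program_depth_def locate_depth_def)
  also have "\<dots> \<le> 9000000 * B" using main lgM lgn PB by linarith
  finally show ?thesis by (simp add: B_def P_def \<Delta>_def polylog_def)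
qed

text \<open>
  Since the density \<open>\<rho>\<close> is at least \<open>1/2\<close>, an output between \<open>\<rho> - \<epsilon> / 4\<close> and \<open>\<rho>\<close> is a
  \<open>(1 + \<epsilon>)\<close>-approximation.
\<close>

lemma output_approximates:
  assumes e: "0 < \<epsilon>" "\<epsilon> < 1"
    and inv: "density_game.regret_inv U nbhd width (\<epsilon> / (96 * width)) k Z L"
    and k: "rounds \<epsilon> \<le> real k" and Z: "\<forall>i\<in>U. 0 \<le> Z i" "(\<Sum>i\<in>U. Z i) = real k"
  shows "approximates \<epsilon> \<rho> ((\<Sum>i\<in>U. \<Sum>j\<in>nbhd i. min (Z i) (Z j)) / (2 * real k))"
proof -
  interpret solver nb width \<epsilon> by (rule solver[OF e])
  let ?S = "game.arc_sum (\<lambda>i j. min (Z i) (Z j))"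
  have "0 < rounds \<epsilon>" unfolding rounds_def
    using width_ge_1 e M_pos by (intro divide_pos_pos mult_pos_pos) (auto intro: add_pos_nonneg)
  then have kpos: "0 < real k" using k by linarith
  obtain I where I: "I \<subseteq> U" "I \<noteq> {}"
    "2 * \<rho> \<le> (\<Sum>i\<in>I. real (card (nbhd i \<inter> I))) / real (card I)"
    by (rule densest_set)
  have lower: "\<rho> - \<epsilon> / 4 \<le> ?S / (2 * real k)"
    using density_le_average[OF inv k[unfolded rounds_def] I(1,2)] I(3)
    by (simp add: game.inner_arcs_def)
  have "?S \<le> 2 * \<rho> * (\<Sum>i\<in>U. Z i)"
    using inner_arcs_le_density Z(1)
    by (intro game.min_sum_le_density) (simp_all add: game.inner_arcs_def)
  then have upper: "?S / (2 * real k) \<le> \<rho>" using kpos Z(2) by (simp add: field_simps)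
  have \<rho>: "1 / 2 \<le> \<rho>" by (rule density_ge_half)
  have "\<rho> \<le> (1 + \<epsilon>) * (\<rho> - \<epsilon> / 4)"
  proof -
    have "\<epsilon> * (1 / 2) \<le> \<epsilon> * \<rho>" using \<rho> e by (intro mult_left_mono) auto
    moreover have "\<epsilon> * \<epsilon> \<le> \<epsilon> * 1" using e by (intro mult_left_mono) auto
    ultimately show ?thesis by (simp add: algebra_simps)
  qed
  then have "\<rho> / (1 + \<epsilon>) \<le> \<rho> - \<epsilon> / 4" using e by (simp add: pos_divide_le_eq mult.commute)
  then have "\<rho> / (1 + \<epsilon>) \<le> ?S / (2 * real k)" using lower by linarith
  moreover have "\<rho> \<le> (1 + \<epsilon>) * \<rho>" using \<rho> e by simp
  ultimately show ?thesis using upper by (simp add: approximates_def)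
qed

end

theorem corollaryC1:
  shows "\<exists>(prog :: com) (C :: real) (k :: nat).
    \<forall>(\<epsilon> :: real) (V :: nat set) (E :: nat set set) (vs :: nat list) (nb :: nat list list).
      0 < \<epsilon> \<and> \<epsilon> < 1 \<and> simple_graph V E \<and> E \<noteq> {} \<and> adjacency_lists V E vs nb \<longrightarrow>
      (\<exists>work depth s.
         runs prog (input_store \<epsilon> nb) work depth s \<and>
         approximates \<epsilon> (max_subgraph_density V E) (output_value s) \<and>
         real depth \<le> C * polylog k (card V) (card E) \<epsilon> * (real (max_degree V E) / \<epsilon>) \<and>
         real work \<le> C * polylog k (card V) (card E) \<epsilon> *
           (real (max_degree V E) * real (card E) / \<epsilon>))"
proof -
  have "\<exists>work depth s.
      runs density_program (input_store \<epsilon> nb) work depth s \<and>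
      approximates \<epsilon> (max_subgraph_density V E) (output_value s) \<and>
      real depth \<le> 1800000000 * polylog 4 (card V) (card E) \<epsilon> * (real (max_degree V E) / \<epsilon>) \<and>
      real work \<le> 1800000000 * polylog 4 (card V) (card E) \<epsilon> *
        (real (max_degree V E) * real (card E) / \<epsilon>)"
    if *: "0 < \<epsilon> \<and> \<epsilon> < 1 \<and> simple_graph V E \<and> E \<noteq> {} \<and> adjacency_lists V E vs nb"
    for \<epsilon> :: real and V :: "nat set" and E :: "nat set set" and vs :: "nat list" and nb :: "nat list list"
  proof -
    interpret adjacency_graph V E vs nb by unfold_locales (use * in auto)
    have e: "0 < \<epsilon>" "\<epsilon> < 1" using * by auto
    let ?B = "polylog 4 (card V) (card E) \<epsilon> * (real (max_degree V E) / \<epsilon>)"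
    from executes_density_program[OF e] obtain w d t k Z L where
      run: "runs density_program (input_store \<epsilon> nb) w d t" "w \<le> 100 * M * d" "d \<le> program_depth \<epsilon>"
      and out: "rounds \<epsilon> \<le> real k" "density_game.regret_inv U nbhd width (\<epsilon> / (96 * width)) k Z L"
        "\<forall>i\<in>U. 0 \<le> Z i" "(\<Sum>i\<in>U. Z i) = real k"
        "output_value t = (\<Sum>i\<in>U. \<Sum>j\<in>nbhd i. min (Z i) (Z j)) / (2 * real k)"
      unfolding executes_def by blast
    have d: "real d \<le> 9000000 * ?B" using run(3) program_depth_le[OF e] by (simp add: mult.assoc)
    have "0 \<le> real d" by simp
    then have B: "0 \<le> ?B" using d by linarith
    have "real w \<le> 200 * real (card E) * real d"
      using run(2) by (simp add: M_eq flip: of_nat_mult) (metis of_nat_le_iff of_nat_mult of_nat_numeral)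
    also have "\<dots> \<le> 200 * real (card E) * (9000000 * ?B)" using d by (intro mult_left_mono) auto
    finally have w: "real w \<le> 1800000000 * (real (card E) * ?B)" by simp
    have d': "real d \<le> 1800000000 * ?B" using d B by linarith
    have "approximates \<epsilon> \<rho> (output_value t)"
      unfolding out(5) by (rule output_approximates[OF e out(2,1,3,4)])
    with run(1) d' w show ?thesis
      by (intro exI[of _ w] exI[of _ d] exI[of _ t]) (simp add: mult_ac)
  qed
  then show ?thesis by blast
qed

end
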